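(* Let $g\ge 2$ and consider the multicurve $\mathcal C=\{a_1,\dots,a_g\}$ in $S_g$. Then there exists a root $F\in\mathrm{Mod}(S_g)$ of $T_{\mathcal C}$ of degree $g$, i.e. $F^g=T_{\mathcal C}=\prod_{i=1}^g T_{a_i}$, of the form $$F=G\,T_{a_1},$$ where $G\in\mathrm{Mod}(S_g)$ is a periodic mapping class of order $g$ with data set $D_G=(g,1;(1,g),(g-1,g))$.
   Context: $S_g$ is the closed orientable surface of genus $g$, $\mathrm{Mod}(S_g)$ its mapping class group, $T_x$ the left-handed Dehn twist about a simple closed curve $x$. For a multicurve (a finite collection of pairwise disjoint, non-isotopic essential simple closed curves) $\mathcal C=\{x_1,\dots,x_n\}$, $T_{\mathcal C}:=\prod_i T_{x_i}$; a root of $T_{\mathcal C}$ of degree $n$ is an $F$ with $F^n=T_{\mathcal C}$. Curves: view $S_g$ as the double of a disk with $g$ open holes in a horizontal row numbered $1,\dots,g$; $a_i$ is the double of a vertical arc going down from hole $i$ to the outer boundary. $D_G=(g,1;(1,g),(g-1,g))$ means that $G$ is represented by an orientation-preserving homeomorphism of $S_g$ of order $g$ whose quotient orbifold has genus $1$ and exactly two cone points, both of order $g$, coming from two fixed points with local rotation angles $2\pi/g$ and $2\pi(g-1)/g$; such a $G$ is unique up to conjugacy (it is the rotation of $S_g$ by $2\pi/g$ about an axis, with two fixed points). *)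

theory Defs
  imports
    "HOL-Complex_Analysis.Complex_Analysis"
    "HOL-Algebra.Bij"
    "HOL-Algebra.Multiplicative_Group"
begin

section \<open>The surface\<close>

text \<open>The plane is \<^typ>\<open>complex\<close>.  The disk is a closed rectangle; its holes are \<open>h\<close> open
  squares, numbered \<open>1, \<dots>, h\<close> from left to right and centred on the line \<open>Im z = 1\<close>.\<close>

definition holed_disk :: "nat \<Rightarrow> complex set" where
  "holed_disk h = cbox 0 (Complex (real h + 1) 2)
     - (\<Union>i\<in>{1..h}. box (Complex (real i - 1/4) (3/4)) (Complex (real i + 1/4) (5/4)))"

text \<open>The double of a closed planar region \<open>P\<close>, i.e. two copies of \<open>P\<close> glued along the frontier,
  is realised as a subspace of three-space: the two copies are the graphs of \<open>d\<close> and \<open>-d\<close>, where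
  \<open>d\<close> is the distance to the frontier.\<close>

definition double :: "complex set \<Rightarrow> (complex \<times> real) set" where
  "double P = {(p, t). p \<in> P \<and> \<bar>t\<bar> = infdist p (frontier P)}"

text \<open>The closed orientable surface of genus \<open>h\<close>.\<close>

definition surf :: "nat \<Rightarrow> (complex \<times> real) set" where
  "surf h = double (holed_disk h)"

abbreviation Surf :: "nat \<Rightarrow> (complex \<times> real) topology" where
  "Surf h \<equiv> top_of_set (surf h)"

text \<open>The curve \<open>a\<^sub>i\<close>: the double of the vertical segment from the bottom of hole \<open>i\<close> down to the
  outer boundary.\<close>

definition curve_a :: "nat \<Rightarrow> nat \<Rightarrow> (complex \<times> real) set" where
  "curve_a h i = {x \<in> surf h. Re (fst x) = real i \<and> Im (fst x) \<le> 3/4}"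


section \<open>Orientation\<close>

text \<open>The local degree of \<open>f\<close> at \<open>z\<close> is \<open>d\<close>: small positively oriented circles about \<open>z\<close> are mapped
  to loops that wind \<open>d\<close> times around \<open>f z\<close>.\<close>

definition local_degree :: "(complex \<Rightarrow> complex) \<Rightarrow> complex \<Rightarrow> real \<Rightarrow> bool" where
  "local_degree f z d \<longleftrightarrow>
     (\<forall>\<^sub>F r in at_right 0. winding_number (f \<circ> circlepath z r) (f z) = of_real d)"

text \<open>The surface is oriented so that the projection to the plane preserves the orientation on the
  upper copy \<open>t > 0\<close> and reverses it on the lower copy \<open>t < 0\<close>.  The seam \<open>t = 0\<close> contains no
  nonempty open subset of the surface, so an embedding of a plane region is
  orientation-preserving iff it is so at the interior points that it does not map to the seam.\<close>

definition oriented_embedding :: "nat \<Rightarrow> complex set \<Rightarrow> (complex \<Rightarrow> complex \<times> real) \<Rightarrow> bool" where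
  "oriented_embedding h U \<phi> \<longleftrightarrow>
     embedding_map (top_of_set U) (Surf h) \<phi> \<and>
     (\<forall>z\<in>interior U. snd (\<phi> z) \<noteq> 0 \<longrightarrow> local_degree (fst \<circ> \<phi>) z (sgn (snd (\<phi> z))))"


section \<open>The mapping class group\<close>

text \<open>Orientation-preserving homeomorphisms, extensional so that they are elements of
  \<^term>\<open>BijGroup (surf h)\<close>.  The equivalence, rather than an implication, makes it evident that
  inverses preserve the orientation as well.\<close>

definition homeo_plus :: "nat \<Rightarrow> (complex \<times> real \<Rightarrow> complex \<times> real) set" where
  "homeo_plus h = {f \<in> extensional (surf h). homeomorphic_map (Surf h) (Surf h) f \<and>
     (\<forall>\<phi>. \<phi> ` ball 0 1 \<subseteq> surf h \<longrightarrow>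
        (oriented_embedding h (ball 0 1) \<phi> \<longleftrightarrow> oriented_embedding h (ball 0 1) (f \<circ> \<phi>)))}"

definition homeo_group :: "nat \<Rightarrow> (complex \<times> real \<Rightarrow> complex \<times> real) monoid" where
  "homeo_group h = (BijGroup (surf h))\<lparr>carrier := homeo_plus h\<rparr>"

text \<open>Homeomorphisms isotopic to the identity: every stage of the homotopy is required to be in
  \<^const>\<open>homeo_plus\<close>.\<close>

definition homeo_0 :: "nat \<Rightarrow> (complex \<times> real \<Rightarrow> complex \<times> real) set" where
  "homeo_0 h = {f \<in> homeo_plus h.
     homotopic_with (\<lambda>k. restrict k (surf h) \<in> homeo_plus h) (Surf h) (Surf h) id f}"

definition MCG :: "nat \<Rightarrow> (complex \<times> real \<Rightarrow> complex \<times> real) set monoid" where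
  "MCG h = homeo_group h Mod homeo_0 h"

definition mapping_class ::
    "nat \<Rightarrow> (complex \<times> real \<Rightarrow> complex \<times> real) \<Rightarrow> (complex \<times> real \<Rightarrow> complex \<times> real) set" where
  "mapping_class h f = homeo_0 h #>\<^bsub>homeo_group h\<^esub> f"


section \<open>Dehn twists\<close>

definition annulus :: "complex set" where
  "annulus = {z. 1 \<le> norm z \<and> norm z \<le> 2}"

text \<open>The left-handed twist of the annulus with its planar orientation, in polar coordinates
  \<open>(r, \<theta>) \<mapsto> (r, \<theta> + 2 \<pi> (r - 1))\<close>: an arc that crosses the annulus is turned to the left.\<close>

definition model_twist :: "complex \<Rightarrow> complex" where
  "model_twist z = z * cis (2 * pi * (norm z - 1))"

text \<open>An orientation-preserving parametrisation of an annular neighbourhood of the curve \<open>c\<close>.\<close>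

definition annulus_about ::
    "nat \<Rightarrow> (complex \<times> real) set \<Rightarrow> (complex \<Rightarrow> complex \<times> real) \<Rightarrow> bool" where
  "annulus_about h c \<alpha> \<longleftrightarrow> oriented_embedding h annulus \<alpha> \<and> \<alpha> ` sphere 0 (3/2) = c"

definition twist_map ::
    "nat \<Rightarrow> (complex \<Rightarrow> complex \<times> real) \<Rightarrow> complex \<times> real \<Rightarrow> complex \<times> real" where
  "twist_map h \<alpha> = (\<lambda>x\<in>surf h.
     if x \<in> \<alpha> ` annulus then \<alpha> (model_twist (inv_into annulus \<alpha> x)) else x)"

text \<open>The Dehn twist about the curve \<open>c\<close> is the class \<open>dehn_twist h \<alpha>\<close> for any \<open>\<alpha>\<close> such that
  \<open>annulus_about h c \<alpha>\<close>; this class does not depend on the choice of \<open>\<alpha>\<close>.\<close>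

definition dehn_twist ::
    "nat \<Rightarrow> (complex \<Rightarrow> complex \<times> real) \<Rightarrow> (complex \<times> real \<Rightarrow> complex \<times> real) set" where
  "dehn_twist h \<alpha> = mapping_class h (twist_map h \<alpha>)"

text \<open>For \<open>a\<^sub>i\<close> the annular neighbourhood is taken to be the double of the vertical strip of
  half-width \<open>1/8\<close> around the segment.  On the upper copy the polar angle runs through
  \<open>[0, \<pi>]\<close> from the top of the strip to its bottom, and on the lower copy it runs back up; the
  radial coordinate points to the left, which makes the parametrisation orientation-preserving.\<close>

definition strip_a :: "nat \<Rightarrow> complex \<Rightarrow> complex" where
  "strip_a i z = Complex (real i - (2 * norm z - 3) / 8) (3/8 * (1 + Re z / norm z))"

definition nbhd_a :: "nat \<Rightarrow> nat \<Rightarrow> complex \<Rightarrow> complex \<times> real" where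
  "nbhd_a h i z =
     (strip_a i z, sgn (Im z) * infdist (strip_a i z) (frontier (holed_disk h)))"

definition T_a :: "nat \<Rightarrow> nat \<Rightarrow> (complex \<times> real \<Rightarrow> complex \<times> real) set" where
  "T_a h i = dehn_twist h (nbhd_a h i)"

text \<open>The product \<open>T\<^sub>1 \<cdots> T\<^sub>h\<close> of the twists about the curves \<open>a\<^sub>1, \<dots>, a\<^sub>h\<close> (which commute, so that
  the order is immaterial).\<close>

definition multitwist_a :: "nat \<Rightarrow> (complex \<times> real \<Rightarrow> complex \<times> real) set" where
  "multitwist_a h = foldr (\<lambda>i t. T_a h i \<otimes>\<^bsub>MCG h\<^esub> t) [1..<Suc h] \<one>\<^bsub>MCG h\<^esub>"


subsection \<open>The parametrisation \<open>nbhd_a\<close> is an annular neighbourhood of \<open>a\<^sub>i\<close>\<close>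

lemma compact_annulus: "compact annulus"
proof -
  have "annulus = cball 0 2 - ball 0 1"
    by (auto simp: annulus_def)
  then show ?thesis
    by (metis compact_cball compact_diff open_ball)
qed

lemma strip_frontier:
  assumes i: "i \<in> {1..h}" and x: "\<bar>Re p - real i\<bar> \<le> 1/8" and y: "0 \<le> Im p" "Im p \<le> 3/4"
  shows strip_in: "p \<in> holed_disk h"
    and strip_infdist: "infdist p (frontier (holed_disk h)) = 0 \<longleftrightarrow> Im p = 0 \<or> Im p = 3/4"
proof -
  let ?P = "holed_disk h"
  have ih: "1 \<le> real i" "real i \<le> real h"
    using i by auto
  have inP: "q \<in> ?P" if "\<bar>Re q - real i\<bar> \<le> 1/2" "0 \<le> Im q" "Im q \<le> 3/4" for q
  proof -
    have "0 \<le> Re q" "Re q \<le> real h + 1"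
      using that(1) ih by (simp_all only: abs_le_iff) linarith+
    then show ?thesis
      using that by (auto simp: holed_disk_def in_cbox_complex_iff in_box_complex_iff)
  qed
  show p: "p \<in> ?P"
    using inP x y by simp
  have clP: "closed ?P"
    by (auto simp: holed_disk_def intro!: closed_Diff open_UN open_box)
  have int: "q \<in> interior ?P" if "\<bar>Re q - real i\<bar> \<le> 1/8" "0 < Im q" "Im q < 3/4" for q
  proof (rule interiorI)
    show "open (box (Complex (real i - 1/2) 0) (Complex (real i + 1/2) (3/4)))"
      by (rule open_box)
    show "q \<in> box (Complex (real i - 1/2) 0) (Complex (real i + 1/2) (3/4))"
      using that unfolding in_box_complex_iff complex.sel abs_diff_le_iff greaterThanLessThan_iff
      by (intro conjI) linarith+
    show "box (Complex (real i - 1/2) 0) (Complex (real i + 1/2) (3/4)) \<subseteq> ?P"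
    proof
      fix w assume "w \<in> box (Complex (real i - 1/2) 0) (Complex (real i + 1/2) (3/4))"
      then have "\<bar>Re w - real i\<bar> \<le> 1/2 \<and> 0 \<le> Im w \<and> Im w \<le> 3/4"
        unfolding in_box_complex_iff complex.sel abs_diff_le_iff greaterThanLessThan_iff
        by (intro conjI) linarith+
      then show "w \<in> ?P"
        using inP by blast
    qed
  qed
  have bd: "q \<in> frontier ?P" if q: "\<bar>Re q - real i\<bar> \<le> 1/8" "Im q = 0 \<or> Im q = 3/4" for q
  proof -
    have "q \<notin> interior ?P"
    proof
      assume "q \<in> interior ?P"
      then obtain e where e: "e > 0" "ball q e \<subseteq> ?P"
        by (meson mem_interior)
      define d where "d = min (e/2) (1/4)"
      have d: "0 < d" "d < e" "d \<le> 1/4"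
        using e by (auto simp: d_def)
      show False
      proof (cases "Im q = 0")
        case True
        have "q - d *\<^sub>R \<i> \<in> ball q e"
          using d by (simp add: dist_norm)
        then have "q - d *\<^sub>R \<i> \<in> ?P"
          using e by blast
        then show False
          using True d by (auto simp: holed_disk_def in_cbox_complex_iff)
      next
        case False
        have "q + d *\<^sub>R \<i> \<in> ball q e"
          using d by (simp add: dist_norm)
        then have "q + d *\<^sub>R \<i> \<in> ?P"
          using e by blast
        moreover have "q + d *\<^sub>R \<i> \<in> box (Complex (real i - 1/4) (3/4)) (Complex (real i + 1/4) (5/4))"
          using False q d unfolding abs_diff_le_iff by (simp add: in_box_complex_iff)
        ultimately show False
          using i by (auto simp: holed_disk_def)
      qed
    qed
    moreover have "q \<in> ?P"
      using inP[of q] q by linarith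
    ultimately show ?thesis
      using clP by (simp add: frontier_def)
  qed
  have ne: "frontier ?P \<noteq> {}"
    using bd[of "Complex (real i) 0"] by force
  have "infdist p (frontier ?P) = 0 \<longleftrightarrow> p \<in> frontier ?P"
    using in_closed_iff_infdist_zero[OF frontier_closed ne] by blast
  also have "\<dots> \<longleftrightarrow> Im p = 0 \<or> Im p = 3/4"
    using bd[OF x] int[OF x] y unfolding frontier_def by force
  finally show "infdist p (frontier ?P) = 0 \<longleftrightarrow> Im p = 0 \<or> Im p = 3/4" .
qed

lemma abs_Re_div_norm: "\<bar>Re z / norm z\<bar> \<le> 1"
  using abs_Re_le_cmod[of z] by (cases "z = 0") (auto simp: divide_simps)

lemma Re_div_norm_eq_iff:
  assumes "z \<noteq> 0"
  shows "\<bar>Re z / norm z\<bar> = 1 \<longleftrightarrow> Im z = 0"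
proof -
  have "\<bar>Re z / norm z\<bar> = 1 \<longleftrightarrow> \<bar>Re z\<bar> = norm z"
    using assms by (auto simp: abs_divide)
  also have "\<dots> \<longleftrightarrow> \<bar>Re z\<bar>\<^sup>2 = (norm z)\<^sup>2"
    by (rule power2_eq_iff_nonneg [symmetric]) auto
  also have "\<dots> \<longleftrightarrow> Im z = 0"
    by (simp add: cmod_power2)
  finally show ?thesis .
qed

lemma strip_a_bounds:
  assumes "z \<in> annulus"
  shows "\<bar>Re (strip_a i z) - real i\<bar> \<le> 1/8" "0 \<le> Im (strip_a i z)" "Im (strip_a i z) \<le> 3/4"
    and "Im (strip_a i z) = 0 \<or> Im (strip_a i z) = 3/4 \<longleftrightarrow> Im z = 0"
proof -
  have z: "1 \<le> norm z" "norm z \<le> 2" "z \<noteq> 0"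
    using assms by (auto simp: annulus_def)
  show "\<bar>Re (strip_a i z) - real i\<bar> \<le> 1/8"
    using z by (simp add: strip_a_def)
  show "0 \<le> Im (strip_a i z)" "Im (strip_a i z) \<le> 3/4"
  proof -
    have "0 \<le> 1 + Re z / norm z" "Re z / norm z \<le> 1"
      using abs_Re_div_norm[of z] unfolding abs_le_iff by linarith+
    then have "0 \<le> 3/8 * (1 + Re z / norm z)" "3/8 * (1 + Re z / norm z) \<le> 3/4"
      by simp_all
    then show "0 \<le> Im (strip_a i z)" "Im (strip_a i z) \<le> 3/4"
      by (simp_all only: strip_a_def complex.sel)
  qed
  show "Im (strip_a i z) = 0 \<or> Im (strip_a i z) = 3/4 \<longleftrightarrow> Im z = 0"
  proof -
    have "3/8 * (1 + u) = 0 \<or> 3/8 * (1 + u) = 3/4 \<longleftrightarrow> \<bar>u\<bar> = 1" for u :: real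
      by (simp add: abs_if) arith
    then show ?thesis
      unfolding strip_a_def complex.sel Re_div_norm_eq_iff[OF z(3), symmetric] .
  qed
qed

lemma nbhd_a_infdist:
  assumes "i \<in> {1..h}" "z \<in> annulus"
  shows "infdist (strip_a i z) (frontier (holed_disk h)) = 0 \<longleftrightarrow> Im z = 0"
  using strip_infdist[OF assms(1) strip_a_bounds(1-3)[OF assms(2)]] strip_a_bounds(4)[OF assms(2)]
  by (rule trans)

lemma nbhd_a_in_surf:
  assumes "i \<in> {1..h}" "z \<in> annulus"
  shows "nbhd_a h i z \<in> surf h"
  using strip_in[OF assms(1) strip_a_bounds(1-3)[OF assms(2)]] nbhd_a_infdist[OF assms]
  by (auto simp: nbhd_a_def surf_def double_def abs_mult infdist_nonneg abs_sgn_eq)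

lemma continuous_on_nbhd_a:
  assumes "i \<in> {1..h}"
  shows "continuous_on annulus (nbhd_a h i)"
proof -
  let ?k = "\<lambda>z. infdist (strip_a i z) (frontier (holed_disk h))"
  have s: "continuous_on annulus (strip_a i)"
    unfolding strip_a_def Complex_eq
    by (intro continuous_intros) (auto simp: annulus_def)
  have k: "continuous_on annulus ?k"
    by (intro continuous_intros s)
  have "continuous_on annulus (\<lambda>z. if Im z \<le> 0 then - ?k z else ?k z)"
  proof (rule continuous_on_cases_le)
    show "- ?k z = ?k z" if "z \<in> annulus" "Im z = 0" for z
      using nbhd_a_infdist[OF assms that(1)] that(2) by simp
  qed (auto intro!: continuous_intros continuous_on_subset[OF k])
  moreover have "(if Im z \<le> 0 then - ?k z else ?k z) = sgn (Im z) * ?k z" if "z \<in> annulus" for z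
    using nbhd_a_infdist[OF assms that] by (auto simp: sgn_if)
  ultimately have "continuous_on annulus (\<lambda>z. sgn (Im z) * ?k z)"
    by (simp cong: continuous_on_cong)
  then show ?thesis
    unfolding nbhd_a_def by (intro continuous_on_Pair s)
qed

lemma inj_on_nbhd_a:
  assumes "i \<in> {1..h}"
  shows "inj_on (nbhd_a h i) annulus"
proof (rule inj_onI)
  fix z w assume zw: "z \<in> annulus" "w \<in> annulus" and eq: "nbhd_a h i z = nbhd_a h i w"
  have st: "strip_a i z = strip_a i w"
    using eq by (simp add: nbhd_a_def)
  have n: "norm z = norm w" and nz: "norm w \<noteq> 0"
    using st zw by (auto simp: strip_a_def annulus_def)
  have re: "Re z = Re w"
    using st n nz by (simp add: strip_a_def)
  have "(Re z)\<^sup>2 + (Im z)\<^sup>2 = (Re w)\<^sup>2 + (Im w)\<^sup>2"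
    using n by (metis cmod_power2)
  then have im: "\<bar>Im z\<bar> = \<bar>Im w\<bar>"
    using re by (simp add: abs_eq_iff power2_eq_iff)
  have "sgn (Im z) = sgn (Im w)"
    using eq nbhd_a_infdist[OF assms zw(1)] im st by (auto simp: nbhd_a_def)
  then have "Im z = Im w"
    using im by (metis mult_sgn_abs)
  with re show "z = w"
    by (simp add: complex_eq_iff)
qed

lemma nbhd_a_core:
  assumes "i \<in> {1..h}"
  shows "nbhd_a h i ` sphere 0 (3/2) = curve_a h i"
proof
  have sub: "sphere 0 (3/2) \<subseteq> annulus"
    by (auto simp: annulus_def)
  show "nbhd_a h i ` sphere 0 (3/2) \<subseteq> curve_a h i"
    using sub nbhd_a_in_surf[OF assms] strip_a_bounds(3)
    by (auto simp: curve_a_def nbhd_a_def strip_a_def)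
  show "curve_a h i \<subseteq> nbhd_a h i ` sphere 0 (3/2)"
  proof
    fix x assume x: "x \<in> curve_a h i"
    obtain p t where pt: "x = (p, t)"
      by (cases x)
    let ?d = "infdist p (frontier (holed_disk h))"
    have p: "p \<in> holed_disk h" "\<bar>t\<bar> = ?d" "Re p = real i" "Im p \<le> 3/4"
      using x by (auto simp: pt curve_a_def surf_def double_def)
    then have y: "0 \<le> Im p"
      by (auto simp: holed_disk_def in_cbox_complex_iff)
    define c where "c = 8/3 * Im p - 1"
    define s where "s = (if t < 0 then -1 else 1) * sqrt (1 - c\<^sup>2)"
    have c1: "\<bar>c\<bar> \<le> 1"
      using p y by (auto simp: c_def abs_le_iff)
    then have c2: "c\<^sup>2 \<le> 1"
      by (simp add: abs_square_le_1)
    then have cs: "c\<^sup>2 + s\<^sup>2 = 1"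
      by (simp add: s_def power_mult_distrib)
    define z where "z = (3/2) *\<^sub>R Complex c s"
    have nz: "norm z = 3/2"
    proof -
      have "norm (Complex c s) = 1"
        using cs by (simp add: cmod_def)
      then show ?thesis
        by (simp add: z_def)
    qed
    have st: "strip_a i z = p"
    proof -
      have "Re z / norm z = c"
        unfolding nz by (simp add: z_def)
      then show ?thesis
        using p(3) by (simp add: strip_a_def complex_eq_iff nz) (simp add: c_def)
    qed
    have dz: "?d = 0 \<longleftrightarrow> Im z = 0"
      using nbhd_a_infdist[OF assms, of z] nz by (simp add: st annulus_def)
    have "sgn (Im z) * ?d = t"
    proof (cases "Im z = 0")
      case True
      with dz p show ?thesis by simp
    next
      case False
      then have "sgn (Im z) = (if t < 0 then -1 else 1)"
        using c2 by (auto simp: z_def s_def sgn_mult zero_less_mult_iff sgn_if split: if_splits)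
      then show ?thesis
        using p by auto
    qed
    then have "nbhd_a h i z = x"
      by (simp add: nbhd_a_def st pt)
    with nz show "x \<in> nbhd_a h i ` sphere 0 (3/2)"
      by force
  qed
qed

lemma winding_number_scaled_circle:
  assumes "c \<noteq> 0"
  shows "winding_number (\<lambda>t. c * exp (2 * of_real pi * \<i> * of_real t)) 0 = 1"
proof -
  let ?g = "\<lambda>t::real. c * exp (2 * of_real pi * \<i> * of_real t)"
  have der: "(?g has_vector_derivative (2 * of_real pi * \<i> * ?g t)) (at t within X)" for t X
    by (auto intro!: derivative_eq_intros has_vector_derivative_real_field simp: algebra_simps)
  have "valid_path ?g"
    unfolding valid_path_def
    by (rule C1_differentiable_imp_piecewise)
       (auto simp: C1_differentiable_on_def intro!: exI[of _ "\<lambda>t. 2 * of_real pi * \<i> * ?g t"] der continuous_intros)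
  moreover have "0 \<notin> path_image ?g"
    using assms by (auto simp: path_image_def)
  ultimately have "winding_number ?g 0 = 1 / (2 * of_real pi * \<i>) * contour_integral ?g (\<lambda>w. 1 / (w - 0))"
    using winding_number_valid_path by simp
  also have "contour_integral ?g (\<lambda>w. 1 / (w - 0)) = 2 * of_real pi * \<i>"
  proof (rule contour_integral_unique)
    have "((\<lambda>t::real. 2 * of_real pi * \<i>) has_integral (2 * of_real pi * \<i>)) {0..1}"
      using has_integral_const_real[of "2 * of_real pi * \<i>" 0 1] by simp
    then show "((\<lambda>w. 1 / (w - 0)) has_contour_integral 2 * of_real pi * \<i>) ?g"
      unfolding has_contour_integral
      using assms by (simp add: vector_derivative_at[OF der])
  qed
  finally show ?thesis by simp
qed

lemma winding_number_same_quadrants: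
  assumes "path \<gamma>" "path \<delta>" "pathfinish \<gamma> = pathstart \<gamma>" "pathfinish \<delta> = pathstart \<delta>"
    and "\<And>t. t \<in> {0..1} \<Longrightarrow> \<gamma> t \<noteq> 0"
    and "\<And>t. t \<in> {0..1} \<Longrightarrow> sgn (Re (\<delta> t)) = sgn (Re (\<gamma> t)) \<and> sgn (Im (\<delta> t)) = sgn (Im (\<gamma> t))"
  shows "winding_number \<delta> 0 = winding_number \<gamma> 0"
proof (rule winding_number_loops_linear_eq)
  have *: "x = 0" if "(1 - u) * x + u * y = 0" "sgn y = sgn x" "0 \<le> u" "u \<le> 1" for u x y :: real
  proof (rule ccontr)
    assume "x \<noteq> 0"
    have "(1 - u) * \<bar>x\<bar> + u * \<bar>y\<bar> = sgn x * ((1 - u) * x + u * y)"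
      using that(2) by (simp add: algebra_simps abs_sgn)
    also have "\<dots> = 0"
      using that by simp
    finally have "(1 - u) * \<bar>x\<bar> + u * \<bar>y\<bar> = 0" .
    moreover have "(1 - u) * \<bar>x\<bar> \<ge> 0" "u * \<bar>y\<bar> \<ge> 0"
      using that by auto
    ultimately have "(1 - u) * \<bar>x\<bar> = 0 \<and> u * \<bar>y\<bar> = 0"
      by linarith
    with \<open>x \<noteq> 0\<close> have "y = 0"
      by auto
    with that(2) \<open>x \<noteq> 0\<close> show False
      by (simp add: sgn_zero_iff)
  qed
  show "0 \<notin> closed_segment (\<gamma> t) (\<delta> t)" if t: "t \<in> {0..1}" for t
  proof
    assume "0 \<in> closed_segment (\<gamma> t) (\<delta> t)"
    then obtain u where u: "0 \<le> u" "u \<le> 1" "0 = (1 - u) *\<^sub>R \<gamma> t + u *\<^sub>R \<delta> t"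
      by (auto simp: closed_segment_def)
    then have re: "(1 - u) * Re (\<gamma> t) + u * Re (\<delta> t) = 0" and im: "(1 - u) * Im (\<gamma> t) + u * Im (\<delta> t) = 0"
      by (metis plus_complex.sel(1) scaleR_complex.sel(1) zero_complex.sel(1),
          metis plus_complex.sel(2) scaleR_complex.sel(2) zero_complex.sel(2))
    have "Re (\<gamma> t) = 0" "Im (\<gamma> t) = 0"
      using *[OF re _ u(1,2)] *[OF im _ u(1,2)] assms(6)[OF t] by auto
    with assms(5)[OF t] show False
      by (simp add: complex_eq_iff)
  qed
qed (rule assms)+

lemma sgn_cos_diff:
  assumes "0 < x" "x < pi" "0 < y" "y < pi"
  shows "sgn (cos x - cos y) = - sgn (x - y)"
proof (cases x y rule: linorder_cases)
  case less
  then have "cos y < cos x"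
    using assms by (intro cos_monotone_0_pi) auto
  with less show ?thesis by simp
next
  case equal
  then show ?thesis by simp
next
  case greater
  then have "cos x < cos y"
    using assms by (intro cos_monotone_0_pi) auto
  with greater show ?thesis by simp
qed

lemma local_degree_strip_a:
  assumes z: "Im z \<noteq> 0"
  shows "local_degree (strip_a i) z (sgn (Im z))"
proof -
  have z0: "z \<noteq> 0" "z \<notin> \<real>\<^sub>\<le>\<^sub>0"
    using z by (auto simp: complex_nonpos_Reals_iff)
  have "(Ln has_field_derivative inverse z) (at z)"
    using z0 by (intro has_field_derivative_Ln) auto
  then have "(Ln has_derivative (\<lambda>x. inverse z * x)) (at z)"
    by (simp add: has_field_derivative_def)
  moreover have "inverse (norm z) / 2 > 0"
    using z0 by simp
  ultimately obtain e1 where e1: "e1 > 0"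
    "\<And>w. norm (w - z) < e1 \<Longrightarrow> norm (Ln w - Ln z - inverse z * (w - z)) \<le> inverse (norm z) / 2 * norm (w - z)"
    unfolding has_derivative_at_alt by blast
  define e where "e = min e1 \<bar>Im z\<bar>"
  have e: "e > 0"
    using e1 z by (simp add: e_def)
  have "winding_number (strip_a i \<circ> circlepath z r) (strip_a i z) = of_real (sgn (Im z))"
    if r: "0 < r" "r < e" for r
  proof -
    let ?c = "circlepath z r"
    let ?l = "\<lambda>t. Ln (?c t) - Ln z"
    let ?g = "\<lambda>t::real. (- r * inverse z) * exp (2 * of_real pi * \<i> * of_real t)"
    let ?s = "\<lambda>t. strip_a i (?c t) - strip_a i z"
    have nc: "norm (?c t - z) = r" for t
      using r by (simp add: circlepath norm_mult)
    have sg: "sgn (Im (?c t)) = sgn (Im z)" for t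
    proof -
      have "\<bar>Im (?c t) - Im z\<bar> < \<bar>Im z\<bar>"
        using abs_Im_le_cmod[of "?c t - z"] nc[of t] r by (simp add: e_def)
      then show ?thesis
        by (auto simp: sgn_if)
    qed
    have c0: "Im (?c t) \<noteq> 0" for t
      using sg[of t] z by (metis sgn_zero_iff)
    then have cn: "?c t \<noteq> 0" "?c t \<notin> \<real>\<^sub>\<le>\<^sub>0" for t
      by (metis zero_complex.sel(2), metis complex_nonpos_Reals_iff)
    have pc: "path ?c"
      by simp
    have pl: "path ?l"
      using cn pc unfolding path_def by (intro continuous_intros) auto
    have ps: "path ?s"
      using cn pc unfolding path_def strip_a_def Complex_eq by (intro continuous_intros) auto
    have pf: "?c 1 = ?c 0"
      by (simp add: circlepath)
    have wl: "winding_number (\<lambda>t. - ?l t) 0 = 1"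
    proof -
      have "winding_number (\<lambda>t. - ?l t) 0 = winding_number ?g 0"
      proof (rule winding_number_nearby_loops_eq)
        show "path ?g"
          unfolding path_def by (intro continuous_intros)
        show "path (\<lambda>t. - ?l t)"
          using pl unfolding path_def by (rule continuous_on_minus)
        show "pathfinish ?g = pathstart ?g"
          by (simp add: pathfinish_def pathstart_def)
        show "pathfinish (\<lambda>t. - ?l t) = pathstart (\<lambda>t. - ?l t)"
          by (simp add: pathfinish_def pathstart_def pf)
        have gt: "?g t = - (inverse z * (?c t - z))" for t
          by (simp add: circlepath)
        show "norm (- ?l t - ?g t) < norm (?g t - 0)" for t
        proof -
          have "norm (- ?l t - ?g t) = norm (Ln (?c t) - Ln z - inverse z * (?c t - z))"
            unfolding gt by (metis minus_diff_minus norm_minus_cancel)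
          also have "\<dots> \<le> inverse (norm z) / 2 * r"
            using e1(2)[of "?c t"] r nc[of t] by (simp add: e_def)
          also have "\<dots> < inverse (norm z) * r"
            using r z0 by simp
          also have "\<dots> = norm (?g t - 0)"
            unfolding gt diff_0_right norm_minus_cancel norm_mult nc norm_inverse by simp
          finally show ?thesis .
        qed
      qed
      also have "\<dots> = 1"
        using r z0 by (intro winding_number_scaled_circle) auto
      finally show ?thesis .
    qed
    have l0: "?l t \<noteq> 0" for t
    proof
      assume "?l t = 0"
      then have "?c t = z"
        using cn z0 by (metis eq_iff_diff_eq_0 exp_Ln)
      with nc[of t] r show False
        by simp
    qed
    have polar: "norm w = exp (Re (Ln w))" "Re w / norm w = cos (Im (Ln w))" if "w \<noteq> 0" for w
    proof -
      have w: "w = exp (Ln w)"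
        using that by simp
      show n: "norm w = exp (Re (Ln w))"
        using w by (metis norm_exp_eq_Re)
      have "Re w = exp (Re (Ln w)) * cos (Im (Ln w))"
        using w by (metis Re_exp)
      then show "Re w / norm w = cos (Im (Ln w))"
        using n by simp
    qed
    have sre: "sgn (Re (?s t)) = - sgn (Re (?l t))" for t
      using polar(1)[OF cn(1)[of t]] polar(1)[OF z0(1)]
      by (auto simp: strip_a_def sgn_if)
    have sim: "sgn (Im (?s t)) = sgn (cos (Im (Ln (?c t))) - cos (Im (Ln z)))" for t
      using polar(2)[OF cn(1)[of t]] polar(2)[OF z0(1)]
      by (auto simp: strip_a_def sgn_if)
    have ws: "winding_number (strip_a i \<circ> ?c) (strip_a i z) = winding_number ?s 0"
      unfolding winding_number_offset[of _ "strip_a i z"] by (simp add: o_def)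
    have pm: "path (\<lambda>t. - ?l t)"
      using pl unfolding path_def by (rule continuous_on_minus)
    show ?thesis
    proof (cases "Im z > 0")
      case True
      have a: "0 < Im (Ln w)" "Im (Ln w) < pi" if "Im w > 0" for w
        using Im_Ln_pos_lt_imp[OF that] by auto
      have sim': "sgn (Im (?s t)) = - sgn (Im (?l t))" for t
      proof -
        have "Im (?c t) > 0"
          using sg[of t] True by (metis sgn_greater)
        then show ?thesis
          unfolding sim using sgn_cos_diff[OF a a[OF True]] by simp
      qed
      have "winding_number ?s 0 = winding_number (\<lambda>t. - ?l t) 0"
      proof (rule winding_number_same_quadrants[OF pm ps])
        show "- ?l t \<noteq> 0" for t
          using l0[of t] by (simp only: neg_equal_0_iff_equal not_False_eq_True)
        show "sgn (Re (?s t)) = sgn (Re (- ?l t)) \<and> sgn (Im (?s t)) = sgn (Im (- ?l t))" for t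
          unfolding sre sim' by (simp only: uminus_complex.sel sgn_minus)
      qed (simp_all add: pathfinish_def pathstart_def pf)
      then show ?thesis
        using True ws wl by simp
    next
      case False
      then have neg: "Im z < 0"
        using z by simp
      have a: "0 < - Im (Ln w)" "- Im (Ln w) < pi" if "Im w < 0" for w
      proof -
        have "Ln (cnj w) = cnj (Ln w)"
          using that by (intro cnj_Ln [symmetric]) (auto simp: complex_nonpos_Reals_iff)
        then show "0 < - Im (Ln w)" "- Im (Ln w) < pi"
          using Im_Ln_pos_lt_imp[of "cnj w"] that by auto
      qed
      have sim': "sgn (Im (?s t)) = sgn (Im (?l t))" for t
      proof -
        have "Im (?c t) < 0"
          using sg[of t] neg by (metis sgn_less)
        from sgn_cos_diff[OF a[OF this] a[OF neg]]
        have "sgn (cos (Im (Ln (?c t))) - cos (Im (Ln z))) = - sgn (- (Im (Ln (?c t)) - Im (Ln z)))"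
          by (simp only: cos_minus) (simp only: minus_diff_minus)
        then show ?thesis
          unfolding sim by (simp only: sgn_minus minus_minus) simp
      qed
      have "winding_number ?s 0 = winding_number (cnj \<circ> (\<lambda>t. - ?l t)) 0"
      proof (rule winding_number_same_quadrants[OF _ ps])
        show "path (cnj \<circ> (\<lambda>t. - ?l t))"
          using pm unfolding path_def o_def by (rule continuous_on_cnj)
        show "(cnj \<circ> (\<lambda>t. - ?l t)) t \<noteq> 0" for t
          using l0[of t] by (simp only: o_def complex_cnj_zero_iff neg_equal_0_iff_equal not_False_eq_True)
        show "sgn (Re (?s t)) = sgn (Re ((cnj \<circ> (\<lambda>t. - ?l t)) t)) \<and>
              sgn (Im (?s t)) = sgn (Im ((cnj \<circ> (\<lambda>t. - ?l t)) t))" for t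
          unfolding sre sim' o_def by (simp only: uminus_complex.sel cnj.sel sgn_minus minus_minus)
      qed (simp_all add: pathfinish_def pathstart_def pf)
      also have "\<dots> = - cnj (winding_number (\<lambda>t. - ?l t) 0)"
      proof -
        have "0 \<notin> path_image (\<lambda>t. - ?l t)"
          using l0 unfolding path_image_def by (metis (no_types, lifting) imageE neg_equal_0_iff_equal)
        from winding_number_cnj[OF pm this] show ?thesis
          by (simp only: complex_cnj_zero)
      qed
      finally show ?thesis
        using neg ws wl by simp
    qed
  qed
  then show ?thesis
    unfolding local_degree_def eventually_at_right_field using e by blast
qed

lemma annulus_about_a:
  assumes "i \<in> {1..h}"
  shows "annulus_about h (curve_a h i) (nbhd_a h i)"
  unfolding annulus_about_def oriented_embedding_def
proof (intro conjI ballI impI nbhd_a_core[OF assms])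
  show "embedding_map (top_of_set annulus) (Surf h) (nbhd_a h i)"
  proof (rule continuous_imp_embedding_map)
    show "continuous_map (top_of_set annulus) (Surf h) (nbhd_a h i)"
      using continuous_on_nbhd_a[OF assms] nbhd_a_in_surf[OF assms] by auto
    show "compact_space (top_of_set annulus)"
      using compact_annulus by (simp add: compact_space_subtopology)
    show "Hausdorff_space (Surf h)"
      by (simp add: Hausdorff_space_subtopology)
    show "inj_on (nbhd_a h i) (topspace (top_of_set annulus))"
      using inj_on_nbhd_a[OF assms] by simp
  qed
next
  fix z assume z: "z \<in> interior annulus" and s: "snd (nbhd_a h i z) \<noteq> 0"
  then have "z \<in> annulus"
    using interior_subset by auto
  then have "sgn (snd (nbhd_a h i z)) = sgn (Im z)" "Im z \<noteq> 0"
    using s nbhd_a_infdist[OF assms, of z] infdist_nonneg[of "strip_a i z" "frontier (holed_disk h)"]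
    by (auto simp: nbhd_a_def sgn_mult sgn_if split: if_splits)
  moreover have "fst \<circ> nbhd_a h i = strip_a i"
    by (auto simp: nbhd_a_def)
  ultimately show "local_degree (fst \<circ> nbhd_a h i) z (sgn (snd (nbhd_a h i z)))"
    using local_degree_strip_a by simp
qed


section \<open>The data set \<open>(h, 1; (1, h), (h - 1, h))\<close>\<close>

text \<open>Near its fixed point \<open>x\<close> the map \<open>f\<close> is the rotation by \<open>\<theta>\<close> in an oriented chart.\<close>

definition local_rotation ::
    "nat \<Rightarrow> (complex \<times> real \<Rightarrow> complex \<times> real) \<Rightarrow> complex \<times> real \<Rightarrow> real \<Rightarrow> bool" where
  "local_rotation h f x \<theta> \<longleftrightarrow>
     (\<exists>\<phi>. oriented_embedding h (ball 0 1) \<phi> \<and> \<phi> 0 = x \<and>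
          (\<forall>z\<in>ball 0 1. f (\<phi> z) = \<phi> (cis \<theta> * z)))"

text \<open>The quotient of the surface by the cyclic group generated by \<open>f\<close> is the closed orientable
  surface of genus \<open>k\<close>.\<close>

definition quotient_genus ::
    "nat \<Rightarrow> (complex \<times> real \<Rightarrow> complex \<times> real) \<Rightarrow> nat \<Rightarrow> bool" where
  "quotient_genus h f k \<longleftrightarrow>
     (\<exists>q. quotient_map (Surf h) (Surf k) q \<and>
          (\<forall>x\<in>surf h. \<forall>y\<in>surf h. q x = q y \<longleftrightarrow> (\<exists>n. (f ^^ n) x = y)))"

text \<open>The cone points are the images of the points with nontrivial stabiliser.  So the last clause
  says that there are no cone points besides the images of the two fixed points, which have
  order \<open>h\<close>.\<close>

definition has_data_set_D ::
    "nat \<Rightarrow> (complex \<times> real \<Rightarrow> complex \<times> real) set \<Rightarrow> bool" where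
  "has_data_set_D h G \<longleftrightarrow>
     (\<exists>f\<in>homeo_plus h. G = mapping_class h f \<and>
        group.ord (homeo_group h) f = h \<and>
        quotient_genus h f 1 \<and>
        (\<exists>p\<in>surf h. \<exists>q\<in>surf h. p \<noteq> q \<and> f p = p \<and> f q = q \<and>
           local_rotation h f p (2 * pi / real h) \<and>
           local_rotation h f q (2 * pi * (real h - 1) / real h) \<and>
           (\<forall>x\<in>surf h - {p, q}. \<forall>n\<in>{1..<h}. (f ^^ n) x \<noteq> x)))"

end

theory Submission
  imports Defs
begin

text \<open>The surface is the double of a plane region, and the region with \<open>g\<close> holes admits a
  homeomorphism \<open>\<rho>\<close> of order \<open>g\<close> that fixes one point and permutes the holes, together with the
  strips below them, cyclically by translations: in suitable polar coordinates \<open>\<rho>\<close> is the rotation by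
  \<open>2 \<pi> / g\<close>.  The double of \<open>\<rho>\<close> is the rotation \<open>G\<close>; its two fixed points lie on the two sheets, which
  carry opposite orientations.  Since \<open>G\<close> carries the annulus around \<open>a\<^sub>i\<close> to the one around
  \<open>a\<^sub>i\<^sub>+\<^sub>1\<close>, it conjugates \<open>T\<^sub>i\<close> to \<open>T\<^sub>i\<^sub>+\<^sub>1\<close> on the nose, and
  \<open>(G T\<^sub>1)\<^sup>g\<close> telescopes to the product of all \<open>T\<^sub>i\<close>.  In the same coordinates the quotient map is
  the double of the \<open>g\<close>-th power map on angles.  No smaller power of \<open>G\<close> is isotopic to the identity
  because it moves \<open>a\<^sub>1\<close> to a curve that has intersection number \<open>0\<close> with the boundary of the
  first hole.\<close>

section \<open>Local degree of injective maps\<close>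

text \<open>The identity \<open>F^g = T_C\<close> is pure algebra once the rotation carries each
  curve to the next by a translation. The obstacle is geometric: the holes stand in a row, not on a
  circle. The chart therefore wraps the row around a centre, turning horizontal position into angle
  and height into radius. The columns around holes \<open>1\<close> to \<open>g\<close> fill all
  angles except a sector of size \<open>pi / (2 g)\<close>, and whatever lies beside the columns is
  squeezed into that sector. Since the rotation has order \<open>g\<close> as a map and permutes the
  twists exactly, every relation is proved for homeomorphisms. Isotopy enters only in forming the
  quotient group and in showing that the order does not drop there.

  The chart and the twists are only piecewise smooth and the surface is folded along the seam, so
  orientation cannot be read off from derivatives. It is governed instead by two topological facts:
  a planar continuous injection has local degree 1 or -1, constant on convex open sets, and no open
  piece of the surface lies in the seam. A single point where the map is a translation then decides
  the orientation of the whole rotation.\<close>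

text \<open>Takes the place of differentiability: by invariance of domain it suffices for a local
  degree to exist and to be 1 or -1.\<close>

definition locally_injective_at :: "(complex \<Rightarrow> complex) \<Rightarrow> complex \<Rightarrow> bool" where
  "locally_injective_at f z \<longleftrightarrow> (\<exists>e>0. continuous_on (ball z e) f \<and> inj_on f (ball z e))"

lemma locally_injective_atI:
  assumes "open U" "z \<in> U" "continuous_on U f" "inj_on f U"
  shows "locally_injective_at f z"
  using assms unfolding locally_injective_at_def
  by (meson continuous_on_subset inj_on_subset open_contains_ball)

text \<open>Centre and radius move linearly from one circle to the other. Convexity keeps the moving
  circle and its centre in \<open>U\<close>, and injectivity keeps the image of the circle away from
  the image of the centre, so the difference is a homotopy of loops in the punctured plane.\<close>

lemma winding_number_circle_image_const:
  assumes U: "convex U" and f: "continuous_on U f" "inj_on f U"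
    and zw: "cball z r \<subseteq> U" "cball w s \<subseteq> U" and rs: "0 < r" "0 < s"
  shows "winding_number (f \<circ> circlepath z r) (f z) = winding_number (f \<circ> circlepath w s) (f w)"
proof -
  define c where "c = (\<lambda>u. (1 - u) *\<^sub>R z + u *\<^sub>R w)"
  define \<rho> where "\<rho> = (\<lambda>u. (1 - u) * r + u * s)"
  define e where "e = (\<lambda>t. exp (2 * of_real pi * \<i> * of_real t))"
  define q where "q = (\<lambda>(u, t). c u + of_real (\<rho> u) * e t)"
  have ne: "norm (e t) = 1" for t
    by (simp add: e_def norm_exp_eq_Re)
  have \<rho>: "\<rho> u > 0" if "u \<in> {0..1}" for u
    using rs that by (cases "u = 0") (auto simp: \<rho>_def intro: add_nonneg_pos)
  have inU: "q (u, t) \<in> U" "c u \<in> U" if u: "u \<in> {0..1}" for u t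
  proof -
    have eq: "q (u, t) = (1 - u) *\<^sub>R (z + of_real r * e t) + u *\<^sub>R (w + of_real s * e t)"
      by (simp add: q_def c_def \<rho>_def scaleR_conv_of_real algebra_simps)
    have "z + of_real r * e t \<in> U" "w + of_real s * e t \<in> U"
      using rs zw ne[of t] by (auto simp: subset_iff dist_norm norm_mult)
    then show "q (u, t) \<in> U"
      unfolding eq using U u by (auto intro: convexD)
    have "z \<in> U" "w \<in> U"
      using rs zw by (auto simp: subset_iff)
    then show "c u \<in> U"
      unfolding c_def using U u by (auto intro: convexD)
  qed
  define H where "H = (\<lambda>y. f (q y) - f (c (fst y)))"
  have "homotopic_loops (-{0}) (\<lambda>t. (f \<circ> circlepath z r) t - f z) (\<lambda>t. (f \<circ> circlepath w s) t - f w)"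
    unfolding homotopic_loops
  proof (intro exI[of _ H] conjI ballI)
    show "continuous_on ({0..1} \<times> {0..1}) H"
      unfolding H_def
      by (intro continuous_intros continuous_on_compose2[OF f(1)])
         (auto simp: q_def c_def \<rho>_def e_def case_prod_unfold intro!: continuous_intros
               dest: inU(2) simp: inU(1)[unfolded q_def c_def \<rho>_def e_def, simplified] inU(2)[unfolded c_def])
    show "H \<in> {0..1} \<times> {0..1} \<rightarrow> - {0}"
    proof
      fix y :: "real \<times> real" assume y: "y \<in> {0..1} \<times> {0..1}"
      obtain u t where ut: "y = (u, t)" "u \<in> {0..1}" using y by auto
      have "q (u, t) \<noteq> c u"
        using \<rho>[OF ut(2)] ne[of t] by (auto simp: q_def)
      then have "f (q (u, t)) \<noteq> f (c u)"
        using inU[OF ut(2)] f(2) by (auto dest: inj_onD)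
      then show "H y \<in> - {0}" by (simp add: H_def ut)
    qed
    show "pathfinish (H \<circ> Pair t) = pathstart (H \<circ> Pair t)" for t
      by (simp add: H_def q_def pathfinish_def pathstart_def e_def)
  qed (auto simp: H_def q_def c_def \<rho>_def e_def circlepath)
  then have "winding_number (\<lambda>t. (f \<circ> circlepath z r) t - f z) 0 = winding_number (\<lambda>t. (f \<circ> circlepath w s) t - f w) 0"
    by (rule winding_number_homotopic_loops)
  then show ?thesis
    unfolding winding_number_offset[of _ "f z"] winding_number_offset[of _ "f w"] .
qed

lemma winding_number_circle_image_cases:
  assumes f: "continuous_on (cball z r) f" "inj_on f (cball z r)" and r: "0 < r"
  shows "winding_number (f \<circ> circlepath z r) (f z) \<in> {1, -1}"
proof -
  let ?\<gamma> = "f \<circ> circlepath z r"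
  have im: "path_image ?\<gamma> = f ` sphere z r"
    using r by (simp add: path_image_compose)
  have sim: "simple_path ?\<gamma>"
    using r f by (intro simple_path_continuous_image) (auto simp: simple_path_circlepath
       intro: continuous_on_subset inj_on_subset)
  have op: "open (f ` ball z r)"
    by (rule invariance_of_domain) (use f in \<open>auto intro: continuous_on_subset inj_on_subset\<close>)
  have cl: "closed (f ` cball z r)"
    using f by (intro compact_imp_closed compact_continuous_image) auto
  have fr: "frontier (f ` ball z r) \<subseteq> f ` sphere z r"
  proof -
    have "closure (f ` ball z r) \<subseteq> f ` cball z r"
      using cl by (intro closure_minimal) auto
    then show ?thesis
      using op by (force simp: frontier_def interior_open)
  qed
  have nin: "f z \<notin> f ` sphere z r"
    using f(2) r by (auto dest: inj_onD)
  let ?C = "connected_component_set (- f ` sphere z r) (f z)"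
  have "?C \<subseteq> f ` ball z r"
  proof (rule ccontr)
    assume "\<not> ?thesis"
    then have "?C - f ` ball z r \<noteq> {}" by auto
    moreover have "f z \<in> ?C \<inter> f ` ball z r"
      using nin r by (simp add: connected_component_refl)
    ultimately have "?C \<inter> frontier (f ` ball z r) \<noteq> {}"
      by (intro connected_Int_frontier connected_connected_component) blast+
    then show False
      using fr connected_component_subset by fastforce
  qed
  moreover have "bounded (f ` ball z r)"
    using f by (intro bounded_subset[OF compact_imp_bounded[OF compact_continuous_image[of "cball z r" f]]]) auto
  ultimately have "bounded ?C"
    by (metis bounded_subset)
  then have "f z \<in> inside (path_image ?\<gamma>)"
    using nin by (auto simp: inside_def im)
  then show ?thesis
    using simple_closed_path_winding_number_inside[OF sim] by (metis insertCI)
qed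

text \<open>One circle of any admissible size decides the local degree at every interior point,
  because all circles in a convex set give the same winding number.\<close>

lemma local_degree_iff:
  assumes U: "convex U" and f: "continuous_on U f" "inj_on f U"
    and zw: "cball z r \<subseteq> U" "w \<in> interior U" and r: "0 < r"
  shows "local_degree f w d \<longleftrightarrow> winding_number (f \<circ> circlepath z r) (f z) = of_real d"
proof -
  obtain e where e: "e > 0" "cball w e \<subseteq> U"
    using zw(2) by (meson mem_interior_cball)
  have eq: "winding_number (f \<circ> circlepath w s) (f w) = winding_number (f \<circ> circlepath z r) (f z)"
    if "0 < s" "s < e" for s
    using that e by (intro winding_number_circle_image_const[OF U f _ zw(1) _ r]) auto
  have "local_degree f w d \<longleftrightarrow> (\<forall>\<^sub>F s in at_right (0::real). winding_number (f \<circ> circlepath z r) (f z) = of_real d)"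
    unfolding local_degree_def
    by (intro eventually_subst eventually_at_rightI[of 0 e]) (use e eq in auto)
  then show ?thesis by simp
qed

lemma local_degree_const:
  assumes U: "open U" "convex U" and f: "continuous_on U f" "inj_on f U" and zw: "z \<in> U" "w \<in> U"
  shows "local_degree f z d \<longleftrightarrow> local_degree f w d"
proof -
  obtain e where "e > 0" "cball z e \<subseteq> U"
    using zw U by (meson open_contains_cball)
  then show ?thesis
    using local_degree_iff[OF U(2) f, of z e] zw U(1) by (auto simp: interior_open)
qed

lemma local_degree_unique:
  assumes "local_degree f z d" "local_degree f z e"
  shows "d = e"
proof -
  have "\<forall>\<^sub>F r::real in at_right 0. complex_of_real d = of_real e"
    using assms unfolding local_degree_def by eventually_elim simp
  then show ?thesis by simp
qed

lemma local_degree_cong: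
  assumes "open U" "z \<in> U" and eq: "\<And>w. w \<in> U \<Longrightarrow> f w = g w"
  shows "local_degree f z d \<longleftrightarrow> local_degree g z d"
proof -
  obtain e where e: "e > 0" "ball z e \<subseteq> U"
    using assms by (meson open_contains_ball)
  have c: "winding_number (f \<circ> circlepath z r) (f z) = winding_number (g \<circ> circlepath z r) (g z)"
    if "0 < r" "r < e" for r
  proof -
    have "circlepath z r t \<in> U" for t
      using that e by (auto simp: circlepath dist_norm norm_mult subset_iff norm_exp_eq_Re)
    then have "f \<circ> circlepath z r = g \<circ> circlepath z r"
      by (auto simp: eq)
    then show ?thesis by (simp add: eq assms)
  qed
  show ?thesis
    unfolding local_degree_def
    by (intro eventually_subst eventually_at_rightI[of 0 e]) (use e c in auto)
qed

lemma locally_injective_at_local_degree: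
  assumes "locally_injective_at f z"
  obtains d where "d \<in> {1, -1}" "local_degree f z d"
proof -
  obtain e where e: "e > 0" "continuous_on (ball z e) f" "inj_on f (ball z e)"
    using assms by (auto simp: locally_injective_at_def)
  have sub: "cball z (e/2) \<subseteq> ball z e" using e by auto
  have "winding_number (f \<circ> circlepath z (e/2)) (f z) \<in> {1, -1}"
    using e sub by (intro winding_number_circle_image_cases) (auto intro: continuous_on_subset inj_on_subset)
  moreover have "local_degree f z d \<longleftrightarrow> winding_number (f \<circ> circlepath z (e/2)) (f z) = of_real d" for d
    using e sub by (intro local_degree_iff[of "ball z e"]) (auto simp: interior_open)
  ultimately show thesis
    using that[of 1] that[of "-1"] by auto
qed

lemma locally_injective_at_compose:
  assumes "locally_injective_at f z" "locally_injective_at h (f z)"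
  shows "locally_injective_at (h \<circ> f) z"
proof -
  obtain e where e: "e > 0" "continuous_on (ball z e) f" "inj_on f (ball z e)"
    using assms by (auto simp: locally_injective_at_def)
  obtain e' where e': "e' > 0" "continuous_on (ball (f z) e') h" "inj_on h (ball (f z) e')"
    using assms by (auto simp: locally_injective_at_def)
  let ?U = "ball z e \<inter> f -` ball (f z) e'"
  show ?thesis
  proof (rule locally_injective_atI)
    show "open ?U"
      using e by (intro continuous_open_preimage) auto
    show "z \<in> ?U" using e e' by simp
    show "continuous_on ?U (h \<circ> f)"
      by (intro continuous_on_compose) (auto intro: continuous_on_subset[OF e(2)] continuous_on_subset[OF e'(2)])
    show "inj_on (h \<circ> f) ?U"
      by (intro comp_inj_on) (auto intro: inj_on_subset[OF e(3)] inj_on_subset[OF e'(3)])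
  qed
qed

text \<open>With a continuous logarithm \<open>q\<close> of \<open>\<gamma> - w\<close>, the loop \<open>\<gamma>\<close> is deformed into a circle traversed
  \<open>\<plusminus>1\<close> times by a linear deformation of \<open>q\<close> in a left half-plane, i.e. inside the punctured disk.\<close>

lemma winding_number_compose:
  assumes h: "continuous_on (ball w e) h" "\<And>x. x \<in> ball w e \<Longrightarrow> x \<noteq> w \<Longrightarrow> h x \<noteq> h w"
    and \<gamma>: "path \<gamma>" "pathfinish \<gamma> = pathstart \<gamma>" "path_image \<gamma> \<subseteq> ball w e - {w}"
    and d: "winding_number \<gamma> w = of_real d" "d \<in> {1, -1}" and r: "0 < r" "r < e"
  shows "winding_number (h \<circ> \<gamma>) (h w) = of_real d * winding_number (h \<circ> circlepath w r) (h w)"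
proof -
  have wn: "w \<notin> path_image \<gamma>" using \<gamma> by auto
  obtain q where q: "path q" "pathfinish q - pathstart q = 2 * of_real pi * \<i> * winding_number \<gamma> w"
    and qe: "\<And>t. t \<in> {0..1} \<Longrightarrow> \<gamma> t = w + exp (q t)"
    using winding_number_as_continuous_log[OF \<gamma>(1) wn] by blast
  have e: "e > 0" using r by simp
  define l where "l = (\<lambda>t. of_real (ln r) + 2 * of_real pi * \<i> * of_real (d * t) :: complex)"
  define H where "H = (\<lambda>(u, t). h (w + exp ((1 - u) *\<^sub>R q t + u *\<^sub>R l t)) - h w)"
  have Req: "Re (q t) < ln e" if "t \<in> {0..1}" for t
  proof -
    have "\<gamma> t \<in> ball w e" using \<gamma>(3) that unfolding path_image_def by blast
    then have "exp (Re (q t)) < e"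
      by (simp add: qe[OF that] dist_norm norm_exp_eq_Re)
    then show ?thesis
      using e by (metis exp_gt_zero ln_exp ln_less_cancel_iff)
  qed
  have Rel: "Re (l t) < ln e" for t
    using r by (simp add: l_def)
  have inb: "w + exp ((1 - u) *\<^sub>R q t + u *\<^sub>R l t) \<in> ball w e - {w}" if "u \<in> {0..1}" "t \<in> {0..1}" for u t
  proof -
    have "(1 - u) * Re (q t) + u * Re (l t) < ln e"
      using that Req Rel by (intro convex_bound_lt) auto
    then have "exp ((1 - u) * Re (q t) + u * Re (l t)) < e"
      using e by (metis exp_ln exp_less_cancel_iff)
    then show ?thesis
      by (simp add: dist_norm norm_exp_eq_Re)
  qed
  let ?\<delta> = "\<lambda>t. h (w + exp (l t))"
  have contq: "continuous_on ({0..1} \<times> {0..1}) (\<lambda>y. q (snd y))"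
    by (rule continuous_on_compose2[of "{0..1}" q]) (use q(1) in \<open>auto simp: path_def intro!: continuous_intros\<close>)
  have "homotopic_loops (-{0}) (\<lambda>t. (h \<circ> \<gamma>) t - h w) (\<lambda>t. ?\<delta> t - h w)"
    unfolding homotopic_loops
  proof (intro exI[of _ H] conjI ballI)
    show "continuous_on ({0..1} \<times> {0..1}) H"
      unfolding H_def case_prod_unfold l_def
      by (intro continuous_intros continuous_on_compose2[OF h(1)] contq)
         (use inb in \<open>auto simp: l_def\<close>)
    show "H \<in> {0..1} \<times> {0..1} \<rightarrow> - {0}"
      using inb h(2) by (force simp: H_def)
    show "pathfinish (H \<circ> Pair u) = pathstart (H \<circ> Pair u)" if "u \<in> {0..1}" for u
    proof -
      \<comment> \<open>The ends of both logarithms differ by \<open>2 pi i d\<close>, hence so do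
        those of every interpolation, and the exponential closes the loop at each stage.\<close>
      have "(1 - u) *\<^sub>R q 1 + u *\<^sub>R l 1 = (1 - u) *\<^sub>R q 0 + u *\<^sub>R l 0 + 2 * of_real pi * \<i> * of_real d"
        using q(2) d by (simp add: l_def pathfinish_def pathstart_def scaleR_conv_of_real algebra_simps)
      then have "exp ((1 - u) *\<^sub>R q 1 + u *\<^sub>R l 1) = exp ((1 - u) *\<^sub>R q 0 + u *\<^sub>R l 0)"
        using d(2) by (auto simp: exp_add exp_diff exp_minus)
      then show ?thesis
        by (simp add: H_def pathfinish_def pathstart_def)
    qed
  qed (auto simp: H_def qe)
  then have "winding_number (\<lambda>t. (h \<circ> \<gamma>) t - h w) 0 = winding_number (\<lambda>t. ?\<delta> t - h w) 0"
    by (rule winding_number_homotopic_loops)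
  then have *: "winding_number (h \<circ> \<gamma>) (h w) = winding_number ?\<delta> (h w)"
    unfolding winding_number_offset[of _ "h w"] .
  have el: "exp (l t) = of_real r * exp (2 * of_real pi * \<i> * of_real (d * t))" for t
    using r by (simp add: l_def exp_add exp_of_real)
  show ?thesis
  proof (cases "d = 1")
    case True
    then have "?\<delta> = h \<circ> circlepath w r"
      unfolding el by (auto simp: circlepath)
    then show ?thesis using * True by simp
  next
    case False
    then have d: "d = -1" using d by simp
    have ex: "exp (- (2 * of_real pi * \<i> * of_real t)) = exp (2 * of_real pi * \<i> * of_real (1 - t))" for t
      by (simp add: algebra_simps exp_diff exp_minus field_simps)
    have "?\<delta> = reversepath (h \<circ> circlepath w r)"
      unfolding el d reversepath_def using ex by (auto simp: circlepath)
    moreover have "path (h \<circ> circlepath w r)"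
      by (intro path_continuous_image continuous_on_subset[OF h(1)]) (use r in auto)
    moreover have "h w \<notin> path_image (h \<circ> circlepath w r)"
      using r h(2) by (fastforce simp: path_image_compose)
    ultimately show ?thesis
      using * d by (simp add: winding_number_reversepath)
  qed
qed

text \<open>A small circle about \<open>z\<close> is mapped by \<open>f\<close> to a loop in a
  punctured ball about \<open>f z\<close> that winds \<open>d\<close> times, and
  \<open>winding_number_compose\<close> then multiplies the degree of \<open>h\<close> by
  \<open>d\<close>.\<close>

lemma local_degree_compose:
  assumes f: "locally_injective_at f z" "local_degree f z d"
    and h: "locally_injective_at h (f z)" "local_degree h (f z) d'"
  shows "local_degree (h \<circ> f) z (d' * d)"
proof -
  obtain e where e: "e > 0" "continuous_on (ball z e) f" "inj_on f (ball z e)"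
    using assms by (auto simp: locally_injective_at_def)
  obtain e' where e': "e' > 0" "continuous_on (ball (f z) e') h" "inj_on h (ball (f z) e')"
    using assms by (auto simp: locally_injective_at_def)
  have dd: "d \<in> {1, -1}"
    using locally_injective_at_local_degree[OF f(1)] local_degree_unique[OF f(2)] by metis
  have "continuous (at z) f"
    using e by (simp add: continuous_on_eq_continuous_at)
  then obtain k where k: "k > 0" "\<And>x. dist x z < k \<Longrightarrow> dist (f x) (f z) < e'"
    using e'(1) by (auto simp: continuous_at_eps_delta)
  have "\<forall>\<^sub>F r in at_right (0::real). r < e'"
    using e'(1) by (auto simp: eventually_at_right_field)
  with h(2) have "\<forall>\<^sub>F r in at_right 0. winding_number (h \<circ> circlepath (f z) r) (h (f z)) = of_real d' \<and> r < e'"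
    unfolding local_degree_def by (rule eventually_conj)
  then obtain b where b: "b > 0"
    "\<And>r. 0 < r \<Longrightarrow> r < b \<Longrightarrow> winding_number (h \<circ> circlepath (f z) r) (h (f z)) = of_real d' \<and> r < e'"
    by (auto simp: eventually_at_right_field)
  have "b / 2 > 0" "b / 2 < b" using b by auto
  then obtain r' where r': "0 < r'" "r' < e'" "winding_number (h \<circ> circlepath (f z) r') (h (f z)) = of_real d'"
    using b(2) by blast
  have "\<forall>\<^sub>F r in at_right (0::real). r < min e k \<and> 0 < r"
    using e(1) k(1) by (auto simp: eventually_at_right_field intro!: exI[of _ "min e k"])
  with f(2) have "\<forall>\<^sub>F r in at_right 0. winding_number (h \<circ> f \<circ> circlepath z r) ((h \<circ> f) z) = of_real (d' * d)"
    unfolding local_degree_def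
  proof eventually_elim
    case (elim r)
    have "winding_number (h \<circ> (f \<circ> circlepath z r)) (h (f z)) =
        of_real d * winding_number (h \<circ> circlepath (f z) r') (h (f z))"
    proof (rule winding_number_compose[OF e'(2) _ _ _ _ elim(1) dd r'(1,2)])
      show "h x \<noteq> h (f z)" if "x \<in> ball (f z) e'" "x \<noteq> f z" for x
        using e' that by (auto dest: inj_onD)
      show "path (f \<circ> circlepath z r)"
        by (intro path_continuous_image continuous_on_subset[OF e(2)]) (use elim in auto)
      show "pathfinish (f \<circ> circlepath z r) = pathstart (f \<circ> circlepath z r)"
        by (simp add: pathfinish_compose pathstart_compose)
      show "path_image (f \<circ> circlepath z r) \<subseteq> ball (f z) e' - {f z}"
      proof -
        have "f x \<in> ball (f z) e' - {f z}" if "dist z x = r" for x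
        proof -
          have "f x \<noteq> f z"
            using inj_onD[OF e(3), of x z] that elim by auto
          then show ?thesis
            using k(2)[of x] that elim by (simp add: dist_commute)
        qed
        then show ?thesis using elim by (auto simp: path_image_compose)
      qed
    qed
    then show ?case
      using r'(3) by (simp add: o_assoc mult.commute)
  qed
  then show ?thesis by (simp add: local_degree_def)
qed

lemma local_degree_translation: "local_degree (\<lambda>x. x + c) z 1"
proof -
  have "winding_number ((\<lambda>x. x + c) \<circ> circlepath z r) (z + c) = 1" if "r > 0" for r
  proof -
    have "(\<lambda>x. x + c) \<circ> circlepath z r = circlepath (z + c) r"
      by (auto simp: circlepath)
    then show ?thesis using that by (simp add: winding_number_circlepath)
  qed
  then show ?thesis
    unfolding local_degree_def by (auto simp: eventually_at_right_field intro!: exI[of _ 1])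
qed

lemma local_degree_cnj: "local_degree cnj z (-1)"
proof -
  have "winding_number (cnj \<circ> circlepath z r) (cnj z) = -1" if "r > 0" for r
    using that winding_number_cnj[of "circlepath z r" z] by (simp add: winding_number_circlepath)
  then show ?thesis
    unfolding local_degree_def by (auto simp: eventually_at_right_field intro!: exI[of _ 1])
qed


section \<open>Doubles\<close>

lemma double_snd_eq_0_iff:
  assumes "x \<in> double P" "frontier P \<noteq> {}"
  shows "snd x = 0 \<longleftrightarrow> fst x \<in> frontier P"
  using assms in_closed_iff_infdist_zero[OF frontier_closed assms(2), of "fst x"]
  by (auto simp: double_def)

lemma double_fst_in_interior:
  assumes "x \<in> double P" "frontier P \<noteq> {}" "snd x \<noteq> 0"
  shows "fst x \<in> interior P"
  using assms double_snd_eq_0_iff[OF assms(1,2)] closure_subset[of P]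
  by (auto simp: double_def frontier_def)

text \<open>The height of a point is fixed up to sign by its planar position, so only the choice of
  sheet is free.\<close>

lemma double_eq_iff:
  assumes "x \<in> double P" "y \<in> double P"
  shows "x = y \<longleftrightarrow> fst x = fst y \<and> sgn (snd x) = sgn (snd y)"
proof -
  have "snd x = sgn (snd x) * infdist (fst x) (frontier P)" "snd y = sgn (snd y) * infdist (fst y) (frontier P)"
    using assms unfolding double_def by (auto simp: sgn_mult_abs dest: sym)
  then show ?thesis by (auto simp: prod_eq_iff)
qed

lemma compact_double:
  assumes "compact P"
  shows "compact (double P)"
proof -
  let ?f = "\<lambda>(p, s). (p, s * infdist p (frontier P))"
  have "double P = ?f ` (P \<times> {1, -1})"
  proof
    show "double P \<subseteq> ?f ` (P \<times> {1, -1})"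
    proof
      fix x assume "x \<in> double P"
      then have "x = ?f (fst x, if snd x \<ge> 0 then 1 else -1)" "fst x \<in> P"
        by (auto simp: double_def prod_eq_iff abs_if split: if_splits)
      then show "x \<in> ?f ` (P \<times> {1, -1})"
        by (intro image_eqI[of x ?f "(fst x, if snd x \<ge> 0 then 1 else -1)"]) simp_all
    qed
  qed (auto simp: double_def infdist_nonneg)
  moreover have "compact (?f ` (P \<times> {1, -1}))"
    using assms unfolding case_prod_unfold
    by (intro compact_continuous_image compact_Times continuous_intros) auto
  ultimately show ?thesis by simp
qed

text \<open>The sheets \<open>snd x \<le> 0\<close> and \<open>snd x \<ge> 0\<close> are closed, and
  the two branches agree where they meet because \<open>k\<close> vanishes on the seam.\<close>

lemma continuous_on_sgn_double:
  fixes k :: "complex \<Rightarrow> real"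
  assumes P: "frontier P \<noteq> {}" and k: "continuous_on P k" "\<And>p. p \<in> frontier P \<inter> P \<Longrightarrow> k p = 0"
  shows "continuous_on (double P) (\<lambda>x. sgn (snd x) * k (fst x))"
proof -
  have c: "continuous_on A (\<lambda>x. k (fst x))" if "A \<subseteq> double P" for A
    by (rule continuous_on_compose2[OF k(1)]) (use that in \<open>auto simp: double_def intro!: continuous_intros\<close>)
  have z: "k (fst x) = 0" if "x \<in> double P" "snd x = 0" for x
    using k(2)[of "fst x"] double_snd_eq_0_iff[OF that(1) P] that by (auto simp: double_def)
  have "continuous_on (double P) (\<lambda>x. if snd x \<le> 0 then - k (fst x) else k (fst x))"
    by (rule continuous_on_cases_le) (use z in \<open>auto intro!: continuous_intros c\<close>)
  moreover have "(if snd x \<le> 0 then - k (fst x) else k (fst x)) = sgn (snd x) * k (fst x)" if "x \<in> double P" for x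
    using z[OF that] by (auto simp: sgn_if)
  ultimately show ?thesis
    by (simp cong: continuous_on_cong)
qed

text \<open>The equivalence is what allows doubling: seam points must go to the seam for continuity,
  and no other point may go there, since its sheet would be lost. Frontiers are required to be
  nonempty because the distance to the empty set is 0 by convention, which would collapse the two
  sheets.\<close>

definition bordered_map :: "complex set \<Rightarrow> complex set \<Rightarrow> (complex \<Rightarrow> complex) \<Rightarrow> bool" where
  "bordered_map P P' f \<longleftrightarrow> continuous_on P f \<and> f \<in> P \<rightarrow> P' \<and>
     frontier P \<noteq> {} \<and> frontier P' \<noteq> {} \<and> (\<forall>p\<in>P. f p \<in> frontier P' \<longleftrightarrow> p \<in> frontier P)"

definition double_map :: "complex set \<Rightarrow> (complex \<Rightarrow> complex) \<Rightarrow> complex \<times> real \<Rightarrow> complex \<times> real" where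
  "double_map P' f x = (f (fst x), sgn (snd x) * infdist (f (fst x)) (frontier P'))"

lemma fst_double_map [simp]: "fst (double_map P' f x) = f (fst x)"
  by (simp add: double_map_def)

lemma sgn_double_map:
  assumes "bordered_map P P' f" "x \<in> double P"
  shows "sgn (snd (double_map P' f x)) = sgn (snd x)"
proof (cases "snd x = 0")
  case False
  then have "f (fst x) \<notin> frontier P'"
    using assms double_snd_eq_0_iff[of x P] by (auto simp: bordered_map_def double_def)
  then have "infdist (f (fst x)) (frontier P') \<noteq> 0"
    using assms in_closed_iff_infdist_zero[of "frontier P'"] by (auto simp: bordered_map_def)
  then have "infdist (f (fst x)) (frontier P') > 0"
    using infdist_nonneg[of "f (fst x)" "frontier P'"] by linarith
  then show ?thesis
    by (simp add: double_map_def sgn_mult)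
qed (simp add: double_map_def)

lemma double_map_in_double:
  assumes "bordered_map P P' f" "x \<in> double P"
  shows "double_map P' f x \<in> double P'"
proof -
  have "f (fst x) \<in> frontier P'" if "snd x = 0"
    using assms double_snd_eq_0_iff[of x P] that by (auto simp: bordered_map_def double_def)
  then show ?thesis
    using assms by (auto simp: double_def bordered_map_def double_map_def abs_mult abs_sgn_eq infdist_nonneg)
qed

lemma continuous_on_double_map:
  assumes "bordered_map P P' f"
  shows "continuous_on (double P) (double_map P' f)"
proof -
  have "continuous_on (double P) (\<lambda>x. f (fst x))"
    by (rule continuous_on_compose2[of P f]) (use assms in \<open>auto simp: bordered_map_def double_def intro!: continuous_intros\<close>)
  moreover have "continuous_on (double P) (\<lambda>x. sgn (snd x) * infdist (f (fst x)) (frontier P'))"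
    by (rule continuous_on_sgn_double[where k = "\<lambda>p. infdist (f p) (frontier P')"])
       (use assms in \<open>auto simp: bordered_map_def intro!: continuous_intros\<close>)
  ultimately show ?thesis
    unfolding double_map_def by (intro continuous_on_Pair)
qed

lemma double_map_eq_iff:
  assumes "bordered_map P P' f" "bordered_map P P' g" "x \<in> double P" "y \<in> double P"
  shows "double_map P' f x = double_map P' g y \<longleftrightarrow> f (fst x) = g (fst y) \<and> sgn (snd x) = sgn (snd y)"
  using double_eq_iff[OF double_map_in_double[OF assms(1,3)] double_map_in_double[OF assms(2,4)]]
    sgn_double_map[OF assms(1,3)] sgn_double_map[OF assms(2,4)] by simp

lemma double_map_compose:
  assumes "bordered_map P P' f" "x \<in> double P"
  shows "double_map P'' g (double_map P' f x) = double_map P'' (g \<circ> f) x"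
  using sgn_double_map[OF assms] by (simp add: double_map_def)

lemma double_map_id:
  assumes "x \<in> double P" "f (fst x) = fst x"
  shows "double_map P f x = x"
  using assms by (auto simp: double_map_def double_def abs_if sgn_if split: if_splits)

lemma image_double_map:
  assumes "bordered_map P P' f" "f ` P = P'"
  shows "double_map P' f ` double P = double P'"
proof
  show "double_map P' f ` double P \<subseteq> double P'"
    using double_map_in_double[OF assms(1)] by auto
  show "double P' \<subseteq> double_map P' f ` double P"
  proof
    fix y assume y: "y \<in> double P'"
    then obtain p where p: "p \<in> P" "f p = fst y"
      using assms by (force simp: double_def)
    let ?x = "(p, sgn (snd y) * infdist p (frontier P))"
    have "p \<in> frontier P" if "snd y = 0"
      using that double_snd_eq_0_iff[OF y] p assms(1) by (auto simp: bordered_map_def)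
    then have x: "?x \<in> double P"
      using p by (auto simp: double_def abs_mult abs_sgn_eq infdist_nonneg)
    have "infdist p (frontier P) > 0" if "snd y \<noteq> 0"
    proof -
      have "p \<notin> frontier P" "frontier P \<noteq> {}"
        using that double_snd_eq_0_iff[OF y] p assms(1) by (auto simp: bordered_map_def)
      then show ?thesis
        using in_closed_iff_infdist_zero[of "frontier P" p] infdist_nonneg[of p "frontier P"] by force
    qed
    then have "sgn (snd ?x) = sgn (snd y)"
      by (cases "snd y = 0") (auto simp: sgn_mult)
    then have "double_map P' f ?x = y"
      using double_eq_iff[OF double_map_in_double[OF assms(1) x] y] sgn_double_map[OF assms(1) x] p by simp
    then show "y \<in> double_map P' f ` double P"
      using x by (metis image_eqI)
  qed
qed

section \<open>The rectangle with holes and its frontier\<close>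

lemma closed_holed_disk: "closed (holed_disk h)"
  by (auto simp: holed_disk_def intro!: closed_Diff open_UN open_box)

lemma compact_holed_disk: "compact (holed_disk h)"
  unfolding holed_disk_def by (intro compact_diff open_UN compact_cbox ballI open_box)

lemma in_interior_holed_disk_iff:
  "p \<in> interior (holed_disk h) \<longleftrightarrow> p \<in> box 0 (Complex (real h + 1) 2) \<and>
    (\<forall>i\<in>{1..h}. p \<notin> cbox (Complex (real i - 1/4) (3/4)) (Complex (real i + 1/4) (5/4)))"
proof -
  have "closure (box (Complex (real i - 1/4) (3/4)) (Complex (real i + 1/4) (5/4))) =
      cbox (Complex (real i - 1/4) (3/4)) (Complex (real i + 1/4) (5/4))" for i
  proof (rule closure_box)
    have "Complex (real i) 1 \<in> box (Complex (real i - 1/4) (3/4)) (Complex (real i + 1/4) (5/4))"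
      by (simp add: in_box_complex_iff)
    then show "box (Complex (real i - 1/4) (3/4)) (Complex (real i + 1/4) (5/4)) \<noteq> {}" by blast
  qed
  moreover have "closure (\<Union>i\<in>{1..h}. B i) = (\<Union>i\<in>{1..h}. closure (B i))" for B :: "nat \<Rightarrow> complex set"
    by (rule finite_induct[OF finite_atLeastAtMost[of 1 h]]) auto
  ultimately show ?thesis
    unfolding holed_disk_def interior_diff interior_cbox by simp
qed

lemma frontier_holed_disk_nonempty: "frontier (holed_disk h) \<noteq> {}"
proof -
  have "0 \<in> holed_disk h"
    by (auto simp: in_box_complex_iff holed_disk_def in_cbox_complex_iff)
  moreover have "0 \<notin> interior (holed_disk h)"
    unfolding in_interior_holed_disk_iff by (simp add: in_box_complex_iff)
  ultimately show ?thesis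
    using closure_subset[of "holed_disk h"] by (auto simp: frontier_def)
qed

lemma in_frontier_holed_disk_iff:
  "p \<in> frontier (holed_disk h) \<longleftrightarrow> p \<in> holed_disk h \<and> (p \<notin> box 0 (Complex (real h + 1) 2) \<or>
    (\<exists>i\<in>{1..h}. p \<in> cbox (Complex (real i - 1/4) (3/4)) (Complex (real i + 1/4) (5/4))))"
  using in_interior_holed_disk_iff[of p h] closed_holed_disk[of h] by (auto simp: frontier_def)

lemma compact_surf: "compact (surf h)"
  unfolding surf_def by (rule compact_double[OF compact_holed_disk])

lemma surf_snd_nonzeroD:
  assumes "x \<in> surf h" "snd x \<noteq> 0"
  shows "fst x \<in> interior (holed_disk h)"
  using assms double_fst_in_interior frontier_holed_disk_nonempty by (auto simp: surf_def)


section \<open>Orientation\<close>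

lemma oriented_embedding_cong:
  assumes "\<And>z. z \<in> U \<Longrightarrow> \<phi> z = \<psi> z"
  shows "oriented_embedding h U \<phi> \<longleftrightarrow> oriented_embedding h U \<psi>"
proof -
  have *: "oriented_embedding h U \<psi>" if \<phi>: "oriented_embedding h U \<phi>" and eq: "\<And>z. z \<in> U \<Longrightarrow> \<phi> z = \<psi> z" for \<phi> \<psi>
  proof -
    have "embedding_map (top_of_set U) (Surf h) \<psi>"
      using \<phi> eq by (auto simp: oriented_embedding_def intro: embedding_map_eq)
    moreover have "local_degree (fst \<circ> \<psi>) z (sgn (snd (\<psi> z)))"
      if "z \<in> interior U" "snd (\<psi> z) \<noteq> 0" for z
    proof -
      have "z \<in> U" using that interior_subset by auto
      then have "local_degree (fst \<circ> \<phi>) z (sgn (snd (\<psi> z)))"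
        using \<phi> that eq by (auto simp: oriented_embedding_def)
      then show ?thesis
        using local_degree_cong[of "interior U" z "fst \<circ> \<phi>" "fst \<circ> \<psi>"] that eq interior_subset by fastforce
    qed
    ultimately show ?thesis by (auto simp: oriented_embedding_def)
  qed
  show ?thesis
    using *[of \<phi> \<psi>] *[of \<psi> \<phi>] assms by metis
qed

lemma embedding_mapD:
  assumes "embedding_map (top_of_set S) (Surf h) \<phi>"
  shows "continuous_on S \<phi>" "inj_on \<phi> S" "\<And>z. z \<in> S \<Longrightarrow> \<phi> z \<in> surf h"
proof -
  have c: "continuous_map (top_of_set S) (Surf h) \<phi>"
    using assms homeomorphic_imp_continuous_map continuous_map_into_fulltopology
    unfolding embedding_map_def by blast
  then show "continuous_on S \<phi>" "\<And>z. z \<in> S \<Longrightarrow> \<phi> z \<in> surf h"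
    by (auto simp: continuous_map_in_subtopology)
  show "inj_on \<phi> S"
    using assms homeomorphic_imp_injective_map[of "top_of_set S"] by (auto simp: embedding_map_def)
qed

text \<open>Off the seam an embedding stays locally on one sheet, where the planar projection is
  injective. This reduces orientation questions on the surface to planar injections.\<close>

lemma embedding_sheet:
  assumes \<phi>: "embedding_map (top_of_set S) (Surf h) \<phi>" and U: "open U" "U \<subseteq> S" and z: "z \<in> U" "snd (\<phi> z) \<noteq> 0"
  obtains e where "e > 0" "ball z e \<subseteq> U" "continuous_on (ball z e) (fst \<circ> \<phi>)" "inj_on (fst \<circ> \<phi>) (ball z e)"
    "\<And>w. w \<in> ball z e \<Longrightarrow> sgn (snd (\<phi> w)) = sgn (snd (\<phi> z))"
proof -
  note E = embedding_mapD[OF \<phi>]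
  let ?V = "U \<inter> (\<lambda>w. snd (\<phi> w) * sgn (snd (\<phi> z))) -` {0<..}"
  have "open ?V"
    using U by (intro continuous_open_preimage continuous_intros continuous_on_subset[OF E(1)]) auto
  moreover have "z \<in> ?V" using z by (auto simp: sgn_if)
  ultimately obtain e where e: "e > 0" "ball z e \<subseteq> ?V"
    by (meson open_contains_ball)
  show thesis
  proof
    show "e > 0" by fact
    show "ball z e \<subseteq> U" using e by auto
    then have sub: "ball z e \<subseteq> S" using U by auto
    show sg: "sgn (snd (\<phi> w)) = sgn (snd (\<phi> z))" if "w \<in> ball z e" for w
    proof -
      have "snd (\<phi> w) * sgn (snd (\<phi> z)) > 0" using e that by auto
      then show ?thesis using z by (auto simp: sgn_if zero_less_mult_iff split: if_splits)
    qed
    show "continuous_on (ball z e) (fst \<circ> \<phi>)"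
      unfolding o_def using sub by (intro continuous_intros continuous_on_subset[OF E(1)])
    show "inj_on (fst \<circ> \<phi>) (ball z e)"
    proof (rule inj_onI)
      fix v w assume vw: "v \<in> ball z e" "w \<in> ball z e" "(fst \<circ> \<phi>) v = (fst \<circ> \<phi>) w"
      then have "\<phi> v \<in> surf h" "\<phi> w \<in> surf h" using E(3) sub by auto
      then have "\<phi> v = \<phi> w"
        using double_eq_iff[of "\<phi> v" "holed_disk h" "\<phi> w"] vw sg by (auto simp: surf_def)
      then show "v = w"
        using inj_onD[OF E(2)] vw sub by blast
    qed
  qed
qed

lemma embedding_locally_injective:
  assumes "embedding_map (top_of_set S) (Surf h) \<phi>" "z \<in> interior S" "snd (\<phi> z) \<noteq> 0"
  shows "locally_injective_at (fst \<circ> \<phi>) z"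
  by (rule embedding_sheet[OF assms(1) open_interior interior_subset assms(2,3)])
     (auto simp: locally_injective_at_def)

text \<open>If an open set went into the seam, its planar projection would be injective, hence open
  by invariance of domain, and would lie in the frontier of a closed set. Such a frontier contains
  no nonempty open set.\<close>

lemma embedding_avoids:
  fixes S :: "complex set"
  assumes \<phi>: "embedding_map (top_of_set S) (Surf h) \<phi>" and U: "open U" "U \<subseteq> S" "U \<noteq> {}"
  obtains z where "z \<in> U" "snd (\<phi> z) \<noteq> 0"
proof -
  note E = embedding_mapD[OF \<phi>]
  have False if 0: "\<forall>z\<in>U. snd (\<phi> z) = 0"
  proof -
    have "open ((fst \<circ> \<phi>) ` U)"
    proof (rule invariance_of_domain)
      show "continuous_on U (fst \<circ> \<phi>)"
        unfolding o_def using U by (intro continuous_intros continuous_on_subset[OF E(1)])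
      show "inj_on (fst \<circ> \<phi>) U"
        using E(2) U 0 by (auto simp: inj_on_def prod_eq_iff subset_iff)
    qed fact
    moreover have fr: "(fst \<circ> \<phi>) ` U \<subseteq> frontier (holed_disk h)"
    proof (rule image_subsetI)
      fix z assume "z \<in> U"
      then have "\<phi> z \<in> double (holed_disk h)" "snd (\<phi> z) = 0"
        using 0 E(3) U by (auto simp: surf_def)
      then show "(fst \<circ> \<phi>) z \<in> frontier (holed_disk h)"
        using double_snd_eq_0_iff frontier_holed_disk_nonempty by simp
    qed
    moreover have "frontier (holed_disk h) \<subseteq> holed_disk h"
      by (simp add: closed_holed_disk frontier_subset_closed)
    ultimately have "(fst \<circ> \<phi>) ` U \<subseteq> interior (holed_disk h)"
      by (intro interior_maximal) auto
    then show False
      using U fr by (force simp: frontier_def)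
  qed
  then show thesis using that by blast
qed

text \<open>The local degree is constant on a ball that maps to one sheet, so one good point in each
  open set off the seam is enough. This permits ignoring nowhere dense sets on which a map is
  awkward to describe.\<close>

lemma oriented_embeddingI_dense:
  assumes \<phi>: "embedding_map (top_of_set S) (Surf h) \<phi>"
    and dense: "\<And>U. open U \<Longrightarrow> U \<subseteq> S \<Longrightarrow> U \<noteq> {} \<Longrightarrow> \<forall>z\<in>U. snd (\<phi> z) \<noteq> 0 \<Longrightarrow>
      \<exists>w\<in>U. local_degree (fst \<circ> \<phi>) w (sgn (snd (\<phi> w)))"
  shows "oriented_embedding h S \<phi>"
  unfolding oriented_embedding_def
proof (intro conjI ballI impI \<phi>)
  fix z assume z: "z \<in> interior S" "snd (\<phi> z) \<noteq> 0"
  obtain e where e: "e > 0" "ball z e \<subseteq> interior S" "continuous_on (ball z e) (fst \<circ> \<phi>)"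
    "inj_on (fst \<circ> \<phi>) (ball z e)" "\<And>w. w \<in> ball z e \<Longrightarrow> sgn (snd (\<phi> w)) = sgn (snd (\<phi> z))"
    by (rule embedding_sheet[OF \<phi> open_interior interior_subset z]) blast
  have "\<forall>w\<in>ball z e. snd (\<phi> w) \<noteq> 0"
    using e(5) z by (metis sgn_0_0)
  moreover have "ball z e \<subseteq> S" "ball z e \<noteq> {}"
    using e interior_subset[of S] by auto
  ultimately obtain w where w: "w \<in> ball z e" "local_degree (fst \<circ> \<phi>) w (sgn (snd (\<phi> w)))"
    using dense[of "ball z e"] open_ball by blast
  then have "local_degree (fst \<circ> \<phi>) z (sgn (snd (\<phi> w)))"
    using local_degree_const[OF open_ball convex_ball e(3,4) centre_in_ball[THEN iffD2, OF e(1)] w(1)] by blast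
  then show "local_degree (fst \<circ> \<phi>) z (sgn (snd (\<phi> z)))"
    unfolding e(5)[OF w(1)] .
qed

definition preserves_orientation :: "nat \<Rightarrow> (complex \<times> real \<Rightarrow> complex \<times> real) \<Rightarrow> bool" where
  "preserves_orientation h f \<longleftrightarrow>
     (\<forall>\<phi>. oriented_embedding h (ball 0 1) \<phi> \<longrightarrow> oriented_embedding h (ball 0 1) (f \<circ> \<phi>))"

text \<open>The equivalence in \<open>homeo_plus\<close> splits into one implication for
  \<open>f\<close> and one for its inverse. The map \<open>f'\<close> has to be inverse to
  \<open>f\<close> only on the surface, so it may be given by a formula without restriction.\<close>

lemma homeo_plusI:
  assumes ext: "f \<in> extensional (surf h)" and hom: "homeomorphic_maps (Surf h) (Surf h) f f'"
    and f: "preserves_orientation h f" and f': "preserves_orientation h f'"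
  shows "f \<in> homeo_plus h"
  unfolding homeo_plus_def
proof (intro CollectI conjI allI impI ext)
  show "homeomorphic_map (Surf h) (Surf h) f"
    using hom homeomorphic_maps_map by blast
  fix \<phi> :: "complex \<Rightarrow> complex \<times> real" assume \<phi>: "\<phi> ` ball 0 1 \<subseteq> surf h"
  show "oriented_embedding h (ball 0 1) \<phi> \<longleftrightarrow> oriented_embedding h (ball 0 1) (f \<circ> \<phi>)"
  proof
    assume "oriented_embedding h (ball 0 1) (f \<circ> \<phi>)"
    then have "oriented_embedding h (ball 0 1) (f' \<circ> (f \<circ> \<phi>))"
      using f' by (simp add: preserves_orientation_def)
    moreover have "(f' \<circ> (f \<circ> \<phi>)) z = \<phi> z" if "z \<in> ball 0 1" for z
      using that \<phi> hom unfolding homeomorphic_maps_def topspace_euclidean_subtopology o_def by blast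
    ultimately show "oriented_embedding h (ball 0 1) \<phi>"
      using oriented_embedding_cong[of "ball 0 1" "f' \<circ> (f \<circ> \<phi>)" \<phi> h] by simp
  qed (use f in \<open>simp add: preserves_orientation_def\<close>)
qed

lemma embedding_map_homeomorphic_compose:
  assumes "homeomorphic_map (Surf h) (Surf h) f" "embedding_map (top_of_set S) (Surf h) \<phi>"
  shows "embedding_map (top_of_set S) (Surf h) (f \<circ> \<phi>)"
  using assms surjective_embedding_map[of "Surf h" "Surf h" f] by (intro embedding_map_compose) auto

text \<open>Doubling keeps each point on its sheet, so the required sign is unchanged, while
  composition with \<open>\<rho>\<close> multiplies the planar degree by 1.\<close>

lemma double_map_preserves_orientation:
  assumes \<rho>: "bordered_map (holed_disk h) (holed_disk h) \<rho>"
    and hom: "homeomorphic_map (Surf h) (Surf h) (double_map (holed_disk h) \<rho>)"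
    and deg: "\<And>p. p \<in> interior (holed_disk h) \<Longrightarrow> locally_injective_at \<rho> p \<and> local_degree \<rho> p 1"
  shows "preserves_orientation h (double_map (holed_disk h) \<rho>)"
  unfolding preserves_orientation_def oriented_embedding_def
proof (intro allI impI conjI ballI)
  fix \<phi> assume \<phi>: "embedding_map (top_of_set (ball 0 1)) (Surf h) \<phi> \<and>
    (\<forall>z\<in>interior (ball 0 1). snd (\<phi> z) \<noteq> 0 \<longrightarrow> local_degree (fst \<circ> \<phi>) z (sgn (snd (\<phi> z))))"
  let ?F = "double_map (holed_disk h) \<rho>"
  show "embedding_map (top_of_set (ball 0 1)) (Surf h) (?F \<circ> \<phi>)"
    using embedding_map_homeomorphic_compose[OF hom] \<phi> by blast
  fix z :: complex assume z: "z \<in> interior (ball 0 1)" "snd ((?F \<circ> \<phi>) z) \<noteq> 0"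
  have zs: "\<phi> z \<in> surf h"
    using \<phi> z embedding_mapD(3) interior_subset by blast
  have sg: "sgn (snd ((?F \<circ> \<phi>) z)) = sgn (snd (\<phi> z))"
    using sgn_double_map[OF \<rho>] zs by (simp add: surf_def)
  then have nz: "snd (\<phi> z) \<noteq> 0" using z by (metis sgn_0_0)
  have d: "local_degree (fst \<circ> \<phi>) z (sgn (snd (\<phi> z)))"
    using \<phi> z nz by blast
  have "fst (\<phi> z) \<in> interior (holed_disk h)"
    using surf_snd_nonzeroD[OF zs nz] .
  then have "local_degree (\<rho> \<circ> (fst \<circ> \<phi>)) z (1 * sgn (snd (\<phi> z)))"
    using deg \<phi> z nz by (intro local_degree_compose d embedding_locally_injective[of "ball 0 1" h]) auto
  moreover have "\<rho> \<circ> (fst \<circ> \<phi>) = fst \<circ> (?F \<circ> \<phi>)" by auto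
  ultimately show "local_degree (fst \<circ> (?F \<circ> \<phi>)) z (sgn (snd ((?F \<circ> \<phi>) z)))"
    unfolding sg by simp
qed


section \<open>The mapping class group is a group\<close>

lemma homeo_plusD:
  assumes "f \<in> homeo_plus h"
  shows "f \<in> extensional (surf h)" "homeomorphic_map (Surf h) (Surf h) f" "f \<in> Bij (surf h)"
    and "x \<in> surf h \<Longrightarrow> f x \<in> surf h" "continuous_map (Surf h) (Surf h) f"
proof -
  show 1: "f \<in> extensional (surf h)" and 2: "homeomorphic_map (Surf h) (Surf h) f"
    using assms by (auto simp: homeo_plus_def)
  then have "bij_betw f (surf h) (surf h)"
    by (simp add: homeomorphic_map_def bij_betw_def quotient_map_def)
  with 1 show "f \<in> Bij (surf h)" "x \<in> surf h \<Longrightarrow> f x \<in> surf h"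
    by (auto simp: Bij_def bij_betwE)
  show "continuous_map (Surf h) (Surf h) f"
    using 2 homeomorphic_imp_continuous_map by blast
qed

lemma homeo_plus_oriented_iff:
  assumes "f \<in> homeo_plus h" "\<phi> ` ball 0 1 \<subseteq> surf h"
  shows "oriented_embedding h (ball 0 1) (f \<circ> \<phi>) \<longleftrightarrow> oriented_embedding h (ball 0 1) \<phi>"
  using assms by (auto simp: homeo_plus_def)

lemma compose_in_homeo_plus:
  assumes g: "g \<in> homeo_plus h" and f: "f \<in> homeo_plus h"
  shows "compose (surf h) g f \<in> homeo_plus h"
  unfolding homeo_plus_def
proof (intro CollectI conjI allI impI)
  show "compose (surf h) g f \<in> extensional (surf h)"
    by simp
  have "homeomorphic_map (Surf h) (Surf h) (g \<circ> f)"
    using f g homeomorphic_map_compose homeo_plusD(2) by blast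
  then show "homeomorphic_map (Surf h) (Surf h) (compose (surf h) g f)"
    by (rule homeomorphic_map_eq) (simp add: compose_def)
  fix \<phi> :: "complex \<Rightarrow> complex \<times> real" assume \<phi>: "\<phi> ` ball 0 1 \<subseteq> surf h"
  then have f\<phi>: "(f \<circ> \<phi>) ` ball 0 1 \<subseteq> surf h"
    using homeo_plusD(4)[OF f] by (simp add: image_subset_iff)
  have "oriented_embedding h (ball 0 1) (compose (surf h) g f \<circ> \<phi>) \<longleftrightarrow>
      oriented_embedding h (ball 0 1) (g \<circ> (f \<circ> \<phi>))"
    by (rule oriented_embedding_cong) (use \<phi> in \<open>auto simp: compose_def image_subset_iff\<close>)
  then show "oriented_embedding h (ball 0 1) \<phi> \<longleftrightarrow> oriented_embedding h (ball 0 1) (compose (surf h) g f \<circ> \<phi>)"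
    using homeo_plus_oriented_iff[OF g f\<phi>] homeo_plus_oriented_iff[OF f \<phi>] by simp
qed

lemma id_in_homeo_plus: "(\<lambda>x\<in>surf h. x) \<in> homeo_plus h"
  unfolding homeo_plus_def
proof (intro CollectI conjI allI impI)
  show "homeomorphic_map (Surf h) (Surf h) (\<lambda>x\<in>surf h. x)"
    by (rule homeomorphic_map_eq[of _ _ id]) auto
  fix \<phi> :: "complex \<Rightarrow> complex \<times> real" assume "\<phi> ` ball 0 1 \<subseteq> surf h"
  then show "oriented_embedding h (ball 0 1) \<phi> \<longleftrightarrow> oriented_embedding h (ball 0 1) ((\<lambda>x\<in>surf h. x) \<circ> \<phi>)"
    by (intro oriented_embedding_cong) (auto simp: image_subset_iff)
qed simp

lemma inv_in_homeo_plus: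
  assumes f: "f \<in> homeo_plus h"
  shows "(\<lambda>x\<in>surf h. inv_into (surf h) f x) \<in> homeo_plus h"
proof -
  let ?i = "\<lambda>x\<in>surf h. inv_into (surf h) f x"
  have bij: "bij_betw f (surf h) (surf h)"
    using homeo_plusD(3)[OF f] by (simp add: Bij_def)
  have fi: "f (?i x) = x" "?i x \<in> surf h" if "x \<in> surf h" for x
    using that bij bij_betw_inv_into_right[OF bij that] by (auto simp: bij_betw_def inv_into_into)
  obtain i where i: "homeomorphic_maps (Surf h) (Surf h) f i"
    using homeo_plusD(2)[OF f] homeomorphic_map_maps by blast
  then have "?i x = i x" if "x \<in> surf h" for x
    using that bij unfolding homeomorphic_maps_def topspace_euclidean_subtopology
    by (metis (no_types, lifting) bij_betw_inv_into_left continuous_map_image_subset_topspace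
        image_subset_iff restrict_apply' topspace_euclidean_subtopology)
  moreover have "homeomorphic_map (Surf h) (Surf h) i"
    using i homeomorphic_maps_map by blast
  ultimately have "homeomorphic_map (Surf h) (Surf h) ?i"
    by (metis homeomorphic_map_eq topspace_euclidean_subtopology)
  moreover have "oriented_embedding h (ball 0 1) \<phi> \<longleftrightarrow> oriented_embedding h (ball 0 1) (?i \<circ> \<phi>)"
    if \<phi>: "\<phi> ` ball 0 1 \<subseteq> surf h" for \<phi>
  proof -
    have "(?i \<circ> \<phi>) ` ball 0 1 \<subseteq> surf h"
      using \<phi> fi(2) by (auto simp: image_subset_iff)
    from homeo_plus_oriented_iff[OF f this] show ?thesis
      using \<phi> fi(1) oriented_embedding_cong[of "ball 0 1" "f \<circ> (?i \<circ> \<phi>)" \<phi> h] by (auto simp: image_subset_iff)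
  qed
  ultimately show ?thesis
    unfolding homeo_plus_def by auto
qed

lemma subgroup_homeo_plus: "subgroup (homeo_plus h) (BijGroup (surf h))"
proof
  show "homeo_plus h \<subseteq> carrier (BijGroup (surf h))"
    using homeo_plusD(3) by (auto simp: BijGroup_def)
  show "f \<otimes>\<^bsub>BijGroup (surf h)\<^esub> g \<in> homeo_plus h" if "f \<in> homeo_plus h" "g \<in> homeo_plus h" for f g
    using that homeo_plusD(3) compose_in_homeo_plus by (auto simp: BijGroup_def)
  show "\<one>\<^bsub>BijGroup (surf h)\<^esub> \<in> homeo_plus h"
    using id_in_homeo_plus by (simp add: BijGroup_def)
  show "inv\<^bsub>BijGroup (surf h)\<^esub> f \<in> homeo_plus h" if "f \<in> homeo_plus h" for f
    using that homeo_plusD(3) inv_in_homeo_plus by (simp add: inv_BijGroup)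
qed

lemma group_homeo_group: "group (homeo_group h)"
  unfolding homeo_group_def by (rule subgroup.subgroup_is_group[OF subgroup_homeo_plus group_BijGroup])

lemma carrier_homeo_group [simp]: "carrier (homeo_group h) = homeo_plus h"
  by (simp add: homeo_group_def)

lemma mult_homeo_group:
  assumes "g \<in> homeo_plus h" "f \<in> homeo_plus h"
  shows "g \<otimes>\<^bsub>homeo_group h\<^esub> f = compose (surf h) g f"
  using assms homeo_plusD(3) by (simp add: homeo_group_def BijGroup_def)

lemma one_homeo_group: "\<one>\<^bsub>homeo_group h\<^esub> = (\<lambda>x\<in>surf h. x)"
  by (simp add: homeo_group_def BijGroup_def)

lemma pow_homeo_group:
  assumes f: "f \<in> homeo_plus h" and x: "x \<in> surf h"
  shows "(f [^]\<^bsub>homeo_group h\<^esub> (n::nat)) x = (f ^^ n) x" "(f ^^ n) x \<in> surf h"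
proof -
  interpret G: group "homeo_group h" by (rule group_homeo_group)
  have "(f [^]\<^bsub>homeo_group h\<^esub> n) x = (f ^^ n) x \<and> (f ^^ n) x \<in> surf h"
  proof (induction n)
    case 0
    then show ?case using x by (simp add: one_homeo_group)
  next
    case (Suc n)
    have "f [^]\<^bsub>homeo_group h\<^esub> n \<in> homeo_plus h"
      using G.nat_pow_closed[of f n] f by simp
    moreover have "f [^]\<^bsub>homeo_group h\<^esub> Suc n = f \<otimes>\<^bsub>homeo_group h\<^esub> f [^]\<^bsub>homeo_group h\<^esub> n"
      using G.nat_pow_Suc2[of f n] f by simp
    ultimately show ?case
      using Suc x f homeo_plusD(4)[OF f] by (simp add: mult_homeo_group compose_def)
  qed
  then show "(f [^]\<^bsub>homeo_group h\<^esub> n) x = (f ^^ n) x" "(f ^^ n) x \<in> surf h"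
    by auto
qed

section \<open>Isotopies and normality of the subgroup of maps isotopic to the identity\<close>

abbreviation isotopic :: "nat \<Rightarrow> (complex \<times> real \<Rightarrow> complex \<times> real) \<Rightarrow> (complex \<times> real \<Rightarrow> complex \<times> real) \<Rightarrow> bool" where
  "isotopic h \<equiv> homotopic_with (\<lambda>k. restrict k (surf h) \<in> homeo_plus h) (Surf h) (Surf h)"

lemma isotopic_cong:
  assumes "isotopic h f g" "\<And>x. x \<in> surf h \<Longrightarrow> f' x = f x" "\<And>x. x \<in> surf h \<Longrightarrow> g' x = g x"
  shows "isotopic h f' g'"
  by (rule homotopic_with_eq[OF assms(1)])
     (use assms(2,3) in \<open>auto cong: restrict_cong\<close>)

lemma isotopic_compose_left:
  assumes "isotopic h f f'" "g \<in> homeo_plus h"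
  shows "isotopic h (g \<circ> f) (g \<circ> f')"
proof (rule homotopic_with_compose_continuous_map_left[OF assms(1) homeo_plusD(5)[OF assms(2)]])
  fix k assume "restrict k (surf h) \<in> homeo_plus h"
  moreover have "restrict (g \<circ> k) (surf h) = compose (surf h) g (restrict k (surf h))"
    by (auto simp: compose_def)
  ultimately show "restrict (g \<circ> k) (surf h) \<in> homeo_plus h"
    using compose_in_homeo_plus assms(2) by simp
qed

lemma isotopic_compose_right:
  assumes "isotopic h f f'" "g \<in> homeo_plus h"
  shows "isotopic h (f \<circ> g) (f' \<circ> g)"
proof (rule homotopic_with_compose_continuous_map_right[OF assms(1) homeo_plusD(5)[OF assms(2)]])
  fix k assume "restrict k (surf h) \<in> homeo_plus h"
  moreover have "restrict (k \<circ> g) (surf h) = compose (surf h) (restrict k (surf h)) g"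
    using homeo_plusD(4)[OF assms(2)] by (auto simp: compose_def)
  ultimately show "restrict (k \<circ> g) (surf h) \<in> homeo_plus h"
    using compose_in_homeo_plus assms(2) by simp
qed

text \<open>Every closure property comes from composing an isotopy that starts at \<open>id\<close>
  with a fixed homeomorphism: on the left by \<open>g\<close> for products, on the left by the
  inverse of \<open>f\<close> and then reversed for inverses, on both sides for conjugates.\<close>

lemma normal_homeo_0: "homeo_0 h \<lhd> homeo_group h"
proof -
  interpret G: group "homeo_group h" by (rule group_homeo_group)
  have comp: "isotopic h id (compose (surf h) g f)" if "f \<in> homeo_plus h" "g \<in> homeo_plus h"
      "isotopic h id f" "isotopic h id g" for f g
  proof -
    have "isotopic h g (g \<circ> f)"
      using isotopic_compose_left[OF that(3,2)] by simp
    then have "isotopic h id (g \<circ> f)"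
      using that(4) homotopic_with_trans by blast
    then show ?thesis
      by (rule isotopic_cong) (auto simp: compose_def)
  qed
  have inv: "(inv\<^bsub>homeo_group h\<^esub> f) (f x) = x" "f ((inv\<^bsub>homeo_group h\<^esub> f) x) = x" "inv\<^bsub>homeo_group h\<^esub> f \<in> homeo_plus h"
    if f: "f \<in> homeo_plus h" and x: "x \<in> surf h" for f x
  proof -
    show i: "inv\<^bsub>homeo_group h\<^esub> f \<in> homeo_plus h"
      using G.inv_closed[of f] f by simp
    show "(inv\<^bsub>homeo_group h\<^esub> f) (f x) = x"
      using G.l_inv[of f] f x mult_homeo_group[OF i f] fun_cong[of _ _ x]
      by (auto simp: compose_def one_homeo_group dest!: fun_cong[of _ _ x])
    show "f ((inv\<^bsub>homeo_group h\<^esub> f) x) = x"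
      using G.r_inv[of f] f x mult_homeo_group[OF f i]
      by (auto simp: compose_def one_homeo_group dest!: fun_cong[of _ _ x])
  qed
  \<comment> \<open>The facts \<open>inv\<close> are stated at a point of the surface, so one point
    must exist before membership of the inverse can be drawn from them.\<close>
  have ne: "surf h \<noteq> {}"
  proof -
    obtain p where "p \<in> frontier (holed_disk h)"
      using frontier_holed_disk_nonempty by blast
    then have "(p, 0) \<in> surf h"
      by (simp add: surf_def double_def in_frontier_holed_disk_iff)
    then show ?thesis by blast
  qed
  show ?thesis
    unfolding G.normal_inv_iff
  proof (intro conjI ballI)
    show "subgroup (homeo_0 h) (homeo_group h)"
    proof
      show "homeo_0 h \<subseteq> carrier (homeo_group h)"
        by (auto simp: homeo_0_def)
      show "f \<otimes>\<^bsub>homeo_group h\<^esub> g \<in> homeo_0 h" if "f \<in> homeo_0 h" "g \<in> homeo_0 h" for f g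
        using that comp compose_in_homeo_plus by (auto simp: homeo_0_def mult_homeo_group)
      have "isotopic h id (\<lambda>x\<in>surf h. x)"
        by (rule homotopic_with_equal) (use id_in_homeo_plus[of h] in \<open>auto simp: id_def\<close>)
      then show "\<one>\<^bsub>homeo_group h\<^esub> \<in> homeo_0 h"
        using id_in_homeo_plus by (simp add: homeo_0_def one_homeo_group)
      show "inv\<^bsub>homeo_group h\<^esub> f \<in> homeo_0 h" if "f \<in> homeo_0 h" for f
      proof -
        have f: "f \<in> homeo_plus h" "isotopic h id f" using that by (auto simp: homeo_0_def)
        note i = inv[OF f(1)]
        have ip: "inv\<^bsub>homeo_group h\<^esub> f \<in> homeo_plus h" using i(3) ne by blast
        have "isotopic h (inv\<^bsub>homeo_group h\<^esub> f) id"
          by (rule isotopic_cong[OF isotopic_compose_left[OF f(2) ip]]) (use i in auto)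
        then show ?thesis
          using ip homotopic_with_symD by (auto simp: homeo_0_def)
      qed
    qed
    fix g f assume "g \<in> carrier (homeo_group h)" "f \<in> homeo_0 h"
    then have g: "g \<in> homeo_plus h" and f: "f \<in> homeo_plus h" "isotopic h id f"
      by (auto simp: homeo_0_def)
    note i = inv[OF g]
    have ip: "inv\<^bsub>homeo_group h\<^esub> g \<in> homeo_plus h" using i(3) ne by blast
    have eq: "g \<otimes>\<^bsub>homeo_group h\<^esub> f \<otimes>\<^bsub>homeo_group h\<^esub> inv\<^bsub>homeo_group h\<^esub> g =
       compose (surf h) (compose (surf h) g f) (inv\<^bsub>homeo_group h\<^esub> g)"
      using g f ip by (simp add: mult_homeo_group compose_in_homeo_plus)
    have "isotopic h ((g \<circ> id) \<circ> (inv\<^bsub>homeo_group h\<^esub> g)) ((g \<circ> f) \<circ> (inv\<^bsub>homeo_group h\<^esub> g))"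
      by (intro isotopic_compose_right isotopic_compose_left f g ip)
    then have "isotopic h id (compose (surf h) (compose (surf h) g f) (inv\<^bsub>homeo_group h\<^esub> g))"
      by (rule isotopic_cong) (use i homeo_plusD(4)[OF ip] in \<open>auto simp: compose_def\<close>)
    then show "g \<otimes>\<^bsub>homeo_group h\<^esub> f \<otimes>\<^bsub>homeo_group h\<^esub> inv\<^bsub>homeo_group h\<^esub> g \<in> homeo_0 h"
      unfolding eq using compose_in_homeo_plus f g ip by (auto simp: homeo_0_def)
  qed
qed

lemma group_hom_mapping_class: "group_hom (homeo_group h) (MCG h) (mapping_class h)"
proof -
  interpret N: normal "homeo_0 h" "homeo_group h" by (rule normal_homeo_0)
  show ?thesis
    unfolding group_hom_def group_hom_axioms_def MCG_def mapping_class_def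
    using group_homeo_group N.factorgroup_is_group N.r_coset_hom_Mod by blast
qed

lemma mapping_class_eq_one_iff:
  assumes "f \<in> homeo_plus h"
  shows "mapping_class h f = \<one>\<^bsub>MCG h\<^esub> \<longleftrightarrow> f \<in> homeo_0 h"
proof -
  interpret N: normal "homeo_0 h" "homeo_group h" by (rule normal_homeo_0)
  show ?thesis
    unfolding MCG_def mapping_class_def one_FactGroup
    using N.rcos_const N.rcos_self assms N.is_subgroup by (metis carrier_homeo_group group_homeo_group)
qed

text \<open>If \<open>a\<close> permutes the \<open>t i\<close> cyclically by conjugation, then \<open>(a t\<^sub>1)\<^sup>g\<close> telescopes to
  \<open>t\<^sub>2 \<cdots> t\<^sub>g (a\<^sup>g t\<^sub>1)\<close>.\<close>

lemma (in group) foldr_mult_closed: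
  assumes "\<And>i. i \<in> set xs \<Longrightarrow> t i \<in> carrier G" "z \<in> carrier G"
  shows "foldr (\<lambda>i u. t i \<otimes> u) xs z \<in> carrier G"
  using assms by (induction xs) auto

lemma (in group) foldr_mult_right:
  assumes "\<And>i. i \<in> set xs \<Longrightarrow> t i \<in> carrier G" "z \<in> carrier G"
  shows "foldr (\<lambda>i u. t i \<otimes> u) xs z = foldr (\<lambda>i u. t i \<otimes> u) xs \<one> \<otimes> z"
  using assms foldr_mult_closed[where t = t and z = \<one>] by (induction xs) (auto simp: m_assoc)

lemma (in group) pow_cyclic_conjugates:
  assumes a: "a \<in> carrier G" "a [^] n = \<one>" and n: "n \<ge> 1"
    and t: "\<And>i. i \<in> {1..n} \<Longrightarrow> t i \<in> carrier G"
    and conj: "\<And>i. i \<in> {1..<n} \<Longrightarrow> a \<otimes> t i = t (Suc i) \<otimes> a"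
    and comm: "\<And>i. i \<in> {1..n} \<Longrightarrow> t 1 \<otimes> t i = t i \<otimes> t 1"
  shows "(a \<otimes> t 1) [^] n = foldr (\<lambda>i u. t i \<otimes> u) [1..<Suc n] \<one>"
proof -
  \<comment> \<open>\<open>?P k\<close> is the product of \<open>t 2\<close> up to
    \<open>t (k + 1)\<close>. For \<open>k < n\<close> the power \<open>(a t_1)^k\<close> equals
    \<open>?P k\<close> times \<open>a^k\<close>; the last step is separate because
    \<open>conj\<close> ends at \<open>t n\<close>.\<close>
  let ?P = "\<lambda>k. foldr (\<lambda>i u. t i \<otimes> u) [2..<k + 2] \<one>"
  have cl: "?P k \<in> carrier G" if "k < n" for k
    using that t by (intro foldr_mult_closed) auto
  have shift: "a [^] k \<otimes> t 1 = t (Suc k) \<otimes> a [^] k" if "k < n" for k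
    using that
  proof (induction k)
    case (Suc k)
    then have "t 1 \<in> carrier G" "t (Suc k) \<in> carrier G" "t (Suc (Suc k)) \<in> carrier G"
      using t by auto
    then have "a [^] Suc k \<otimes> t 1 = (a \<otimes> t (Suc k)) \<otimes> a [^] k"
      using Suc a by (simp only: nat_pow_Suc2) (simp add: m_assoc)
    also have "\<dots> = t (Suc (Suc k)) \<otimes> a [^] Suc k"
      using Suc.prems conj[of "Suc k"] a \<open>t (Suc (Suc k)) \<in> carrier G\<close>
      by (simp only: nat_pow_Suc2) (simp add: m_assoc)
    finally show ?case .
  qed (use t n in auto)
  have t1: "t 1 \<in> carrier G" using t n by auto
  have step: "?P (Suc k) = ?P k \<otimes> t (k + 2)" if "Suc k < n" for k
  proof -
    have "t (k + 2) \<in> carrier G" "\<And>i. i \<in> set [2..<k + 2] \<Longrightarrow> t i \<in> carrier G"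
      using t that by auto
    then show ?thesis
      using foldr_mult_right[of "[2..<k + 2]" t "t (k + 2)"] by simp
  qed
  have pow: "(a \<otimes> t 1) [^] k = ?P k \<otimes> a [^] k" if "k < n" for k
    using that
  proof (induction k)
    case 0
    then show ?case by simp
  next
    case (Suc k)
    have tk: "t (k + 2) \<in> carrier G" using t Suc by auto
    have "(a \<otimes> t 1) [^] Suc k = ?P k \<otimes> (a [^] Suc k \<otimes> t 1)"
      using Suc cl[of k] a t1 by (simp add: m_assoc)
    also have "\<dots> = (?P k \<otimes> t (k + 2)) \<otimes> a [^] Suc k"
      using shift[OF Suc.prems] cl[of k] a tk Suc.prems by (simp add: m_assoc)
    finally show ?case
      using step[OF Suc.prems] by simp
  qed
  have "(a \<otimes> t 1) [^] n = (a \<otimes> t 1) [^] Suc (n - 1)"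
    using n by simp
  also have "\<dots> = (?P (n - 1) \<otimes> a [^] (n - 1)) \<otimes> (a \<otimes> t 1)"
    using pow[of "n - 1"] n by (simp del: Suc_pred)
  also have "\<dots> = ?P (n - 1) \<otimes> (a [^] Suc (n - 1) \<otimes> t 1)"
    using cl[of "n - 1"] n a t1 by (simp add: m_assoc del: Suc_pred)
  also have "\<dots> = ?P (n - 1) \<otimes> t 1"
    using a n t1 by simp
  \<comment> \<open>With \<open>a^n = 1\<close> the factor \<open>t 1\<close> is left at the right
    end, and \<open>comm\<close> brings it to the front.\<close>
  also have "?P (n - 1) \<otimes> t 1 = t 1 \<otimes> ?P (n - 1)"
  proof -
    have "foldr (\<lambda>i u. t i \<otimes> u) xs \<one> \<otimes> t 1 = t 1 \<otimes> foldr (\<lambda>i u. t i \<otimes> u) xs \<one>"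
      if "set xs \<subseteq> {1..n}" for xs
      using that
    proof (induction xs)
      case (Cons i xs)
      have c: "t i \<in> carrier G" "foldr (\<lambda>i u. t i \<otimes> u) xs \<one> \<in> carrier G"
        using Cons t by (auto intro!: foldr_mult_closed)
      have "foldr (\<lambda>i u. t i \<otimes> u) (i # xs) \<one> \<otimes> t 1 = t i \<otimes> (t 1 \<otimes> foldr (\<lambda>i u. t i \<otimes> u) xs \<one>)"
        using Cons c t1 by (simp add: m_assoc)
      also have "\<dots> = (t 1 \<otimes> t i) \<otimes> foldr (\<lambda>i u. t i \<otimes> u) xs \<one>"
        using comm[of i] Cons c t1 by (simp add: m_assoc)
      finally show ?case using c t1 by (simp add: m_assoc)
    qed (use t1 in simp)
    from this[of "[2..<n - 1 + 2]"] show ?thesis using n by fastforce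
  qed
  also have "\<dots> = foldr (\<lambda>i u. t i \<otimes> u) [1..<Suc n] \<one>"
  proof -
    have "[1..<Suc n] = 1 # [2..<n - 1 + 2]"
      using n by (subst upt_conv_Cons) (auto simp: numeral_2_eq_2)
    then show ?thesis by simp
  qed
  finally show ?thesis .
qed


section \<open>Dehn twists\<close>

text \<open>The parameter \<open>s\<close> is real although only \<open>1\<close> and
  \<open>-1\<close> give maps that fix the boundary circles: the values in between join the twist to
  the identity when its local degree is computed.\<close>

definition twist_by :: "real \<Rightarrow> complex \<Rightarrow> complex" where
  "twist_by s z = z * cis (2 * pi * s * (norm z - 1))"

lemma twist_by_1: "twist_by 1 = model_twist"
  by (auto simp: twist_by_def model_twist_def)

lemma norm_twist_by [simp]: "norm (twist_by s z) = norm z"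
  by (simp add: twist_by_def norm_mult)

lemma twist_by_twist_by: "twist_by s (twist_by s' z) = twist_by (s + s') z"
  by (simp add: twist_by_def norm_mult cis_mult algebra_simps)

lemma twist_by_0 [simp]: "twist_by 0 z = z"
  by (simp add: twist_by_def)

lemma inj_twist_by: "twist_by s z = twist_by s w \<longleftrightarrow> z = w"
  by (metis twist_by_0 twist_by_twist_by add.left_inverse)

lemma continuous_on_twist_by [continuous_intros]: "continuous_on A (twist_by s)"
  unfolding twist_by_def by (intro continuous_intros)

lemma twist_by_boundary:
  assumes "norm z = 1 \<or> norm z = 2" "s \<in> {1, -1}"
  shows "twist_by s z = z"
proof -
  have "cis (- (2 * pi)) = 1"
    by (simp add: cis.code complex_eq_iff)
  then have "cis (2 * pi * s * (norm z - 1)) = 1"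
    using assms by auto
  then show ?thesis
    by (simp add: twist_by_def)
qed

lemma locally_injective_at_twist_by: "locally_injective_at (twist_by s) z"
  by (rule locally_injective_atI[of UNIV]) (auto simp: inj_def inj_twist_by intro: continuous_intros)

text \<open>Shrinking \<open>s\<close> to 0 deforms the twist to the identity through injective
  maps, so the image of the circle never meets the image of its centre.\<close>

lemma local_degree_twist_by: "local_degree (twist_by s) z 1"
proof -
  have "winding_number (twist_by s \<circ> circlepath z r) (twist_by s z) = 1" if r: "r > 0" for r
  proof -
    define H where "H = (\<lambda>(u, t). twist_by (u * s) (circlepath z r t) - twist_by (u * s) z)"
    have ne: "circlepath z r t \<noteq> z" for t
      using r by (simp add: circlepath)
    have "homotopic_loops (-{0}) (\<lambda>t. circlepath z r t - z) (\<lambda>t. (twist_by s \<circ> circlepath z r) t - twist_by s z)"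
      unfolding homotopic_loops
    proof (intro exI[of _ H] conjI ballI)
      show "continuous_on ({0..1} \<times> {0..1}) H"
        unfolding H_def case_prod_unfold twist_by_def circlepath by (intro continuous_intros)
      show "H \<in> {0..1} \<times> {0..1} \<rightarrow> - {0}"
        using ne by (auto simp: H_def inj_twist_by)
      show "pathfinish (H \<circ> Pair t) = pathstart (H \<circ> Pair t)" for t
        by (simp add: H_def pathfinish_def pathstart_def circlepath)
    qed (auto simp: H_def)
    then have "winding_number (\<lambda>t. circlepath z r t - z) 0 = winding_number (\<lambda>t. (twist_by s \<circ> circlepath z r) t - twist_by s z) 0"
      by (rule winding_number_homotopic_loops)
    then have "winding_number (circlepath z r) z = winding_number (twist_by s \<circ> circlepath z r) (twist_by s z)"
      unfolding winding_number_offset[of _ z] winding_number_offset[of _ "twist_by s z"] .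
    then show ?thesis
      using r by (simp add: winding_number_circlepath)
  qed
  then show ?thesis
    unfolding local_degree_def by (auto simp: eventually_at_right_field intro!: exI[of _ 1])
qed

lemma in_interior_annulus:
  assumes "1 < norm z" "norm z < 2"
  shows "z \<in> interior annulus"
proof (rule interiorI)
  show "open {z::complex. 1 < norm z \<and> norm z < 2}"
    by (intro open_Collect_conj open_Collect_less continuous_intros)
qed (use assms in \<open>auto simp: annulus_def\<close>)

text \<open>Between the heights 3/4 and 1 the strip lies inside the open hole. Thus the closed
  condition \<open>Im (fst x) \<le> 3/4\<close> can be replaced by an open one, which separates the
  strip below a hole from the part of the surface above it.\<close>

lemma strip_below_hole:
  assumes x: "x \<in> surf h" and i: "i \<in> {1..h}" and Re: "\<bar>Re (fst x) - real i\<bar> < 1/8" and Im: "Im (fst x) < 1"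
  shows "Im (fst x) \<le> 3/4"
proof (rule ccontr)
  assume "\<not> ?thesis"
  then have "fst x \<in> box (Complex (real i - 1/4) (3/4)) (Complex (real i + 1/4) (5/4))"
    using Re Im unfolding in_box_complex_iff complex.sel abs_diff_less_iff by auto
  moreover have "fst x \<in> holed_disk h"
    using x by (auto simp: surf_def double_def)
  ultimately show False
    using i by (auto simp: holed_disk_def)
qed

text \<open>The parametrisation is inverted explicitly: the radius is read off from the horizontal
  position, the cosine of the angle from the height, and the sign of the sine from the
  sheet.\<close>

lemma nbhd_a_preimage:
  assumes i: "i \<in> {1..h}" and x: "x \<in> surf h" and Re: "\<bar>Re (fst x) - real i\<bar> \<le> 1/8" and Im: "Im (fst x) \<le> 3/4"
  obtains z where "norm z = (3 - 8 * (Re (fst x) - real i)) / 2" "z \<in> annulus" "nbhd_a h i z = x"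
proof -
  obtain p t where pt: "x = (p, t)"
    by (cases x)
  let ?d = "infdist p (frontier (holed_disk h))"
  have p: "p \<in> holed_disk h" "\<bar>t\<bar> = ?d"
    using x by (auto simp: pt surf_def double_def)
  then have y: "0 \<le> Im p" "Im p \<le> 3/4"
    using Im by (auto simp: holed_disk_def in_cbox_complex_iff pt)
  define \<nu> where "\<nu> = (3 - 8 * (Re p - real i)) / 2"
  have \<nu>: "1 \<le> \<nu>" "\<nu> \<le> 2"
  proof -
    have "Re p - real i \<le> 1/8" "- (Re p - real i) \<le> 1/8"
      using Re by (simp_all only: pt fst_conv abs_le_iff)
    then show "1 \<le> \<nu>" "\<nu> \<le> 2"
      by (simp_all add: \<nu>_def field_simps)
  qed
  define c where "c = 8/3 * Im p - 1"
  define s where "s = (if t < 0 then -1 else 1) * sqrt (1 - c\<^sup>2)"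
  have c1: "\<bar>c\<bar> \<le> 1"
    using y by (auto simp: c_def abs_le_iff)
  then have c2: "c\<^sup>2 \<le> 1"
    by (simp add: abs_square_le_1)
  then have cs: "c\<^sup>2 + s\<^sup>2 = 1"
    by (simp add: s_def power_mult_distrib)
  define z where "z = \<nu> *\<^sub>R Complex c s"
  have nz: "norm z = \<nu>"
  proof -
    have "norm (Complex c s) = 1"
      using cs by (simp add: cmod_def)
    then show ?thesis
      using \<nu> by (simp add: z_def)
  qed
  have za: "z \<in> annulus"
    using nz \<nu> by (simp add: annulus_def)
  have st: "strip_a i z = p"
  proof -
    have "Re z / norm z = c"
      unfolding nz using \<nu> by (simp add: z_def)
    then show ?thesis
      by (simp add: strip_a_def complex_eq_iff nz \<nu>_def field_simps) (simp add: c_def field_simps)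
  qed
  have dz: "?d = 0 \<longleftrightarrow> Im z = 0"
    using nbhd_a_infdist[OF i za] by (simp add: st)
  have "sgn (Im z) * ?d = t"
  proof (cases "Im z = 0")
    case True
    with dz p show ?thesis by simp
  next
    case False
    then have "sgn (Im z) = (if t < 0 then -1 else 1)"
      using c2 \<nu> by (auto simp: z_def s_def sgn_mult zero_less_mult_iff sgn_if split: if_splits)
    then show ?thesis
      using p by auto
  qed
  then have "nbhd_a h i z = x"
    by (simp add: nbhd_a_def st pt)
  with nz za show thesis
    by (intro that[of z]) (simp_all add: \<nu>_def pt)
qed

definition strip_nbhd :: "nat \<Rightarrow> nat \<Rightarrow> (complex \<times> real) set" where
  "strip_nbhd h i = {x \<in> surf h. \<bar>Re (fst x) - real i\<bar> \<le> 1/8 \<and> Im (fst x) \<le> 3/4}"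

lemma nbhd_a_image:
  assumes "i \<in> {1..h}"
  shows "nbhd_a h i ` annulus = strip_nbhd h i"
proof
  show "nbhd_a h i ` annulus \<subseteq> strip_nbhd h i"
    using nbhd_a_in_surf[OF assms] strip_a_bounds by (auto simp: strip_nbhd_def nbhd_a_def)
  show "strip_nbhd h i \<subseteq> nbhd_a h i ` annulus"
  proof
    fix x assume "x \<in> strip_nbhd h i"
    then obtain z where "z \<in> annulus" "nbhd_a h i z = x"
      using nbhd_a_preimage[OF assms, of x] unfolding strip_nbhd_def by blast
    then show "x \<in> nbhd_a h i ` annulus" by blast
  qed
qed

lemma norm_inv_nbhd_a:
  assumes i: "i \<in> {1..h}" and x: "x \<in> strip_nbhd h i"
  shows "nbhd_a h i (inv_into annulus (nbhd_a h i) x) = x" "inv_into annulus (nbhd_a h i) x \<in> annulus"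
    "norm (inv_into annulus (nbhd_a h i) x) = (3 - 8 * (Re (fst x) - real i)) / 2"
proof -
  let ?z = "inv_into annulus (nbhd_a h i) x"
  show 1: "nbhd_a h i ?z = x" and "?z \<in> annulus"
    using x nbhd_a_image[OF i] by (auto intro: f_inv_into_f inv_into_into)
  have "Re (fst x) = Re (strip_a i ?z)"
    using 1 by (metis fst_conv nbhd_a_def)
  then show "norm ?z = (3 - 8 * (Re (fst x) - real i)) / 2"
    by (simp add: strip_a_def field_simps)
qed

section \<open>The twist of a strip neighbourhood as a homeomorphism\<close>

definition annular_map :: "nat \<Rightarrow> nat \<Rightarrow> real \<Rightarrow> complex \<times> real \<Rightarrow> complex \<times> real" where
  "annular_map h i s = (\<lambda>x\<in>surf h. if x \<in> nbhd_a h i ` annulus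
     then nbhd_a h i (twist_by s (inv_into annulus (nbhd_a h i) x)) else x)"

lemma twist_map_eq: "twist_map h (nbhd_a h i) = annular_map h i 1"
  unfolding twist_map_def annular_map_def twist_by_1 ..

lemma annular_map_nbhd_a:
  assumes "i \<in> {1..h}" "z \<in> annulus"
  shows "annular_map h i s (nbhd_a h i z) = nbhd_a h i (twist_by s z)"
  using assms nbhd_a_in_surf[OF assms] inj_on_nbhd_a[OF assms(1)]
  by (simp add: annular_map_def)

lemma annular_map_outside:
  "x \<in> surf h \<Longrightarrow> x \<notin> nbhd_a h i ` annulus \<Longrightarrow> annular_map h i s x = x"
  by (simp add: annular_map_def)

lemma twist_by_annulus: "z \<in> annulus \<Longrightarrow> twist_by s z \<in> annulus"
  by (simp add: annulus_def)

lemma annular_map_in_surf: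
  assumes i: "i \<in> {1..h}" and x: "x \<in> surf h"
  shows "annular_map h i s x \<in> surf h"
proof (cases "x \<in> nbhd_a h i ` annulus")
  case True
  then obtain z where "z \<in> annulus" "x = nbhd_a h i z" by auto
  then show ?thesis
    using annular_map_nbhd_a[OF i] nbhd_a_in_surf[OF i] twist_by_annulus by simp
qed (use x annular_map_outside in simp)

lemma annular_map_inverse:
  assumes i: "i \<in> {1..h}" and x: "x \<in> surf h"
  shows "annular_map h i s (annular_map h i (- s) x) = x"
proof (cases "x \<in> nbhd_a h i ` annulus")
  case True
  then obtain z where "z \<in> annulus" "x = nbhd_a h i z" by auto
  then show ?thesis
    using annular_map_nbhd_a[OF i] twist_by_annulus by (simp add: twist_by_twist_by)
qed (use x annular_map_outside in simp)

text \<open>Two closed pieces are pasted: the strip neighbourhood, and \<open>?C\<close>, the points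
  that lie beside the open strip or at height at least 1. They meet only in the two boundary
  circles, where the twist is the identity since \<open>s\<close> is 1 or -1.\<close>

lemma continuous_on_annular_map:
  assumes i: "i \<in> {1..h}" and s: "s \<in> {1, -1}"
  shows "continuous_on (surf h) (annular_map h i s)"
proof -
  let ?\<alpha> = "nbhd_a h i" and ?\<kappa> = "inv_into annulus (nbhd_a h i)"
  let ?C = "surf h \<inter> ({x. 1/8 \<le> \<bar>Re (fst x) - real i\<bar>} \<union> {x. 1 \<le> Im (fst x)})"
  have im: "?\<alpha> ` annulus = strip_nbhd h i" by (rule nbhd_a_image[OF i])
  have cl: "compact (?\<alpha> ` annulus)"
    by (intro compact_continuous_image continuous_on_nbhd_a i compact_annulus)
  have "continuous_on (?\<alpha> ` annulus \<union> ?C) (\<lambda>x. if x \<in> ?\<alpha> ` annulus then ?\<alpha> (twist_by s (?\<kappa> x)) else x)"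
  proof (rule continuous_on_cases)
    show "closed (?\<alpha> ` annulus)"
      using cl by (rule compact_imp_closed)
    show "closed ?C"
      by (intro closed_Int compact_imp_closed[OF compact_surf] closed_Un closed_Collect_le continuous_intros)
    have k: "continuous_on (?\<alpha> ` annulus) ?\<kappa>"
      by (intro continuous_on_inv continuous_on_nbhd_a i compact_annulus) (simp add: inj_on_nbhd_a[OF i])
    show "continuous_on (?\<alpha> ` annulus) (\<lambda>x. ?\<alpha> (twist_by s (?\<kappa> x)))"
      by (rule continuous_on_compose2[OF continuous_on_nbhd_a[OF i]])
         (auto intro!: continuous_on_compose2[OF continuous_on_twist_by k] twist_by_annulus inv_into_into)
    have "?\<alpha> (twist_by s (?\<kappa> x)) = x" if x: "x \<in> ?\<alpha> ` annulus" "x \<in> ?C" for x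
    proof -
      have xs: "x \<in> strip_nbhd h i" using x im by simp
      then have "\<bar>Re (fst x) - real i\<bar> = 1/8"
        using x(2) by (auto simp: strip_nbhd_def)
      then have "norm (?\<kappa> x) = 1 \<or> norm (?\<kappa> x) = 2"
        unfolding norm_inv_nbhd_a(3)[OF i xs] by (auto simp: abs_if split: if_splits)
      then show ?thesis
        using norm_inv_nbhd_a(1)[OF i xs] twist_by_boundary[OF _ s] by simp
    qed
    then show "\<forall>x. x \<in> ?\<alpha> ` annulus \<and> x \<notin> ?\<alpha> ` annulus \<or> x \<in> ?C \<and> x \<in> ?\<alpha> ` annulus \<longrightarrow>
        ?\<alpha> (twist_by s (?\<kappa> x)) = x"
      by blast
  qed auto
  moreover have "surf h = ?\<alpha> ` annulus \<union> ?C"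
    using strip_below_hole[OF _ i] unfolding im by (force simp: strip_nbhd_def)
  ultimately have "continuous_on (surf h) (\<lambda>x. if x \<in> ?\<alpha> ` annulus then ?\<alpha> (twist_by s (?\<kappa> x)) else x)"
    by simp
  then show ?thesis
    unfolding annular_map_def by (simp cong: continuous_on_cong)
qed

lemma homeomorphic_maps_annular_map:
  assumes i: "i \<in> {1..h}" and s: "s \<in> {1, -1}"
  shows "homeomorphic_maps (Surf h) (Surf h) (annular_map h i s) (annular_map h i (- s))"
proof -
  have "- s \<in> {1, -1}" using s by auto
  then show ?thesis
    unfolding homeomorphic_maps_def topspace_euclidean_subtopology continuous_map_in_subtopology
      continuous_map_iff_continuous
    using annular_map_inverse[OF i, of _ s] annular_map_inverse[OF i, of _ "- s"]
      continuous_on_annular_map[OF i s] continuous_on_annular_map[OF i, of "- s"] annular_map_in_surf[OF i] by simp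
qed

text \<open>It suffices to compare local degrees away from the seam, its preimage, and the two boundary
  circles of the annulus, since all of these are nowhere dense.\<close>

lemma annular_map_preserves_orientation:
  assumes i: "i \<in> {1..h}" and s: "s \<in> {1, -1}"
  shows "preserves_orientation h (annular_map h i s)"
  unfolding preserves_orientation_def
proof (intro allI impI)
  fix \<phi> assume \<phi>: "oriented_embedding h (ball 0 1) \<phi>"
  let ?T = "annular_map h i s" and ?\<alpha> = "nbhd_a h i" and ?\<kappa> = "inv_into annulus (nbhd_a h i)"
  have em: "embedding_map (top_of_set (ball 0 1)) (Surf h) \<phi>"
    and deg: "\<And>z. z \<in> ball 0 1 \<Longrightarrow> snd (\<phi> z) \<noteq> 0 \<Longrightarrow> local_degree (fst \<circ> \<phi>) z (sgn (snd (\<phi> z)))"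
    using \<phi> by (auto simp: oriented_embedding_def interior_open)
  note E = embedding_mapD[OF em]
  have ha: "embedding_map (top_of_set annulus) (Surf h) ?\<alpha>"
    and dega: "\<And>z. z \<in> interior annulus \<Longrightarrow> snd (?\<alpha> z) \<noteq> 0 \<Longrightarrow> local_degree (fst \<circ> ?\<alpha>) z (sgn (snd (?\<alpha> z)))"
    using annulus_about_a[OF i] by (auto simp: annulus_about_def oriented_embedding_def)
  have cf: "continuous_on (ball 0 1) (\<lambda>z. fst (\<phi> z))"
    by (intro continuous_intros E)
  show "oriented_embedding h (ball 0 1) (?T \<circ> \<phi>)"
  proof (rule oriented_embeddingI_dense)
    show "embedding_map (top_of_set (ball 0 1)) (Surf h) (?T \<circ> \<phi>)"
      using embedding_map_homeomorphic_compose em homeomorphic_maps_annular_map[OF i s] homeomorphic_maps_map by blast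
    fix U :: "complex set" assume U: "open U" "U \<subseteq> ball 0 1" "U \<noteq> {}" "\<forall>z\<in>U. snd ((?T \<circ> \<phi>) z) \<noteq> 0"
    obtain z1 where z1: "z1 \<in> U" "snd (\<phi> z1) \<noteq> 0"
      using embedding_avoids[OF em U(1-3)] .
    obtain e where e: "e > 0" "ball z1 e \<subseteq> U" "continuous_on (ball z1 e) (fst \<circ> \<phi>)" "inj_on (fst \<circ> \<phi>) (ball z1 e)"
        "\<And>w. w \<in> ball z1 e \<Longrightarrow> sgn (snd (\<phi> w)) = sgn (snd (\<phi> z1))"
      by (rule embedding_sheet[OF em U(1,2) z1]) blast
    have "open ((fst \<circ> \<phi>) ` ball z1 e)"
      using e by (intro invariance_of_domain) auto
    moreover have "fst (\<phi> z1) \<in> (fst \<circ> \<phi>) ` ball z1 e"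
      using e by auto
    ultimately obtain \<delta> where \<delta>: "\<delta> > 0" "ball (fst (\<phi> z1)) \<delta> \<subseteq> (fst \<circ> \<phi>) ` ball z1 e"
      by (meson open_contains_ball)
    \<comment> \<open>The planar projection covers a disk about \<open>fst (\<phi> z1)\<close>, so a
      small horizontal shift can be realised; all but two shifts avoid the lines at distance 1/8
      from \<open>real i\<close>. After that, both lying in the twisted strip and lying outside it
      are open conditions.\<close>
    obtain \<eta> where \<eta>: "0 < \<eta>" "\<eta> < \<delta>" "\<bar>Re (fst (\<phi> z1)) + \<eta> - real i\<bar> \<noteq> 1/8"
    proof -
      have "infinite ({0<..<\<delta>} - {real i + 1/8 - Re (fst (\<phi> z1)), real i - 1/8 - Re (fst (\<phi> z1))})"
        using \<delta> by (intro Diff_infinite_finite) (auto simp: infinite_Ioo)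
      then obtain \<eta> where "\<eta> \<in> {0<..<\<delta>} - {real i + 1/8 - Re (fst (\<phi> z1)), real i - 1/8 - Re (fst (\<phi> z1))}"
        by (metis infinite_imp_nonempty ex_in_conv)
      then show thesis
        by (intro that[of \<eta>]) (auto simp: abs_if split: if_splits)
    qed
    have "fst (\<phi> z1) + of_real \<eta> \<in> ball (fst (\<phi> z1)) \<delta>"
      using \<eta> by (simp add: dist_norm)
    then obtain w where w: "w \<in> ball z1 e" "fst (\<phi> w) = fst (\<phi> z1) + of_real \<eta>"
      using \<delta> by fastforce
    have Re: "\<bar>Re (fst (\<phi> w)) - real i\<bar> \<noteq> 1/8"
      using \<eta> w by simp
    define \<sigma> where "\<sigma> = sgn (snd (\<phi> w))"
    have \<sigma>: "\<sigma> \<noteq> 0" "snd (\<phi> w) \<noteq> 0"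
      using e(5)[OF w(1)] z1(2) unfolding \<sigma>_def by (auto simp: sgn_zero_iff)
    have wU: "w \<in> U" "w \<in> ball 0 1" using w(1) e(2) U(2) by blast+
    have xs: "\<phi> w \<in> surf h" using E(3) wU by blast
    have dw: "local_degree (fst \<circ> \<phi>) w \<sigma>"
      unfolding \<sigma>_def using deg wU \<sigma> by blast
    show "\<exists>w\<in>U. local_degree (fst \<circ> (?T \<circ> \<phi>)) w (sgn (snd ((?T \<circ> \<phi>) w)))"
    proof (rule bexI[OF _ wU(1)])
      show "local_degree (fst \<circ> (?T \<circ> \<phi>)) w (sgn (snd ((?T \<circ> \<phi>) w)))"
      proof (cases "\<bar>Re (fst (\<phi> w)) - real i\<bar> < 1/8 \<and> Im (fst (\<phi> w)) < 1")
        case False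
        let ?V = "ball 0 1 \<inter> (\<lambda>z. fst (\<phi> z)) -` ({q. 1/8 < \<bar>Re q - real i\<bar>} \<union> {q. 3/4 < Im q})"
        have V: "open ?V" "w \<in> ?V"
        proof -
          show "open ?V"
            by (intro continuous_open_preimage cf open_Un open_Collect_less continuous_intros open_ball)
          show "w \<in> ?V" using False Re wU by auto
        qed
        have eq: "?T (\<phi> z) = \<phi> z" if "z \<in> ?V" for z
        proof (rule annular_map_outside)
          show "\<phi> z \<in> surf h" using that E(3) by blast
          show "\<phi> z \<notin> ?\<alpha> ` annulus"
            using that unfolding nbhd_a_image[OF i] by (auto simp: strip_nbhd_def)
        qed
        have "local_degree (fst \<circ> \<phi>) w \<sigma> \<longleftrightarrow> local_degree (fst \<circ> (?T \<circ> \<phi>)) w \<sigma>"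
          by (rule local_degree_cong[OF V]) (simp add: eq)
        then show ?thesis
          using dw eq[OF V(2)] by (simp add: \<sigma>_def)
      next
        case True
        let ?V = "ball 0 1 \<inter> (\<lambda>z. fst (\<phi> z)) -` ({q. \<bar>Re q - real i\<bar> < 1/8} \<inter> {q. Im q < 1})"
        have V: "open ?V" "w \<in> ?V"
        proof -
          show "open ?V"
            by (intro continuous_open_preimage cf open_Int open_Collect_less continuous_intros open_ball)
          show "w \<in> ?V" using True wU by auto
        qed
        have strip: "\<phi> z \<in> strip_nbhd h i" if "z \<in> ?V" for z
          using that E(3)[of z] strip_below_hole[OF _ i, of "\<phi> z"] by (auto simp: strip_nbhd_def)
        have \<kappa>: "?\<alpha> (?\<kappa> (\<phi> z)) = \<phi> z" "?\<kappa> (\<phi> z) \<in> annulus" "1 < norm (?\<kappa> (\<phi> z))" "norm (?\<kappa> (\<phi> z)) < 2" if "z \<in> ?V" for z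
        proof -
          note N = norm_inv_nbhd_a[OF i strip[OF that]]
          show "?\<alpha> (?\<kappa> (\<phi> z)) = \<phi> z" "?\<kappa> (\<phi> z) \<in> annulus" using N by auto
          show "1 < norm (?\<kappa> (\<phi> z))" "norm (?\<kappa> (\<phi> z)) < 2"
          proof -
            have "Re (fst (\<phi> z)) - real i < 1/8" "- (Re (fst (\<phi> z)) - real i) < 1/8"
              using that by (simp_all only: Int_iff vimage_eq mem_Collect_eq abs_less_iff)
            then show "1 < norm (?\<kappa> (\<phi> z))" "norm (?\<kappa> (\<phi> z)) < 2"
              unfolding N(3) by (simp_all add: field_simps)
          qed
        qed
        have k: "continuous_on (?\<alpha> ` annulus) ?\<kappa>"
          by (intro continuous_on_inv continuous_on_nbhd_a i compact_annulus) (simp add: inj_on_nbhd_a[OF i])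
        have li: "locally_injective_at (?\<kappa> \<circ> \<phi>) w"
        proof (rule locally_injective_atI[OF V])
          show "continuous_on ?V (?\<kappa> \<circ> \<phi>)"
            by (intro continuous_on_compose continuous_on_subset[OF k] continuous_on_subset[OF E(1)])
               (use strip nbhd_a_image[OF i] in auto)
          show "inj_on (?\<kappa> \<circ> \<phi>) ?V"
            using \<kappa>(1) inj_onD[OF E(2)] by (intro inj_onI) (metis IntD1 comp_apply)
        qed
        then obtain d where d: "local_degree (?\<kappa> \<circ> \<phi>) w d"
          using locally_injective_at_local_degree by blast
        let ?z = "?\<kappa> (\<phi> w)"
        have zi: "?z \<in> interior annulus"
          using \<kappa>(3,4)[OF V(2)] by (rule in_interior_annulus)
        have az: "?\<alpha> ?z = \<phi> w" using \<kappa>(1)[OF V(2)] .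
        \<comment> \<open>Near \<open>w\<close> the map \<open>\<phi>\<close> factors through the
          annulus. Both \<open>\<phi>\<close> and \<open>?\<alpha>\<close> have the sign
          \<open>\<sigma>\<close> of the sheet as planar degree, so the factor
          \<open>?\<kappa> \<circ> \<phi>\<close> has degree 1. Twisting keeps it at 1, and
          \<open>?\<alpha>\<close> then contributes the sign of the sheet on which the image
          lies.\<close>
        have "local_degree ((fst \<circ> ?\<alpha>) \<circ> (?\<kappa> \<circ> \<phi>)) w (\<sigma> * d)"
          using dega[OF zi] embedding_locally_injective[OF ha zi] \<sigma> az
          by (intro local_degree_compose li d) (auto simp: \<sigma>_def)
        then have "local_degree (fst \<circ> \<phi>) w (\<sigma> * d)"
          using local_degree_cong[OF V, of "(fst \<circ> ?\<alpha>) \<circ> (?\<kappa> \<circ> \<phi>)" "fst \<circ> \<phi>"] \<kappa>(1) by simp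
        then have "\<sigma> = \<sigma> * d"
          by (rule local_degree_unique[OF dw])
        then have "d = 1"
          using \<sigma>(1) by simp
        then have 1: "local_degree (twist_by s \<circ> (?\<kappa> \<circ> \<phi>)) w (1 * 1)"
          using d by (intro local_degree_compose li locally_injective_at_twist_by local_degree_twist_by) auto
        have 2: "locally_injective_at (twist_by s \<circ> (?\<kappa> \<circ> \<phi>)) w"
          by (intro locally_injective_at_compose li locally_injective_at_twist_by)
        have Teq: "?\<alpha> (twist_by s (?\<kappa> (\<phi> z))) = ?T (\<phi> z)" if "z \<in> ?V" for z
          using annular_map_nbhd_a[OF i \<kappa>(2)[OF that], of s] \<kappa>(1)[OF that] by simp
        have ti: "twist_by s ?z \<in> interior annulus"
          using \<kappa>(3,4)[OF V(2)] by (intro in_interior_annulus) auto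
        have nz: "snd (?\<alpha> (twist_by s ?z)) \<noteq> 0"
          using Teq[OF V(2)] U(4) wU(1) by simp
        have "local_degree ((fst \<circ> ?\<alpha>) \<circ> (twist_by s \<circ> (?\<kappa> \<circ> \<phi>))) w (sgn (snd (?\<alpha> (twist_by s ?z))) * (1 * 1))"
          using dega[OF ti nz] embedding_locally_injective[OF ha ti nz]
          by (intro local_degree_compose 1 2) auto
        then show ?thesis
          using local_degree_cong[OF V, of "(fst \<circ> ?\<alpha>) \<circ> (twist_by s \<circ> (?\<kappa> \<circ> \<phi>))" "fst \<circ> (?T \<circ> \<phi>)"]
            Teq Teq[OF V(2)] by simp
      qed
    qed
  qed
qed

lemma annular_map_in_homeo_plus:
  assumes "i \<in> {1..h}" "s \<in> {1, -1}"
  shows "annular_map h i s \<in> homeo_plus h"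
  by (rule homeo_plusI[OF _ homeomorphic_maps_annular_map[OF assms]])
     (use assms annular_map_preserves_orientation in \<open>auto simp: annular_map_def\<close>)

text \<open>For \<open>i \<noteq> j\<close> the strips are disjoint, having half-width 1/8 and axes
  at distance at least 1, and each map leaves its own strip invariant.\<close>

lemma annular_map_commute:
  assumes i: "i \<in> {1..h}" and j: "j \<in> {1..h}" and x: "x \<in> surf h"
  shows "annular_map h i s (annular_map h j s x) = annular_map h j s (annular_map h i s x)"
proof (cases "i = j")
  case False
  have "strip_nbhd h i \<inter> strip_nbhd h j = {}"
  proof -
    have "False" if "\<bar>r - real i\<bar> \<le> 1/8" "\<bar>r - real j\<bar> \<le> 1/8" for r
    proof -
      have "\<bar>real i - real j\<bar> \<le> 1/4" using that by linarith
      moreover have "\<bar>real i - real j\<bar> \<ge> 1" using False by linarith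
      ultimately show False by simp
    qed
    then show ?thesis unfolding strip_nbhd_def by blast
  qed
  then have disj: "nbhd_a h i ` annulus \<inter> nbhd_a h j ` annulus = {}"
    using nbhd_a_image i j by simp
  have inv: "annular_map h k s y \<in> nbhd_a h k ` annulus" if "k \<in> {1..h}" "y \<in> nbhd_a h k ` annulus" for k y
    using that annular_map_nbhd_a twist_by_annulus by fastforce
  show ?thesis
  proof (cases "x \<in> nbhd_a h i ` annulus \<or> x \<in> nbhd_a h j ` annulus")
    case True
    then show ?thesis
    proof
      assume "x \<in> nbhd_a h i ` annulus"
      then have "x \<notin> nbhd_a h j ` annulus" "annular_map h i s x \<notin> nbhd_a h j ` annulus"
        using disj inv[OF i, of x] by blast+
      then show ?thesis
        using annular_map_outside x annular_map_in_surf[OF i x] by metis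
    next
      assume "x \<in> nbhd_a h j ` annulus"
      then have "x \<notin> nbhd_a h i ` annulus" "annular_map h j s x \<notin> nbhd_a h i ` annulus"
        using disj inv[OF j, of x] by blast+
      then show ?thesis
        using annular_map_outside x annular_map_in_surf[OF j x] by metis
    qed
  qed (use annular_map_outside x in metis)
qed simp


section \<open>Radial coordinates on the rectangle\<close>

text \<open>A homeomorphism from the rectangle onto the unit disk under which the vertical strip
  \<open>5/8 \<le> x \<le> n + 3/8\<close>, \<open>0 \<le> y \<le> 3/2\<close> gets the polar coordinates \<open>(1 - y/3, 2 \<pi> x / n)\<close>, so that
  the rotation by \<open>2 \<pi> / n\<close> becomes a translation there.  First the vertical lines in the strip are tilted
  towards a common point; then the rays from this point are bent to the prescribed angles.  The
  second argument of the maximum in \<open>tilt_factor\<close> keeps the sides of the rectangle fixed, and the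
  second case of \<open>bend\<close> fills the remaining angles by a function that is \<open>\<plusminus>1\<close> on the two
  extreme rays of the strip.\<close>

abbreviation rect :: "nat \<Rightarrow> complex set" where
  "rect n \<equiv> cbox 0 (Complex (real n + 1) 2)"

definition half_width :: "nat \<Rightarrow> real" where
  "half_width n = (real n + 1) / 2"

text \<open>Half the width of the strip \<open>5/8 \<le> x \<le> n + 3/8\<close>, whose centre is
  \<open>half_width n\<close>; after tilting it is the slope of the two extreme rays.\<close>

definition slope :: "nat \<Rightarrow> real" where
  "slope n = real n / 2 - 1/8"

text \<open>The two lines cross at \<open>y = 3/2\<close> with value 1/2. The steeper one goes on to
  -1 at \<open>y = 2\<close>, so \<open>[0, 2]\<close> is mapped decreasingly onto
  \<open>[-1, 1]\<close>, and the bottom and the top both get absolute value 1.\<close>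

definition depth :: "real \<Rightarrow> real" where
  "depth y = min (1 - y / 3) (5 - 3 * y)"

text \<open>The strip stays 5/8 away from the sides and \<open>1 - 4/5 * 5/8 = 1/2\<close>: within
  it the second argument is at most 1/2 and the factor is just the depth, as long as this is at
  least 1/2. On the sides the second argument is 1. The bound 1/2 keeps the factor positive where
  the depth is not.\<close>

definition tilt_factor :: "nat \<Rightarrow> real \<Rightarrow> real \<Rightarrow> real" where
  "tilt_factor n a u = max (max a (1/2)) (1 - 4/5 * (half_width n - \<bar>u\<bar>))"

definition tilt :: "nat \<Rightarrow> complex \<Rightarrow> complex" where
  "tilt n p = Complex (depth (Im p))
     ((Re p - half_width n) * tilt_factor n (depth (Im p)) (Re p - half_width n))"

text \<open>The norm whose unit ball is the tilted rectangle, with half-sides 1 and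
  \<open>half_width n\<close>.\<close>

definition gauge_norm :: "nat \<Rightarrow> complex \<Rightarrow> real" where
  "gauge_norm n \<zeta> = max \<bar>Re \<zeta>\<bar> (\<bar>Im \<zeta>\<bar> / half_width n)"

text \<open>On the strip the angle reaches \<open>2 pi / n * slope n = pi - pi / (4 n)\<close>, so a
  sector of half-angle \<open>pi / (4 n)\<close> about the negative axis remains for the second
  case. Its denominator equals \<open>\<bar>Im \<zeta>\<bar>\<close> on the extreme rays, which
  makes the quotient 1 or -1 there.\<close>

definition bend :: "nat \<Rightarrow> complex \<Rightarrow> complex" where
  "bend n \<zeta> = (if \<bar>Im \<zeta>\<bar> - slope n * Re \<zeta> \<le> 0 then cis (2 * pi / real n * (Im \<zeta> / Re \<zeta>))
     else - cis (- (pi / (4 * real n)) * (Im \<zeta> / ((1 + 1 / slope n) * \<bar>Im \<zeta>\<bar> - Re \<zeta>))))"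

text \<open>The constant factor undoes the recentring of the horizontal coordinate at
  \<open>half_width n\<close>, so that the angle becomes \<open>2 pi x / n\<close>.\<close>

definition disk_chart :: "nat \<Rightarrow> complex \<Rightarrow> complex" where
  "disk_chart n p = of_real (gauge_norm n (tilt n p)) * (cis (2 * pi * half_width n / real n) * bend n (tilt n p))"

lemma in_rect_iff: "p \<in> rect n \<longleftrightarrow> \<bar>Re p - half_width n\<bar> \<le> half_width n \<and> 0 \<le> Im p \<and> Im p \<le> 2"
  by (auto simp: in_cbox_complex_iff half_width_def abs_le_iff field_simps)

lemma in_rect_interior_iff:
  "p \<in> box 0 (Complex (real n + 1) 2) \<longleftrightarrow> \<bar>Re p - half_width n\<bar> < half_width n \<and> 0 < Im p \<and> Im p < 2"
  unfolding in_box_complex_iff half_width_def abs_less_iff by (auto simp: field_simps)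

lemma half_width_pos [simp]: "half_width n > 0" "half_width n \<noteq> 0"
  by (simp_all add: half_width_def add_eq_0_iff2)

lemma slope_pos: "n > 0 \<Longrightarrow> slope n > 0" and slope_less: "slope n < half_width n"
  by (simp_all add: slope_def half_width_def)

lemma depth_inject: "depth y = depth y' \<longleftrightarrow> y = y'"
  by (auto simp: depth_def min_def split: if_splits)

lemma depth_bounds:
  assumes "0 \<le> y" "y \<le> 2"
  shows "\<bar>depth y\<bar> \<le> 1" "\<bar>depth y\<bar> = 1 \<longleftrightarrow> y = 0 \<or> y = 2"
  using assms by (auto simp: depth_def min_def abs_if split: if_splits)

lemma tilt_factor_pos: "tilt_factor n a u > 0"
  by (simp add: tilt_factor_def less_max_iff_disj)

lemma tilt_factor_le:
  assumes "a \<le> 1" "\<bar>u\<bar> \<le> half_width n"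
  shows "tilt_factor n a u \<le> 1"
  using assms by (simp add: tilt_factor_def)

text \<open>At a fixed height both \<open>\<bar>u\<bar>\<close> and the factor grow with
  \<open>\<bar>u\<bar>\<close>; this makes the tilt injective on each horizontal line.\<close>

lemma abs_tilt_mono:
  assumes "\<bar>u\<bar> < \<bar>v\<bar>"
  shows "\<bar>u * tilt_factor n a u\<bar> < \<bar>v * tilt_factor n a v\<bar>"
proof -
  have "tilt_factor n a u \<le> tilt_factor n a v"
    using assms unfolding tilt_factor_def by (intro max.mono) auto
  then have "\<bar>u\<bar> * tilt_factor n a u \<le> \<bar>u\<bar> * tilt_factor n a v"
    by (intro mult_left_mono) auto
  also have "\<dots> < \<bar>v\<bar> * tilt_factor n a v"
    using assms tilt_factor_pos by (intro mult_strict_right_mono)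
  finally show ?thesis
    using tilt_factor_pos[of n a] by (simp add: abs_mult less_imp_le)
qed

lemma tilt_inject: "tilt n p = tilt n q \<longleftrightarrow> p = q"
proof
  assume eq: "tilt n p = tilt n q"
  then have y: "Im p = Im q"
    by (simp add: tilt_def depth_inject)
  define a where "a = depth (Im q)"
  define u v where "u = Re p - half_width n" and "v = Re q - half_width n"
  have uv: "u * tilt_factor n a u = v * tilt_factor n a v"
    using eq y by (simp add: tilt_def a_def u_def v_def)
  then have "\<bar>u\<bar> = \<bar>v\<bar>"
    using abs_tilt_mono[of u v n a] abs_tilt_mono[of v u n a] by (metis linorder_neqE_linordered_idom order_less_irrefl)
  moreover from this have "tilt_factor n a u = tilt_factor n a v"
    by (simp add: tilt_factor_def)
  ultimately have "u = v"
    using uv tilt_factor_pos[of n a v] by simp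
  then show "p = q"
    using y by (simp add: u_def v_def complex_eq_iff)
qed simp

lemma continuous_on_tilt: "continuous_on A (tilt n)"
  unfolding tilt_def Complex_eq depth_def tilt_factor_def by (intro continuous_intros) auto

text \<open>On the left and right sides the factor is 1, and at the bottom and the top the depth is
  1 or -1. Elsewhere the factor is at most 1, so the point stays inside the unit ball of the
  gauge.\<close>

lemma gauge_norm_tilt:
  assumes "p \<in> rect n"
  shows "gauge_norm n (tilt n p) \<le> 1" "gauge_norm n (tilt n p) = 1 \<longleftrightarrow> p \<notin> box 0 (Complex (real n + 1) 2)"
proof -
  let ?u = "Re p - half_width n" and ?a = "depth (Im p)"
  have p: "\<bar>?u\<bar> \<le> half_width n" "0 \<le> Im p" "Im p \<le> 2"
    using assms by (auto simp: in_rect_iff)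
  note a = depth_bounds[OF p(2,3)]
  have F: "0 < tilt_factor n ?a ?u" "tilt_factor n ?a ?u \<le> 1"
    using tilt_factor_pos tilt_factor_le[of ?a ?u n] a(1) p(1) by auto
  have le: "\<bar>?u * tilt_factor n ?a ?u\<bar> \<le> \<bar>?u\<bar>"
    using F mult_left_mono[OF F(2), of "\<bar>?u\<bar>"] by (simp add: abs_mult)
  have eq: "\<bar>?u * tilt_factor n ?a ?u\<bar> = half_width n \<longleftrightarrow> \<bar>?u\<bar> = half_width n"
  proof
    assume "\<bar>?u\<bar> = half_width n"
    moreover from this have "tilt_factor n ?a ?u = 1"
      using a(1) by (simp add: tilt_factor_def)
    ultimately show "\<bar>?u * tilt_factor n ?a ?u\<bar> = half_width n" by simp
  qed (use le p in linarith)
  show "gauge_norm n (tilt n p) \<le> 1"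
    using a(1) le p(1) by (simp add: gauge_norm_def tilt_def)
  have "gauge_norm n (tilt n p) = 1 \<longleftrightarrow> \<bar>?a\<bar> = 1 \<or> \<bar>?u * tilt_factor n ?a ?u\<bar> / half_width n = 1"
    using a(1) le p(1) half_width_pos(1)[of n] unfolding gauge_norm_def tilt_def complex.sel
    by (auto simp: max_def)
  also have "\<dots> \<longleftrightarrow> p \<notin> box 0 (Complex (real n + 1) 2)"
    using a(2) eq p unfolding in_rect_interior_iff by (auto simp: field_simps)
  finally show "gauge_norm n (tilt n p) = 1 \<longleftrightarrow> p \<notin> box 0 (Complex (real n + 1) 2)" .
qed

lemma gauge_norm_eq_0_iff: "gauge_norm n \<zeta> = 0 \<longleftrightarrow> \<zeta> = 0"
proof -
  have "gauge_norm n \<zeta> = 0 \<longleftrightarrow> \<bar>Re \<zeta>\<bar> = 0 \<and> \<bar>Im \<zeta>\<bar> / half_width n = 0"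
    using half_width_pos(1)[of n] unfolding gauge_norm_def
    by (smt (verit, best) divide_nonneg_pos abs_ge_zero)
  then show ?thesis
    using half_width_pos(1)[of n] by (simp add: complex_eq_iff)
qed

lemma gauge_norm_nonneg: "gauge_norm n \<zeta> \<ge> 0"
  by (simp add: gauge_norm_def le_max_iff_disj)

lemma gauge_norm_scale:
  assumes "c \<ge> 0"
  shows "gauge_norm n (of_real c * \<zeta>) = c * gauge_norm n \<zeta>"
  using assms half_width_pos(1)[of n] by (simp add: gauge_norm_def abs_mult max_mult_distrib_left)

lemma norm_bend [simp]: "norm (bend n \<zeta>) = 1"
  by (simp add: bend_def)

lemma bend_denominator:
  assumes "n > 0" "0 \<le> \<bar>Im \<zeta>\<bar> - slope n * Re \<zeta>" "\<zeta> \<noteq> 0"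
  shows "(1 + 1 / slope n) * \<bar>Im \<zeta>\<bar> - Re \<zeta> > 0"
    and "\<bar>Im \<zeta>\<bar> \<le> (1 + 1 / slope n) * \<bar>Im \<zeta>\<bar> - Re \<zeta>"
    and "0 < \<bar>Im \<zeta>\<bar> - slope n * Re \<zeta> \<Longrightarrow> \<bar>Im \<zeta>\<bar> < (1 + 1 / slope n) * \<bar>Im \<zeta>\<bar> - Re \<zeta>"
proof -
  note s = slope_pos[OF assms(1)]
  \<comment> \<open>The denominator is \<open>\<bar>Im \<zeta>\<bar>\<close> plus a multiple of the
    amount by which \<open>\<zeta>\<close> lies beyond the extreme ray.\<close>
  have eq: "(1 + 1 / slope n) * \<bar>Im \<zeta>\<bar> - Re \<zeta> = \<bar>Im \<zeta>\<bar> + (\<bar>Im \<zeta>\<bar> - slope n * Re \<zeta>) / slope n"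
    using s by (simp add: field_simps)
  show le: "\<bar>Im \<zeta>\<bar> \<le> (1 + 1 / slope n) * \<bar>Im \<zeta>\<bar> - Re \<zeta>"
    unfolding eq using assms(2) s by simp
  show "\<bar>Im \<zeta>\<bar> < (1 + 1 / slope n) * \<bar>Im \<zeta>\<bar> - Re \<zeta>" if "0 < \<bar>Im \<zeta>\<bar> - slope n * Re \<zeta>"
    unfolding eq using that s by simp
  show "(1 + 1 / slope n) * \<bar>Im \<zeta>\<bar> - Re \<zeta> > 0"
  proof (cases "Im \<zeta> = 0")
    case True
    then have "Re \<zeta> \<noteq> 0" using assms(3) by (simp add: complex_eq_iff)
    moreover have "Re \<zeta> \<le> 0" using assms(2) s True by (simp add: mult_le_0_iff)
    ultimately show ?thesis using True by simp
  qed (use le in linarith)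
qed

lemma slope_angle: "n > 0 \<Longrightarrow> 2 * pi / real n * slope n = pi - pi / (4 * real n)"
  by (simp add: slope_def field_simps)

lemma bend_Re_pos:
  assumes "n > 0" "\<bar>Im \<zeta>\<bar> - slope n * Re \<zeta> \<le> 0" "\<zeta> \<noteq> 0"
  shows "Re \<zeta> > 0" "\<bar>Im \<zeta> / Re \<zeta>\<bar> \<le> slope n" "\<bar>2 * pi / real n * (Im \<zeta> / Re \<zeta>)\<bar> \<le> pi - pi / (4 * real n)"
proof -
  note s = slope_pos[OF assms(1)]
  have "0 \<le> slope n * Re \<zeta>" using assms(2) by linarith
  then have "Re \<zeta> \<ge> 0" using s by (simp add: zero_le_mult_iff)
  moreover have "Re \<zeta> \<noteq> 0" using assms by (auto simp: complex_eq_iff)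
  ultimately show pos: "Re \<zeta> > 0" by simp
  then show b: "\<bar>Im \<zeta> / Re \<zeta>\<bar> \<le> slope n"
    using assms(2) by (simp add: abs_divide field_simps)
  have "\<bar>2 * pi / real n * (Im \<zeta> / Re \<zeta>)\<bar> = 2 * pi / real n * \<bar>Im \<zeta> / Re \<zeta>\<bar>"
    by (simp add: abs_mult)
  also have "\<dots> \<le> 2 * pi / real n * slope n"
    using b by (intro mult_left_mono) auto
  finally show "\<bar>2 * pi / real n * (Im \<zeta> / Re \<zeta>)\<bar> \<le> pi - pi / (4 * real n)"
    using slope_angle[OF assms(1)] by simp
qed

text \<open>On an extreme ray \<open>Im \<zeta> / Re \<zeta>\<close> is plus or minus
  \<open>slope n\<close> and the other quotient is 1 or -1 with the same sign \<open>e\<close>, so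
  by \<open>slope_angle\<close> both formulas give the angle
  \<open>e * (pi - pi / (4 n))\<close>.\<close>

lemma continuous_on_bend:
  assumes n: "n > 0"
  shows "continuous_on (- {0}) (bend n)"
  unfolding bend_def
proof (rule continuous_on_cases_le)
  show "continuous_on {\<zeta> \<in> - {0}. \<bar>Im \<zeta>\<bar> - slope n * Re \<zeta> \<le> 0} (\<lambda>\<zeta>. cis (2 * pi / real n * (Im \<zeta> / Re \<zeta>)))"
    using bend_Re_pos(1)[OF n] by (intro continuous_intros) fastforce
  show "continuous_on {\<zeta> \<in> - {0}. 0 \<le> \<bar>Im \<zeta>\<bar> - slope n * Re \<zeta>}
     (\<lambda>\<zeta>. - cis (- (pi / (4 * real n)) * (Im \<zeta> / ((1 + 1 / slope n) * \<bar>Im \<zeta>\<bar> - Re \<zeta>))))"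
    using bend_denominator(1)[OF n] by (intro continuous_intros) fastforce
  show "continuous_on (- {0}) (\<lambda>\<zeta>. \<bar>Im \<zeta>\<bar> - slope n * Re \<zeta>)"
    by (intro continuous_intros)
  fix \<zeta> :: complex assume z: "\<zeta> \<in> - {0}" "\<bar>Im \<zeta>\<bar> - slope n * Re \<zeta> = 0"
  have pos: "Re \<zeta> > 0" using bend_Re_pos(1)[OF n] z by auto
  have s: "slope n > 0" using slope_pos[OF n] .
  have im: "\<bar>Im \<zeta>\<bar> = slope n * Re \<zeta>" "\<bar>Im \<zeta>\<bar> > 0" using z pos s by auto
  have D: "(1 + 1 / slope n) * \<bar>Im \<zeta>\<bar> - Re \<zeta> = \<bar>Im \<zeta>\<bar>"
    unfolding im(1) using s by (simp add: field_simps)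
  define e where "e = sgn (Im \<zeta>)"
  have e: "e \<in> {1, -1}" "Im \<zeta> = e * \<bar>Im \<zeta>\<bar>" using im(2) by (auto simp: e_def sgn_if)
  have "Im \<zeta> / Re \<zeta> = e * slope n" "Im \<zeta> / ((1 + 1 / slope n) * \<bar>Im \<zeta>\<bar> - Re \<zeta>) = e"
    unfolding D using e(2) im pos by (metis nonzero_mult_div_cancel_right times_divide_eq_right less_irrefl)+
  then have "2 * pi / real n * (Im \<zeta> / Re \<zeta>) = e * (2 * pi / real n * slope n)"
    "- (pi / (4 * real n)) * (Im \<zeta> / ((1 + 1 / slope n) * \<bar>Im \<zeta>\<bar> - Re \<zeta>)) = - e * (pi / (4 * real n))"
    by (simp_all only: mult.left_commute mult_minus_left mult.commute)
  then have "cis (2 * pi / real n * (Im \<zeta> / Re \<zeta>)) = cis (e * (pi - pi / (4 * real n)))"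
    "- cis (- (pi / (4 * real n)) * (Im \<zeta> / ((1 + 1 / slope n) * \<bar>Im \<zeta>\<bar> - Re \<zeta>))) = - cis (- e * (pi / (4 * real n)))"
    unfolding slope_angle[OF n] by (simp_all only:)
  moreover have "cis (e * (pi - x)) = - cis (- e * x)" for x
    using e(1) by (auto simp: complex_eq_iff)
  ultimately show "cis (2 * pi / real n * (Im \<zeta> / Re \<zeta>)) =
      - cis (- (pi / (4 * real n)) * (Im \<zeta> / ((1 + 1 / slope n) * \<bar>Im \<zeta>\<bar> - Re \<zeta>)))"
    by simp
qed

lemma cis_inject:
  assumes "\<bar>x\<bar> < pi" "\<bar>y\<bar> < pi" "cis x = cis y"
  shows "x = y"
proof -
  have "Arg (cis x) = x" "Arg (cis x) = y"
    using assms by (auto intro!: cis_Arg_unique)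
  then show ?thesis by simp
qed

text \<open>The real part of \<open>bend\<close> tells the two cases apart: it is at least
  \<open>cos (pi - pi / (4 n))\<close> on the strip and smaller beyond it. Within a case the angle
  determines \<open>Im / Re\<close> or \<open>Im / ?D\<close>, and \<open>?D\<close> is positively
  homogeneous, so the ray is determined.\<close>

lemma bend_eq_imp_scale:
  assumes n: "n > 0" and nz: "\<zeta> \<noteq> 0" "\<xi> \<noteq> 0" and eq: "bend n \<zeta> = bend n \<xi>"
  obtains c where "c > 0" "\<xi> = of_real c * \<zeta>"
proof -
  let ?S = "\<lambda>\<zeta>. \<bar>Im \<zeta>\<bar> - slope n * Re \<zeta> \<le> 0"
  let ?D = "\<lambda>\<zeta>. (1 + 1 / slope n) * \<bar>Im \<zeta>\<bar> - Re \<zeta>"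
  have small: "pi / (4 * real n) > 0" "pi / (4 * real n) \<le> pi / 4" using n by (auto simp: field_simps)
  have D: "?D \<zeta> > 0" "\<bar>Im \<zeta> / ?D \<zeta>\<bar> < 1" if "\<not> ?S \<zeta>" "\<zeta> \<noteq> 0" for \<zeta>
    using bend_denominator[OF n, of \<zeta>] that by (auto simp: abs_divide)
  have angle: "\<bar>- (pi / (4 * real n)) * (Im \<zeta> / ?D \<zeta>)\<bar> < pi / (4 * real n)" if "\<not> ?S \<zeta>" "\<zeta> \<noteq> 0" for \<zeta>
  proof -
    have "\<bar>- (pi / (4 * real n)) * (Im \<zeta> / ?D \<zeta>)\<bar> = pi / (4 * real n) * \<bar>Im \<zeta> / ?D \<zeta>\<bar>"
      by (simp add: abs_mult)
    also have "\<dots> < pi / (4 * real n) * 1"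
      using D(2)[OF that] small by (intro mult_strict_left_mono)
    finally show ?thesis by simp
  qed
  have mixed: "bend n \<zeta> \<noteq> bend n \<xi>" if "?S \<zeta>" "\<not> ?S \<xi>" "\<zeta> \<noteq> 0" "\<xi> \<noteq> 0" for \<zeta> \<xi>
  proof -
    have "Re (bend n \<xi>) = - cos \<bar>- (pi / (4 * real n)) * (Im \<xi> / ?D \<xi>)\<bar>"
      using that by (simp only: bend_def if_False cos_abs_real uminus_complex.sel cis.sel)
    also have "\<dots> < - cos (pi / (4 * real n))"
      using angle[OF that(2,4)] small unfolding neg_less_iff_less by (intro cos_monotone_0_pi) auto
    also have "\<dots> = cos (pi - pi / (4 * real n))"
      by simp
    also have "\<dots> \<le> cos \<bar>2 * pi / real n * (Im \<zeta> / Re \<zeta>)\<bar>"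
      using bend_Re_pos(3)[OF n that(1,3)] small by (intro cos_monotone_0_pi_le) auto
    also have "\<dots> = Re (bend n \<zeta>)"
      using that by (simp only: bend_def if_True cos_abs_real cis.sel)
    finally show ?thesis by auto
  qed
  show thesis
  proof (cases "?S \<zeta>")
    case True
    then have S: "?S \<xi>" using mixed[of \<zeta> \<xi>] eq nz by blast
    have "2 * pi / real n * (Im \<zeta> / Re \<zeta>) = 2 * pi / real n * (Im \<xi> / Re \<xi>)"
      using bend_Re_pos(3)[OF n True nz(1)] bend_Re_pos(3)[OF n S nz(2)] small eq True S
      by (intro cis_inject) (auto simp: bend_def)
    moreover have "2 * pi / real n \<noteq> 0" using n by simp
    ultimately have "Im \<zeta> / Re \<zeta> = Im \<xi> / Re \<xi>" by (metis mult_left_cancel)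
    moreover have "Re \<zeta> > 0" "Re \<xi> > 0"
      using bend_Re_pos(1)[OF n True nz(1)] bend_Re_pos(1)[OF n S nz(2)] by auto
    ultimately show thesis
      by (intro that[of "Re \<xi> / Re \<zeta>"]) (auto simp: complex_eq_iff field_simps)
  next
    case False
    then have S: "\<not> ?S \<xi>" using mixed[of \<xi> \<zeta>] eq nz by metis
    have "- (pi / (4 * real n)) * (Im \<zeta> / ?D \<zeta>) = - (pi / (4 * real n)) * (Im \<xi> / ?D \<xi>)"
      using angle[OF False nz(1)] angle[OF S nz(2)] small eq False S pi_gt_zero
      by (intro cis_inject) (auto simp: bend_def)
    moreover have "- (pi / (4 * real n)) \<noteq> 0" using n by simp
    ultimately have g: "Im \<zeta> / ?D \<zeta> = Im \<xi> / ?D \<xi>" by (metis mult_left_cancel)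
    have d: "?D \<zeta> > 0" "?D \<xi> > 0" using D(1) False S nz by auto
    define c where "c = ?D \<xi> / ?D \<zeta>"
    have c: "c > 0" using d by (simp add: c_def)
    have im: "Im \<xi> = c * Im \<zeta>"
    proof -
      have "Im \<xi> = (Im \<xi> / ?D \<xi>) * ?D \<xi>" using d by simp
      also have "\<dots> = (Im \<zeta> / ?D \<zeta>) * ?D \<xi>" using g by simp
      finally show ?thesis by (simp add: c_def mult.commute)
    qed
    have "?D \<xi> = c * ?D \<zeta>" using d by (simp add: c_def)
    then have "Re \<xi> = c * Re \<zeta>"
      using im c by (simp add: abs_mult algebra_simps)
    then show thesis
      using im c by (intro that[of c]) (auto simp: complex_eq_iff)
  qed
qed

text \<open>Where the radius \<open>k\<close> vanishes the direction \<open>e\<close> may jump, but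
  the product is squeezed to 0. This serves both polar constructions, the disk chart and the power
  map on angles.\<close>

lemma continuous_on_scaled_direction:
  fixes e :: "complex \<Rightarrow> complex"
  assumes k: "continuous_on S k" and e: "continuous_on {x \<in> S. k x \<noteq> 0} e" and b: "\<And>x. norm (e x) \<le> 1"
  shows "continuous_on S (\<lambda>x. of_real (k x) * e x)"
  unfolding continuous_on_eq_continuous_within
proof
  fix x assume x: "x \<in> S"
  show "continuous (at x within S) (\<lambda>x. of_real (k x) * e x)"
  proof (cases "k x = 0")
    case True
    have "(k \<longlongrightarrow> 0) (at x within S)"
      using k x True by (metis continuous_on_def)
    then have lim: "((\<lambda>y. \<bar>k y\<bar>) \<longlongrightarrow> 0) (at x within S)"
      by (rule tendsto_rabs_zero)
    have "((\<lambda>y. of_real (k y) * e y) \<longlongrightarrow> 0) (at x within S)"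
    proof (rule Lim_null_comparison[OF _ lim])
      have "norm (of_real (k y) * e y) \<le> \<bar>k y\<bar>" for y
        using mult_left_mono[OF b[of y], of "\<bar>k y\<bar>"] by (simp add: norm_mult)
      then show "\<forall>\<^sub>F y in at x within S. norm (of_real (k y) * e y) \<le> \<bar>k y\<bar>"
        by simp
    qed
    then show ?thesis
      by (simp add: continuous_within True)
  next
    case False
    have "openin (top_of_set S) (S \<inter> k -` (- {0}))"
      using k by (intro continuous_openin_preimage_gen) auto
    then obtain V where V: "open V" "S \<inter> k -` (- {0}) = S \<inter> V"
      by (auto simp: openin_open)
    then have sub: "{x \<in> S. k x \<noteq> 0} = S \<inter> V" by auto
    have "continuous_on (S \<inter> V) (\<lambda>x. of_real (k x) * e x)"
      using e k unfolding sub by (intro continuous_intros) (auto intro: continuous_on_subset)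
    moreover have "x \<in> V" using False x V(2) by auto
    moreover have "at x within (S \<inter> V) = at x within S"
      using \<open>x \<in> V\<close> V(1) by (intro at_within_nhd[of _ V]) auto
    ultimately show ?thesis
      using x by (metis IntI continuous_on_eq_continuous_within)
  qed
qed

lemma norm_disk_chart: "norm (disk_chart n p) = gauge_norm n (tilt n p)"
  using gauge_norm_nonneg[of n "tilt n p"] by (simp add: disk_chart_def norm_mult)

lemma continuous_on_disk_chart:
  assumes n: "n > 0"
  shows "continuous_on (rect n) (disk_chart n)"
  unfolding disk_chart_def
proof (rule continuous_on_scaled_direction)
  show "continuous_on (rect n) (\<lambda>p. gauge_norm n (tilt n p))"
    unfolding gauge_norm_def using continuous_on_tilt[of "rect n" n] half_width_pos(1)[of n]
    by (intro continuous_intros) auto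
  show "continuous_on {p \<in> rect n. gauge_norm n (tilt n p) \<noteq> 0}
     (\<lambda>p. cis (2 * pi * half_width n / real n) * bend n (tilt n p))"
    by (intro continuous_intros continuous_on_compose2[OF continuous_on_bend[OF n] continuous_on_tilt])
       (auto simp: gauge_norm_eq_0_iff)
qed (simp add: norm_mult)

lemma inj_on_disk_chart:
  assumes n: "n > 0"
  shows "inj_on (disk_chart n) (rect n)"
proof (rule inj_onI)
  fix p q assume eq: "disk_chart n p = disk_chart n q"
  let ?\<zeta> = "tilt n p" and ?\<xi> = "tilt n q"
  have g: "gauge_norm n ?\<zeta> = gauge_norm n ?\<xi>"
    using eq norm_disk_chart by metis
  have "?\<zeta> = ?\<xi>"
  proof (cases "?\<zeta> = 0")
    case True
    then show ?thesis using g gauge_norm_eq_0_iff by metis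
  next
    case False
    then have nz: "gauge_norm n ?\<zeta> \<noteq> 0" "?\<xi> \<noteq> 0" using g gauge_norm_eq_0_iff by metis+
    then have "bend n ?\<zeta> = bend n ?\<xi>"
      using eq g by (simp add: disk_chart_def)
    then obtain c where c: "c > 0" "?\<xi> = of_real c * ?\<zeta>"
      using bend_eq_imp_scale[OF n False nz(2)] by metis
    then have "gauge_norm n ?\<zeta> = c * gauge_norm n ?\<zeta>"
      using g gauge_norm_scale[of c n ?\<zeta>] by simp
    then have "c = 1" using nz(1) by simp
    then show ?thesis using c by simp
  qed
  then show "p = q" by (simp add: tilt_inject)
qed

lemma norm_disk_chart_rect:
  assumes "p \<in> rect n"
  shows "norm (disk_chart n p) \<le> 1" "norm (disk_chart n p) = 1 \<longleftrightarrow> p \<notin> box 0 (Complex (real n + 1) 2)"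
  using gauge_norm_tilt[OF assms] by (simp_all add: norm_disk_chart)

text \<open>Surjectivity by connectedness: the image is open by invariance of domain, and it is
  closed in the open disk because it is the part of a compact image that lies there.\<close>

lemma disk_chart_box:
  assumes n: "n > 0"
  shows "disk_chart n ` box 0 (Complex (real n + 1) 2) = ball 0 1"
proof -
  let ?U = "box 0 (Complex (real n + 1) 2)"
  have sub: "?U \<subseteq> rect n" by (rule box_subset_cbox)
  have op: "open (disk_chart n ` ?U)"
    using continuous_on_disk_chart[OF n] inj_on_disk_chart[OF n] sub
    by (intro invariance_of_domain) (auto intro: continuous_on_subset inj_on_subset)
  have cl: "closed (disk_chart n ` rect n)"
    by (intro compact_imp_closed compact_continuous_image continuous_on_disk_chart n compact_cbox)
  have lt: "norm (disk_chart n p) < 1 \<longleftrightarrow> p \<in> ?U" if "p \<in> rect n" for p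
    using norm_disk_chart_rect[OF that] by linarith
  have eq: "disk_chart n ` ?U = ball 0 1 \<inter> disk_chart n ` rect n"
  proof
    show "disk_chart n ` ?U \<subseteq> ball 0 1 \<inter> disk_chart n ` rect n"
      using lt sub by auto
    show "ball 0 1 \<inter> disk_chart n ` rect n \<subseteq> disk_chart n ` ?U"
      using lt by auto
  qed
  have "openin (top_of_set (ball 0 1)) (disk_chart n ` ?U)"
    using op eq by (auto intro: openin_open_eq[THEN iffD2])
  moreover have "closedin (top_of_set (ball 0 1)) (disk_chart n ` ?U)"
    unfolding eq using cl by (rule closedin_closed_Int)
  moreover have "?U \<noteq> {}"
  proof -
    have "Complex (1/2) 1 \<in> ?U" by (simp add: in_box_complex_iff)
    then show ?thesis by blast
  qed
  ultimately show ?thesis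
    using connected_ball[of "0::complex" 1] unfolding connected_clopen by blast
qed

lemma disk_chart_rect:
  assumes n: "n > 0"
  shows "disk_chart n ` rect n = cball 0 1"
proof
  show "disk_chart n ` rect n \<subseteq> cball 0 1"
    using norm_disk_chart_rect(1) by auto
  have "closed (disk_chart n ` rect n)"
    by (intro compact_imp_closed compact_continuous_image continuous_on_disk_chart n compact_cbox)
  moreover have "ball 0 1 \<subseteq> disk_chart n ` rect n"
    using disk_chart_box[OF n] box_subset_cbox by blast
  ultimately have "closure (ball 0 1) \<subseteq> disk_chart n ` rect n"
    by (rule closure_minimal[rotated])
  then show "cball 0 1 \<subseteq> disk_chart n ` rect n" by simp
qed

text \<open>In the strip the tilt multiplies the centred coordinate \<open>u\<close> by the depth,
  so \<open>Im / Re\<close> recovers \<open>u\<close> exactly, and the gauge norm is the depth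
  itself.\<close>

lemma disk_chart_strip:
  assumes n: "n > 0" and x: "5/8 \<le> x" "x \<le> real n + 3/8" and y: "0 \<le> y" "y \<le> 3/2"
  shows "disk_chart n (Complex x y) = of_real (1 - y / 3) * cis (2 * pi * x / real n)"
proof -
  define a where "a = 1 - y / 3"
  define u where "u = x - half_width n"
  have a: "1/2 \<le> a" "a \<le> 1" "depth y = a"
    using y by (auto simp: a_def depth_def min_def)
  have u: "\<bar>u\<bar> \<le> slope n"
    using x unfolding abs_le_iff by (simp add: u_def half_width_def slope_def field_simps)
  have "1 - 4/5 * (half_width n - \<bar>u\<bar>) \<le> 1/2"
    using u by (simp add: half_width_def slope_def field_simps)
  then have "tilt_factor n a u = a"
    using a(1) by (simp only: tilt_factor_def max_absorb1)
  then have t: "tilt n (Complex x y) = Complex a (u * a)"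
    using a(3) by (simp add: tilt_def u_def)
  have "\<bar>u\<bar> \<le> half_width n" using u slope_less[of n] by linarith
  then have "\<bar>u * a\<bar> / half_width n \<le> a"
    using a half_width_pos(1)[of n] by (simp add: abs_mult field_simps)
  then have g: "gauge_norm n (Complex a (u * a)) = a"
    using a by (simp add: gauge_norm_def max_def)
  have "\<bar>u * a\<bar> \<le> slope n * a"
    using a u by (simp add: abs_mult)
  then have "bend n (Complex a (u * a)) = cis (2 * pi / real n * u)"
    using a by (simp add: bend_def)
  moreover have "2 * pi * half_width n / real n + 2 * pi / real n * u = 2 * pi * x / real n"
    using n by (simp add: u_def field_simps)
  ultimately show ?thesis
    unfolding disk_chart_def t g a_def[symmetric] by (simp add: cis_mult)
qed


section \<open>The power map and the holes\<close>

text \<open>Unlike \<open>z ^ n\<close> it keeps the radius, so that all holes are mapped to one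
  region with the same radial extent for every \<open>n\<close>.\<close>

definition angle_power :: "nat \<Rightarrow> complex \<Rightarrow> complex" where
  "angle_power n z = of_real (norm z) * sgn z ^ n"

lemma norm_angle_power [simp]: "norm (angle_power n z) = norm z"
  by (cases "z = 0") (simp_all add: angle_power_def norm_mult norm_power norm_sgn)

lemma continuous_on_angle_power: "continuous_on A (angle_power n)"
  unfolding angle_power_def
proof (rule continuous_on_scaled_direction)
  show "continuous_on A norm"
    by (intro continuous_intros)
  show "continuous_on {x \<in> A. norm x \<noteq> 0} (\<lambda>x. sgn x ^ n)"
    by (intro continuous_intros) auto
qed (simp add: norm_power norm_sgn power_le_one)

lemma angle_power_1 [simp]: "angle_power 1 z = z"
  by (simp add: angle_power_def sgn_eq)

lemma angle_power_polar:
  "r > 0 \<Longrightarrow> angle_power n (of_real r * cis t) = of_real r * cis (real n * t)"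
  by (simp add: angle_power_def norm_mult sgn_mult sgn_of_real Complex.DeMoivre)

lemma angle_power_rotate: "angle_power n (cis t * z) = cis (real n * t) * angle_power n z"
  by (simp add: angle_power_def norm_mult sgn_mult power_mult_distrib Complex.DeMoivre)

lemma angle_power_eq_iff:
  assumes n: "n > 0"
  shows "angle_power n z = angle_power n w \<longleftrightarrow> (\<exists>j<n. w = cis (2 * pi * real j / real n) * z)"
proof
  assume eq: "angle_power n z = angle_power n w"
  then have nrm: "norm z = norm w" by (metis norm_angle_power)
  show "\<exists>j<n. w = cis (2 * pi * real j / real n) * z"
  proof (cases "z = 0")
    case True
    then show ?thesis using nrm n by auto
  next
    case False
    then have nz: "z \<noteq> 0" "w \<noteq> 0" using nrm by auto
    then have "(w / z) ^ n = 1"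
      using eq nrm by (simp add: angle_power_def sgn_eq power_divide)
    then have "w / z \<in> {x. x ^ n = 1}" by simp
    then obtain j where "j < n" "w / z = cis (2 * pi * real j / real n)"
      using bij_betw_imp_surj_on[OF Complex.bij_betw_roots_unity[OF n]] by (metis (no_types, lifting) imageE lessThan_iff)
    then show ?thesis
      using nz by (intro exI[of _ j]) (simp add: field_simps)
  qed
next
  assume "\<exists>j<n. w = cis (2 * pi * real j / real n) * z"
  then obtain j where "w = cis (2 * pi * real j / real n) * z" by blast
  moreover have "cis (real n * (2 * pi * real j / real n)) = 1"
    using n by (simp add: cis_multiple_2pi)
  ultimately show "angle_power n z = angle_power n w"
    by (simp only: angle_power_rotate) simp
qed

text \<open>Since \<open>1 - 3/8 = 5/8\<close>, the columns of half-width 3/8 lie in the strip. They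
  are wide and high enough to contain the hole, with half-width 1/4 and top at 5/4, and the
  neighbourhood of the curve below it.\<close>

lemma disk_chart_column:
  assumes "n > 0" "k \<in> {1..n}" "\<bar>\<sigma>\<bar> \<le> 3/8" "0 \<le> y" "y \<le> 3/2"
  shows "disk_chart n (Complex (real k + \<sigma>) y) = of_real (1 - y / 3) * cis (2 * pi * (real k + \<sigma>) / real n)"
    and "Complex (real k + \<sigma>) y \<in> rect n"
proof -
  have "1 \<le> real k" "real k \<le> real n"
    using assms(2) by simp_all
  moreover have "- \<sigma> \<le> 3/8" "\<sigma> \<le> 3/8"
    using assms(3) by (simp_all only: abs_le_iff)
  ultimately have x: "5/8 \<le> real k + \<sigma>" "real k + \<sigma> \<le> real n + 3/8" by linarith+
  then show "disk_chart n (Complex (real k + \<sigma>) y) = of_real (1 - y / 3) * cis (2 * pi * (real k + \<sigma>) / real n)"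
    using assms by (intro disk_chart_strip) auto
  show "Complex (real k + \<sigma>) y \<in> rect n"
    using x assms by (auto simp: in_cbox_complex_iff)
qed

text \<open>Multiplying the angle \<open>2 pi (k + \<sigma>) / n\<close> by \<open>n\<close> leaves
  \<open>2 pi \<sigma>\<close> modulo \<open>2 pi\<close>. The fibre is an orbit of the
  \<open>n\<close>-th roots of unity, and these step through the columns.\<close>

lemma angle_power_column_iff:
  assumes n: "n > 0" and p: "p \<in> rect n" and s: "\<bar>\<sigma>\<bar> \<le> 3/8" and y: "0 \<le> y" "y \<le> 3/2"
  shows "angle_power n (disk_chart n p) = of_real (1 - y / 3) * cis (2 * pi * \<sigma>) \<longleftrightarrow>
    (\<exists>k\<in>{1..n}. p = Complex (real k + \<sigma>) y)"
proof -
  have r: "1 - y / 3 > 0" using y by simp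
  have *: "angle_power n (disk_chart n (Complex (real k + \<sigma>) y)) = of_real (1 - y / 3) * cis (2 * pi * \<sigma>)"
    if k: "k \<in> {1..n}" for k
  proof -
    have "real n * (2 * pi * (real k + \<sigma>) / real n) = 2 * pi * real k + 2 * pi * \<sigma>"
      using n by (simp add: field_simps)
    moreover have "cis (2 * pi * real k) = 1" by (rule cis_multiple_2pi) auto
    ultimately show ?thesis
      unfolding disk_chart_column(1)[OF n k s y] angle_power_polar[OF r] by (simp flip: cis_mult)
  qed
  show ?thesis
  proof
    assume "angle_power n (disk_chart n p) = of_real (1 - y / 3) * cis (2 * pi * \<sigma>)"
    then have "angle_power n (disk_chart n (Complex (real 1 + \<sigma>) y)) = angle_power n (disk_chart n p)"
      using *[of 1] n by simp
    then obtain j where j: "j < n" "disk_chart n p = cis (2 * pi * real j / real n) * disk_chart n (Complex (real 1 + \<sigma>) y)"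
      unfolding angle_power_eq_iff[OF n] by blast
    have 1: "1 \<in> {1..n}" and Sj: "Suc j \<in> {1..n}" using n j by auto
    have "disk_chart n p = of_real (1 - y / 3) * cis (2 * pi * real j / real n + 2 * pi * (real 1 + \<sigma>) / real n)"
      unfolding j(2) disk_chart_column(1)[OF n 1 s y] by (simp add: cis_mult)
    also have "2 * pi * real j / real n + 2 * pi * (real 1 + \<sigma>) / real n = 2 * pi * (real (Suc j) + \<sigma>) / real n"
      by (simp add: field_simps add_divide_distrib[symmetric])
    also have "of_real (1 - y / 3) * cis (2 * pi * (real (Suc j) + \<sigma>) / real n) = disk_chart n (Complex (real (Suc j) + \<sigma>) y)"
      by (rule disk_chart_column(1)[OF n Sj s y, symmetric])
    finally have "p = Complex (real (Suc j) + \<sigma>) y"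
      using inj_onD[OF inj_on_disk_chart[OF n]] p disk_chart_column(2)[OF n Sj s y] by blast
    then show "\<exists>k\<in>{1..n}. p = Complex (real k + \<sigma>) y" using Sj by blast
  qed (use * in blast)
qed

text \<open>The common image of all holes under the power map. Its description does not involve
  \<open>n\<close>, which makes the holes of regions with different numbers of holes
  comparable.\<close>

definition open_hole :: "complex set" where
  "open_hole = (\<lambda>(\<sigma>, y). of_real (1 - y / 3) * cis (2 * pi * \<sigma>)) ` ({-1/4<..<1/4} \<times> {3/4<..<5/4})"

definition closed_hole :: "complex set" where
  "closed_hole = (\<lambda>(\<sigma>, y). of_real (1 - y / 3) * cis (2 * pi * \<sigma>)) ` ({-1/4..1/4} \<times> {3/4..5/4})"

lemma in_hole_iff:
  assumes n: "n > 0" and p: "p \<in> rect n"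
  shows "(\<exists>i\<in>{1..n}. p \<in> box (Complex (real i - 1/4) (3/4)) (Complex (real i + 1/4) (5/4))) \<longleftrightarrow>
      angle_power n (disk_chart n p) \<in> open_hole" (is ?open)
    and "(\<exists>i\<in>{1..n}. p \<in> cbox (Complex (real i - 1/4) (3/4)) (Complex (real i + 1/4) (5/4))) \<longleftrightarrow>
      angle_power n (disk_chart n p) \<in> closed_hole" (is ?closed)
proof -
  show ?open
  proof
    assume "\<exists>i\<in>{1..n}. p \<in> box (Complex (real i - 1/4) (3/4)) (Complex (real i + 1/4) (5/4))"
    then obtain i where i0: "i \<in> {1..n}" and b: "p \<in> box (Complex (real i - 1/4) (3/4)) (Complex (real i + 1/4) (5/4))"
      by blast
    have i: "i \<in> {1..n}" "-1/4 < Re p - real i" "Re p - real i < 1/4" "3/4 < Im p" "Im p < 5/4"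
      using i0 b unfolding in_box_complex_iff complex.sel by auto
    have "\<bar>Re p - real i\<bar> \<le> 3/8"
      using i unfolding abs_le_iff by simp
    then have "angle_power n (disk_chart n p) = of_real (1 - Im p / 3) * cis (2 * pi * (Re p - real i))"
      using i by (subst angle_power_column_iff[OF n p]) (auto intro!: bexI[of _ i])
    then show "angle_power n (disk_chart n p) \<in> open_hole"
      unfolding open_hole_def using i by (intro image_eqI[of _ _ "(Re p - real i, Im p)"]) auto
  next
    assume "angle_power n (disk_chart n p) \<in> open_hole"
    then obtain \<sigma> y where sy: "-1/4 < \<sigma>" "\<sigma> < 1/4" "3/4 < y" "y < 5/4"
      "angle_power n (disk_chart n p) = of_real (1 - y / 3) * cis (2 * pi * \<sigma>)"
      unfolding open_hole_def by auto
    moreover have "\<bar>\<sigma>\<bar> \<le> 3/8" using sy unfolding abs_le_iff by simp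
    ultimately obtain k where "k \<in> {1..n}" "p = Complex (real k + \<sigma>) y"
      using angle_power_column_iff[OF n p, of \<sigma> y] by auto
    then show "\<exists>i\<in>{1..n}. p \<in> box (Complex (real i - 1/4) (3/4)) (Complex (real i + 1/4) (5/4))"
      using sy by (intro bexI[of _ k]) (auto simp: in_box_complex_iff)
  qed
  show ?closed
  proof
    assume "\<exists>i\<in>{1..n}. p \<in> cbox (Complex (real i - 1/4) (3/4)) (Complex (real i + 1/4) (5/4))"
    then obtain i where i0: "i \<in> {1..n}" and b: "p \<in> cbox (Complex (real i - 1/4) (3/4)) (Complex (real i + 1/4) (5/4))"
      by blast
    have i: "i \<in> {1..n}" "-1/4 \<le> Re p - real i" "Re p - real i \<le> 1/4" "3/4 \<le> Im p" "Im p \<le> 5/4"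
      using i0 b unfolding in_cbox_complex_iff complex.sel by auto
    have "\<bar>Re p - real i\<bar> \<le> 3/8"
      using i unfolding abs_le_iff by simp
    then have "angle_power n (disk_chart n p) = of_real (1 - Im p / 3) * cis (2 * pi * (Re p - real i))"
      using i by (subst angle_power_column_iff[OF n p]) (auto intro!: bexI[of _ i])
    then show "angle_power n (disk_chart n p) \<in> closed_hole"
      unfolding closed_hole_def using i by (intro image_eqI[of _ _ "(Re p - real i, Im p)"]) auto
  next
    assume "angle_power n (disk_chart n p) \<in> closed_hole"
    then obtain \<sigma> y where sy: "-1/4 \<le> \<sigma>" "\<sigma> \<le> 1/4" "3/4 \<le> y" "y \<le> 5/4"
      "angle_power n (disk_chart n p) = of_real (1 - y / 3) * cis (2 * pi * \<sigma>)"
      unfolding closed_hole_def by auto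
    moreover have "\<bar>\<sigma>\<bar> \<le> 3/8" using sy unfolding abs_le_iff by simp
    ultimately obtain k where "k \<in> {1..n}" "p = Complex (real k + \<sigma>) y"
      using angle_power_column_iff[OF n p, of \<sigma> y] by auto
    then show "\<exists>i\<in>{1..n}. p \<in> cbox (Complex (real i - 1/4) (3/4)) (Complex (real i + 1/4) (5/4))"
      using sy by (intro bexI[of _ k]) (auto simp: in_cbox_complex_iff)
  qed
qed

lemma in_holed_disk_iff_chart:
  assumes n: "n > 0"
  shows "p \<in> holed_disk n \<longleftrightarrow> p \<in> rect n \<and> angle_power n (disk_chart n p) \<notin> open_hole"
  using in_hole_iff(1)[OF n, of p] by (auto simp: holed_disk_def)

lemma in_frontier_holed_disk_iff_chart:
  assumes n: "n > 0" and p: "p \<in> holed_disk n"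
  shows "p \<in> frontier (holed_disk n) \<longleftrightarrow>
    norm (disk_chart n p) = 1 \<or> angle_power n (disk_chart n p) \<in> closed_hole"
proof -
  have "p \<in> rect n" using p by (simp add: holed_disk_def)
  then show ?thesis
    using in_hole_iff(2)[OF n] norm_disk_chart_rect(2) p by (simp add: in_frontier_holed_disk_iff)
qed

definition disk_param :: "nat \<Rightarrow> complex \<Rightarrow> complex" where
  "disk_param n = inv_into (rect n) (disk_chart n)"

lemma disk_chart_param:
  assumes "n > 0" "z \<in> cball 0 1"
  shows "disk_chart n (disk_param n z) = z" "disk_param n z \<in> rect n"
  using assms disk_chart_rect[OF assms(1)] by (auto simp: disk_param_def f_inv_into_f inv_into_into)

lemma disk_param_chart:
  assumes "n > 0" "p \<in> rect n"
  shows "disk_param n (disk_chart n p) = p" "disk_chart n p \<in> cball 0 1"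
  using assms inj_on_disk_chart[OF assms(1)] norm_disk_chart_rect(1)[OF assms(2)] by (auto simp: disk_param_def)

lemma continuous_on_disk_param:
  assumes n: "n > 0"
  shows "continuous_on (cball 0 1) (disk_param n)"
proof -
  have "continuous_on (disk_chart n ` rect n) (disk_param n)"
    unfolding disk_param_def
    by (intro continuous_on_inv continuous_on_disk_chart n compact_cbox) (simp add: inj_on_disk_chart[OF n])
  then show ?thesis by (simp add: disk_chart_rect[OF n])
qed

lemma inj_on_disk_param:
  assumes "n > 0"
  shows "inj_on (disk_param n) (cball 0 1)"
  using disk_chart_param(1)[OF assms] by (rule inj_on_inverseI)

section \<open>Maps between holed rectangles given in chart coordinates\<close>

definition conjugate_map :: "nat \<Rightarrow> nat \<Rightarrow> (complex \<Rightarrow> complex) \<Rightarrow> complex \<Rightarrow> complex" where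
  "conjugate_map n m F p = disk_param m (F (disk_chart n p))"

text \<open>In the chart, the region and its frontier are described by the norm and the power map
  alone, so a map that respects these two quantities respects the border.\<close>

lemma bordered_map_conjugate_map:
  assumes n: "n > 0" and m: "m > 0" and F: "continuous_on (cball 0 1) F"
    and nrm: "\<And>z. norm (F z) = norm z" and pow: "\<And>z. angle_power m (F z) = angle_power n z"
  shows "bordered_map (holed_disk n) (holed_disk m) (conjugate_map n m F)"
  unfolding bordered_map_def
proof (intro conjI ballI frontier_holed_disk_nonempty)
  have sub: "holed_disk n \<subseteq> rect n" by (auto simp: holed_disk_def)
  have chart: "disk_chart m (conjugate_map n m F p) = F (disk_chart n p)" "conjugate_map n m F p \<in> rect m"
    if "p \<in> rect n" for p
    using disk_chart_param[OF m, of "F (disk_chart n p)"] disk_param_chart(2)[OF n that] nrm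
    by (auto simp: conjugate_map_def)
  show "continuous_on (holed_disk n) (conjugate_map n m F)"
    unfolding conjugate_map_def
  proof (rule continuous_on_compose2[OF continuous_on_disk_param[OF m]])
    show "continuous_on (holed_disk n) (\<lambda>p. F (disk_chart n p))"
      by (rule continuous_on_compose2[OF F continuous_on_subset[OF continuous_on_disk_chart[OF n] sub]])
         (use disk_param_chart(2)[OF n] sub in blast)
    show "(\<lambda>p. F (disk_chart n p)) ` holed_disk n \<subseteq> cball 0 1"
      using disk_param_chart(2)[OF n] sub nrm by auto
  qed
  have in_hd: "conjugate_map n m F p \<in> holed_disk m" if "p \<in> holed_disk n" for p
  proof -
    have p: "p \<in> rect n" using sub that by blast
    then show ?thesis
      using that chart[OF p] pow by (simp add: in_holed_disk_iff_chart n m)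
  qed
  then show "conjugate_map n m F \<in> holed_disk n \<rightarrow> holed_disk m" by blast
  fix p assume p: "p \<in> holed_disk n"
  then have "p \<in> rect n" using sub by blast
  then show "conjugate_map n m F p \<in> frontier (holed_disk m) \<longleftrightarrow> p \<in> frontier (holed_disk n)"
    using in_frontier_holed_disk_iff_chart[OF m in_hd[OF p]] in_frontier_holed_disk_iff_chart[OF n p] chart nrm pow
    by simp
qed


section \<open>The rotation\<close>

definition rotation :: "nat \<Rightarrow> nat \<Rightarrow> complex \<Rightarrow> complex" where
  "rotation n j = conjugate_map n n (\<lambda>z. cis (2 * pi * real j / real n) * z)"

text \<open>The \<open>n\<close> holes are identified to a single one, so the target is
  \<open>holed_disk 1\<close>, whose double is the surface of genus 1.\<close>

definition quotient :: "nat \<Rightarrow> complex \<Rightarrow> complex" where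
  "quotient n = conjugate_map n 1 (angle_power n)"

lemma cis_root_power: "n > 0 \<Longrightarrow> cis (real n * (2 * pi * real j / real n)) = 1"
  by (simp add: cis_multiple_2pi)

lemma bordered_map_rotation:
  assumes n: "n > 0"
  shows "bordered_map (holed_disk n) (holed_disk n) (rotation n j)"
  unfolding rotation_def
  by (rule bordered_map_conjugate_map[OF n n])
     (auto intro!: continuous_intros simp: norm_mult simp del: times_divide_eq_right
       simp: angle_power_rotate cis_root_power[OF n])

lemma bordered_map_quotient:
  assumes n: "n > 0"
  shows "bordered_map (holed_disk n) (holed_disk 1) (quotient n)"
  unfolding quotient_def
  by (rule bordered_map_conjugate_map[OF n]) (auto intro!: continuous_on_angle_power simp del: One_nat_def)

lemma rotation_chart:
  assumes n: "n > 0" and p: "p \<in> rect n"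
  shows "disk_chart n (rotation n j p) = cis (2 * pi * real j / real n) * disk_chart n p"
    and "rotation n j p \<in> rect n"
  using disk_chart_param[OF n, of "cis (2 * pi * real j / real n) * disk_chart n p"] disk_param_chart(2)[OF n p]
  by (auto simp: rotation_def conjugate_map_def norm_mult)

lemma rect_eqI:
  assumes "n > 0" "p \<in> rect n" "q \<in> rect n" "disk_chart n p = disk_chart n q"
  shows "p = q"
  using inj_onD[OF inj_on_disk_chart] assms by blast

lemma rotation_add:
  assumes n: "n > 0" and p: "p \<in> rect n"
  shows "rotation n i (rotation n j p) = rotation n (i + j) p"
proof (rule rect_eqI[OF n])
  show "disk_chart n (rotation n i (rotation n j p)) = disk_chart n (rotation n (i + j) p)"
    using rotation_chart[OF n] p by (simp add: cis_mult add_divide_distrib[symmetric] ring_distribs flip: mult.assoc)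
qed (use rotation_chart(2)[OF n] p in auto)

lemma rotation_eq_self:
  assumes n: "n > 0" and p: "p \<in> rect n"
  shows "rotation n 0 p = p" "rotation n n p = p"
proof -
  show "rotation n 0 p = p"
    by (rule rect_eqI[OF n rotation_chart(2)[OF n p] p]) (simp add: rotation_chart[OF n p])
  show "rotation n n p = p"
    by (rule rect_eqI[OF n rotation_chart(2)[OF n p] p]) (use n in \<open>simp add: rotation_chart[OF n p]\<close>)
qed

lemma cis_root_neq_1:
  assumes "0 < j" "j < n"
  shows "cis (2 * pi * real j / real n) \<noteq> 1"
proof
  assume "cis (2 * pi * real j / real n) = 1"
  moreover have "inj_on (\<lambda>k. cis (2 * pi * real k / real n)) {..<n}"
    using Complex.bij_betw_roots_unity[of n] assms by (simp add: bij_betw_def)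
  ultimately show False
    using inj_onD[of _ "{..<n}" j 0] assms by fastforce
qed

lemma rotation_fixed_iff:
  assumes n: "n > 0" and p: "p \<in> rect n" and j: "0 < j" "j < n"
  shows "rotation n j p = p \<longleftrightarrow> disk_chart n p = 0"
proof -
  have "rotation n j p = p \<longleftrightarrow> disk_chart n (rotation n j p) = disk_chart n p"
    using rect_eqI[OF n rotation_chart(2)[OF n p] p] by metis
  also have "\<dots> \<longleftrightarrow> disk_chart n p = 0"
    using cis_root_neq_1[OF j] by (simp add: rotation_chart[OF n p])
  finally show ?thesis .
qed

text \<open>Adding \<open>2 pi j / n\<close> to the angle \<open>2 pi x / n\<close> adds
  \<open>j\<close> to \<open>x\<close>; the second alternative for \<open>k'\<close> is the wrap
  from the last columns to the first ones.\<close>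

lemma rotation_column:
  assumes n: "n > 0" and k: "k \<in> {1..n}" "k' \<in> {1..n}" "k' = k + j \<or> k' + n = k + j"
    and s: "\<bar>\<sigma>\<bar> \<le> 3/8" and y: "0 \<le> y" "y \<le> 3/2"
  shows "rotation n j (Complex (real k + \<sigma>) y) = Complex (real k' + \<sigma>) y"
proof (rule rect_eqI[OF n])
  have "cis (2 * pi * (real (k + j) + \<sigma>) / real n) = cis (2 * pi * (real k' + \<sigma>) / real n)"
    using k(3)
  proof
    assume "k' + n = k + j"
    then have "real (k + j) = real k' + real n" by (metis of_nat_add)
    then have "2 * pi * (real (k + j) + \<sigma>) / real n = 2 * pi * (real k' + \<sigma>) / real n + 2 * pi"
      using n by (simp only:) (simp add: field_simps)
    then show ?thesis by (simp flip: cis_mult)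
  qed simp
  moreover have "2 * pi * (real (k + j) + \<sigma>) / real n = 2 * pi * real j / real n + 2 * pi * (real k + \<sigma>) / real n"
    by (simp add: add_divide_distrib[symmetric] ring_distribs)
  ultimately show "disk_chart n (rotation n j (Complex (real k + \<sigma>) y)) = disk_chart n (Complex (real k' + \<sigma>) y)"
    using disk_chart_column(1)[OF n k(1) s y] disk_chart_column(1)[OF n k(2) s y]
      rotation_chart(1)[OF n disk_chart_column(2)[OF n k(1) s y], of j]
    by (simp add: mult.left_commute flip: cis_mult)
  show "rotation n j (Complex (real k + \<sigma>) y) \<in> rect n"
    by (rule rotation_chart(2)[OF n disk_chart_column(2)[OF n k(1) s y]])
  show "Complex (real k' + \<sigma>) y \<in> rect n"
    by (rule disk_chart_column(2)[OF n k(2) s y])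
qed

lemma quotient_eq_iff:
  assumes n: "n > 0" and p: "p \<in> rect n" and q: "q \<in> rect n"
  shows "quotient n p = quotient n q \<longleftrightarrow> (\<exists>j<n. q = rotation n j p)"
proof -
  have "quotient n p = quotient n q \<longleftrightarrow> angle_power n (disk_chart n p) = angle_power n (disk_chart n q)"
    using inj_onD[OF inj_on_disk_param[of 1]] disk_param_chart(2)[OF n p] disk_param_chart(2)[OF n q]
    unfolding quotient_def conjugate_map_def by fastforce
  also have "\<dots> \<longleftrightarrow> (\<exists>j<n. disk_chart n q = disk_chart n (rotation n j p))"
    by (simp add: angle_power_eq_iff[OF n] rotation_chart[OF n p])
  also have "\<dots> \<longleftrightarrow> (\<exists>j<n. q = rotation n j p)"
    using rect_eqI[OF n q rotation_chart(2)[OF n p]] by metis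
  finally show ?thesis .
qed

lemma quotient_image:
  assumes n: "n > 0"
  shows "quotient n ` holed_disk n = holed_disk 1"
proof
  show "quotient n ` holed_disk n \<subseteq> holed_disk 1"
    using bordered_map_quotient[OF n] by (auto simp: bordered_map_def)
  show "holed_disk 1 \<subseteq> quotient n ` holed_disk n"
  proof
    fix q assume q: "q \<in> holed_disk 1"
    have one: "(0::nat) < 1" by simp
    have q1: "q \<in> rect 1" "disk_chart 1 q \<notin> open_hole"
      using q in_holed_disk_iff_chart[OF one, of q] angle_power_1 by auto
    let ?w = "disk_chart 1 q"
    obtain z where z: "angle_power n z = ?w"
    proof (cases "?w = 0")
      case True
      then show ?thesis using that[of 0] by (simp add: angle_power_def)
    next
      case False
      have "angle_power n (of_real (norm ?w) * cis (Arg ?w / real n)) = of_real (norm ?w) * cis (Arg ?w)"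
        using angle_power_polar[of "norm ?w" n "Arg ?w / real n"] False n by simp
      then show ?thesis
        using that False by (simp add: cis_Arg sgn_eq)
    qed
    have zb: "z \<in> cball 0 1"
      using disk_param_chart(2)[OF one q1(1)] z by (metis mem_cball_0 norm_angle_power)
    let ?p = "disk_param n z"
    have p: "?p \<in> rect n" "disk_chart n ?p = z" using disk_chart_param[OF n zb] by auto
    have "?p \<in> holed_disk n"
      using p z q1 by (simp add: in_holed_disk_iff_chart[OF n])
    moreover have "quotient n ?p = q"
      using p z disk_param_chart(1)[OF one q1(1)] by (simp add: quotient_def conjugate_map_def)
    ultimately show "q \<in> quotient n ` holed_disk n" by blast
  qed
qed


section \<open>The rotation of the surface\<close>

lemma holed_disk_subset_rect: "holed_disk n \<subseteq> rect n"
  by (auto simp: holed_disk_def)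

lemma surf_fst_rect: "x \<in> surf n \<Longrightarrow> fst x \<in> rect n"
  using holed_disk_subset_rect[of n] unfolding surf_def double_def by force

lemma continuous_on_rotation:
  assumes n: "n > 0"
  shows "continuous_on (rect n) (rotation n j)"
  unfolding rotation_def conjugate_map_def
proof (rule continuous_on_compose2[OF continuous_on_disk_param[OF n]])
  show "continuous_on (rect n) (\<lambda>p. cis (2 * pi * real j / real n) * disk_chart n p)"
    by (intro continuous_intros continuous_on_disk_chart n)
  show "(\<lambda>p. cis (2 * pi * real j / real n) * disk_chart n p) ` rect n \<subseteq> cball 0 1"
    using norm_disk_chart_rect(1) by (auto simp: norm_mult)
qed

lemma inj_on_rotation:
  assumes n: "n > 0"
  shows "inj_on (rotation n j) (rect n)"
proof (rule inj_onI)
  fix p q assume pq: "p \<in> rect n" "q \<in> rect n" "rotation n j p = rotation n j q"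
  then have "cis (2 * pi * real j / real n) * disk_chart n p = cis (2 * pi * real j / real n) * disk_chart n q"
    using rotation_chart(1)[OF n] by metis
  then have "disk_chart n p = disk_chart n q" by simp
  then show "p = q" using rect_eqI[OF n pq(1,2)] by blast
qed

text \<open>The planar rotation is an injection of the whole open rectangle, holes included, and
  that set is convex. Hence its local degree is constant there, and it can be evaluated below the
  first hole, where the rotation is the translation by \<open>j\<close>.\<close>

lemma rotation_local_degree:
  assumes n: "n > 0" and j: "j < n" and p: "p \<in> interior (holed_disk n)"
  shows "locally_injective_at (rotation n j) p" "local_degree (rotation n j) p 1"
proof -
  let ?U = "box 0 (Complex (real n + 1) 2)"
  have sub: "?U \<subseteq> rect n" by (rule box_subset_cbox)
  have cont: "continuous_on ?U (rotation n j)" and inj: "inj_on (rotation n j) ?U"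
    using continuous_on_rotation[OF n] inj_on_rotation[OF n] sub
    by (auto intro: continuous_on_subset inj_on_subset)
  have pU: "p \<in> ?U" using p by (simp add: in_interior_holed_disk_iff)
  show "locally_injective_at (rotation n j) p"
    by (rule locally_injective_atI[OF open_box pU cont inj])
  let ?q = "Complex 1 (1/2)"
  let ?V = "box (Complex (5/8) 0) (Complex (11/8) (3/2))"
  have q: "?q \<in> ?U" "?q \<in> ?V"
    using n by (auto simp: in_box_complex_iff)
  have eq: "rotation n j w = w + of_nat j" if w: "w \<in> ?V" for w
  proof -
    have "\<bar>Re w - 1\<bar> \<le> 3/8" "0 \<le> Im w" "Im w \<le> 3/2"
      using w unfolding in_box_complex_iff complex.sel abs_le_iff by auto
    then have "rotation n j (Complex (real 1 + (Re w - 1)) (Im w)) = Complex (real (Suc j) + (Re w - 1)) (Im w)"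
      using n j by (intro rotation_column) auto
    then show ?thesis by (simp add: complex_eq_iff)
  qed
  have "local_degree (rotation n j) ?q 1 \<longleftrightarrow> local_degree (\<lambda>w. w + of_nat j) ?q 1"
    by (rule local_degree_cong[OF open_box q(2) eq])
  then have "local_degree (rotation n j) ?q 1"
    using local_degree_translation by blast
  then show "local_degree (rotation n j) p 1"
    using local_degree_const[OF open_box convex_box(2) cont inj q(1) pU] by blast
qed

definition surf_rotation :: "nat \<Rightarrow> nat \<Rightarrow> complex \<times> real \<Rightarrow> complex \<times> real" where
  "surf_rotation n j = (\<lambda>x\<in>surf n. double_map (holed_disk n) (rotation n j) x)"

lemma surf_rotation_in_surf:
  "n > 0 \<Longrightarrow> x \<in> surf n \<Longrightarrow> surf_rotation n j x \<in> surf n"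
  using double_map_in_double[OF bordered_map_rotation] by (simp add: surf_rotation_def surf_def)

lemma surf_rotation_add:
  assumes n: "n > 0" and x: "x \<in> surf n"
  shows "surf_rotation n i (surf_rotation n j x) = surf_rotation n (i + j) x"
proof -
  have "surf_rotation n i (surf_rotation n j x) = double_map (holed_disk n) (rotation n i \<circ> rotation n j) x"
    using double_map_compose[OF bordered_map_rotation[OF n]] surf_rotation_in_surf[OF n x, of j] x
    by (simp add: surf_rotation_def surf_def)
  also have "\<dots> = surf_rotation n (i + j) x"
    using rotation_add[OF n surf_fst_rect[OF x]] x by (simp add: surf_rotation_def double_map_def)
  finally show ?thesis .
qed

lemma surf_rotation_trivial:
  assumes n: "n > 0" and x: "x \<in> surf n"
  shows "surf_rotation n 0 x = x" "surf_rotation n n x = x"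
  using double_map_id[of x "holed_disk n"] rotation_eq_self[OF n surf_fst_rect[OF x]] x
  by (simp_all add: surf_rotation_def surf_def)

lemma homeomorphic_maps_double_rotation:
  assumes n: "n > 0" and ij: "i + j = n"
  shows "homeomorphic_maps (Surf n) (Surf n) (double_map (holed_disk n) (rotation n i)) (double_map (holed_disk n) (rotation n j))"
proof -
  have eq: "double_map (holed_disk n) (rotation n j) x = surf_rotation n j x" if "x \<in> surf n" for x j
    using that by (simp add: surf_rotation_def)
  have inv: "surf_rotation n i (surf_rotation n j x) = x" "surf_rotation n j (surf_rotation n i x) = x" if "x \<in> surf n" for x
    using surf_rotation_add[OF n that] surf_rotation_trivial(2)[OF n that] ij by (simp_all add: add.commute)
  show ?thesis
    unfolding homeomorphic_maps_def topspace_euclidean_subtopology continuous_map_in_subtopology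
      continuous_map_iff_continuous
    using continuous_on_double_map[OF bordered_map_rotation[OF n]] double_map_in_double[OF bordered_map_rotation[OF n]]
      inv surf_rotation_in_surf[OF n] by (simp add: eq flip: surf_def)
qed

lemma surf_rotation_in_homeo_plus:
  assumes n: "n > 1"
  shows "surf_rotation n 1 \<in> homeo_plus n"
proof -
  let ?d = "\<lambda>j. double_map (holed_disk n) (rotation n j)"
  have n0: "n > 0" using n by simp
  have hm: "homeomorphic_maps (Surf n) (Surf n) (?d 1) (?d (n - 1))" "homeomorphic_maps (Surf n) (Surf n) (?d (n - 1)) (?d 1)"
    using n by (auto intro!: homeomorphic_maps_double_rotation)
  have po: "preserves_orientation n (?d j)" if "j \<in> {1, n - 1}" for j
  proof (rule double_map_preserves_orientation[OF bordered_map_rotation[OF n0]])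
    show "homeomorphic_map (Surf n) (Surf n) (?d j)"
      using that hm homeomorphic_maps_map by blast
    have "j < n" using that n by auto
    then show "locally_injective_at (rotation n j) p \<and> local_degree (rotation n j) p 1"
      if "p \<in> interior (holed_disk n)" for p
      using rotation_local_degree[OF n0 _ that] by blast
  qed
  have rs: "surf_rotation n 1 x = ?d 1 x" if "x \<in> surf n" for x
    using that by (simp add: surf_rotation_def)
  show ?thesis
  proof (rule homeo_plusI)
    show "homeomorphic_maps (Surf n) (Surf n) (surf_rotation n 1) (?d (n - 1))"
      by (rule homeomorphic_maps_eq[OF hm(1)]) (use rs in auto)
    show "preserves_orientation n (surf_rotation n 1)"
      unfolding preserves_orientation_def
    proof (intro allI impI)
      fix \<phi> assume \<phi>: "oriented_embedding n (ball 0 1) \<phi>"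
      then have "oriented_embedding n (ball 0 1) (?d 1 \<circ> \<phi>)"
        using po[of 1] by (simp add: preserves_orientation_def)
      moreover have "(?d 1 \<circ> \<phi>) z = (surf_rotation n 1 \<circ> \<phi>) z" if "z \<in> ball 0 1" for z
        using rs embedding_mapD(3)[of "ball 0 1" n \<phi> z] \<phi> that by (simp add: oriented_embedding_def)
      ultimately show "oriented_embedding n (ball 0 1) (surf_rotation n 1 \<circ> \<phi>)"
        using oriented_embedding_cong by blast
    qed
    show "preserves_orientation n (?d (n - 1))" using po by blast
  qed (simp add: surf_rotation_def)
qed

lemma funpow_surf_rotation:
  assumes n: "n > 0" and x: "x \<in> surf n"
  shows "(surf_rotation n 1 ^^ m) x = surf_rotation n m x"
proof (induction m)
  case 0
  then show ?case using surf_rotation_trivial(1)[OF n x] by simp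
next
  case (Suc m)
  then show ?case using surf_rotation_add[OF n x, of 1 m] by simp
qed

lemma pow_surf_rotation:
  assumes n: "n > 1"
  shows "surf_rotation n 1 [^]\<^bsub>homeo_group n\<^esub> m = surf_rotation n m"
proof (rule extensionalityI)
  interpret H: group "homeo_group n" by (rule group_homeo_group)
  have "surf_rotation n 1 [^]\<^bsub>homeo_group n\<^esub> m \<in> homeo_plus n"
    using H.nat_pow_closed[of "surf_rotation n 1" m] surf_rotation_in_homeo_plus[OF n] by simp
  then show "surf_rotation n 1 [^]\<^bsub>homeo_group n\<^esub> m \<in> extensional (surf n)"
    by (rule homeo_plusD(1))
  show "surf_rotation n m \<in> extensional (surf n)"
    by (simp add: surf_rotation_def)
  fix x assume "x \<in> surf n"
  then show "(surf_rotation n 1 [^]\<^bsub>homeo_group n\<^esub> m) x = surf_rotation n m x"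
    using pow_homeo_group(1)[OF surf_rotation_in_homeo_plus[OF n]] funpow_surf_rotation n by simp
qed

lemma surf_rotation_nbhd_a:
  assumes n: "n > 0" and k: "k \<in> {1..n}" "k' \<in> {1..n}" "k' = k + j \<or> k' + n = k + j" and z: "z \<in> annulus"
  shows "surf_rotation n j (nbhd_a n k z) = nbhd_a n k' z"
proof -
  note b = strip_a_bounds[OF z, of k]
  have "rotation n j (Complex (real k + (Re (strip_a k z) - real k)) (Im (strip_a k z))) =
      Complex (real k' + (Re (strip_a k z) - real k)) (Im (strip_a k z))"
    by (rule rotation_column[OF n k]) (use b in auto)
  then have "rotation n j (strip_a k z) = strip_a k' z"
    by (simp add: strip_a_def)
  moreover have "sgn (snd (nbhd_a n k z)) = sgn (Im z)"
    using nbhd_a_infdist[OF k(1) z] infdist_nonneg[of "strip_a k z" "frontier (holed_disk n)"]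
    by (auto simp: nbhd_a_def sgn_mult sgn_if)
  ultimately show ?thesis
    using nbhd_a_in_surf[OF k(1) z] by (simp add: surf_rotation_def double_map_def nbhd_a_def)
qed

lemma quotient_rotation:
  assumes n: "n > 0" and p: "p \<in> rect n"
  shows "quotient n (rotation n j p) = quotient n p"
  using angle_power_rotate[of n "2 * pi * real j / real n" "disk_chart n p"]
  unfolding quotient_def conjugate_map_def rotation_chart(1)[OF n p] cis_root_power[OF n] by simp

text \<open>A continuous surjection from a compact to a Hausdorff space is a quotient map. Its
  fibres are the orbits because the double keeps the sheets apart and the planar fibres are orbits
  of the planar rotation.\<close>

lemma quotient_genus_surf_rotation:
  assumes n: "n > 0"
  shows "quotient_genus n (surf_rotation n 1) 1"
  unfolding quotient_genus_def
proof (intro exI[of _ "double_map (holed_disk 1) (quotient n)"] conjI ballI)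
  let ?Q = "double_map (holed_disk 1) (quotient n)"
  note bq = bordered_map_quotient[OF n]
  show "quotient_map (Surf n) (Surf 1) ?Q"
  proof (rule T1_Spaces.continuous_imp_quotient_map)
    show "continuous_map (Surf n) (Surf 1) ?Q"
      using continuous_on_double_map[OF bq] double_map_in_double[OF bq] by (auto simp: surf_def)
    show "compact_space (Surf n)"
      using compact_surf by (simp add: compact_space_subtopology)
    show "Hausdorff_space (Surf 1)"
      by (simp add: Hausdorff_space_subtopology)
    show "?Q ` topspace (Surf n) = topspace (Surf 1)"
      using image_double_map[OF bq quotient_image[OF n]] by (simp add: surf_def)
  qed
  fix x y assume x: "x \<in> surf n" and y: "y \<in> surf n"
  have eq: "surf_rotation n j x = y \<longleftrightarrow> rotation n j (fst x) = fst y \<and> sgn (snd x) = sgn (snd y)" for j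
  proof -
    have "surf_rotation n j x = y \<longleftrightarrow> fst (surf_rotation n j x) = fst y \<and> sgn (snd (surf_rotation n j x)) = sgn (snd y)"
      using double_eq_iff[of "surf_rotation n j x" "holed_disk n" y] surf_rotation_in_surf[OF n x] y
      by (simp add: surf_def)
    also have "sgn (snd (surf_rotation n j x)) = sgn (snd x)"
      using sgn_double_map[OF bordered_map_rotation[OF n]] x by (simp add: surf_rotation_def surf_def)
    also have "fst (surf_rotation n j x) = rotation n j (fst x)"
      using x by (simp add: surf_rotation_def)
    finally show ?thesis .
  qed
  have "?Q x = ?Q y \<longleftrightarrow> quotient n (fst x) = quotient n (fst y) \<and> sgn (snd x) = sgn (snd y)"
    using double_map_eq_iff[OF bq bq] x y by (simp add: surf_def)
  also have "\<dots> \<longleftrightarrow> (\<exists>j. rotation n j (fst x) = fst y \<and> sgn (snd x) = sgn (snd y))"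
    using quotient_eq_iff[OF n surf_fst_rect[OF x] surf_fst_rect[OF y]] quotient_rotation[OF n surf_fst_rect[OF x]]
    by metis
  also have "\<dots> \<longleftrightarrow> (\<exists>m. (surf_rotation n 1 ^^ m) x = y)"
    unfolding funpow_surf_rotation[OF n x] eq ..
  finally show "?Q x = ?Q y \<longleftrightarrow> (\<exists>m. (surf_rotation n 1 ^^ m) x = y)" .
qed

text \<open>The factor \<open>1/2\<close> keeps the disk clear of the holes, which lie at radius at least \<open>7/12\<close>.\<close>

definition central_disk :: "nat \<Rightarrow> complex \<Rightarrow> complex" where
  "central_disk n z = disk_param n (z / 2)"

definition central_lift :: "nat \<Rightarrow> real \<Rightarrow> complex \<Rightarrow> complex \<times> real" where
  "central_lift n s z = (central_disk n z, s * infdist (central_disk n z) (frontier (holed_disk n)))"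

lemma central_disk:
  assumes n: "n > 0" and z: "z \<in> ball 0 1"
  shows "disk_chart n (central_disk n z) = z / 2" "central_disk n z \<in> interior (holed_disk n)"
    "central_disk n z \<in> rect n"
proof -
  have "z / 2 \<in> cball 0 1" using z by (simp add: norm_divide)
  note c = disk_chart_param[OF n this]
  show 1: "disk_chart n (central_disk n z) = z / 2" and 2: "central_disk n z \<in> rect n"
    using c by (simp_all add: central_disk_def)
  have small: "norm (z / 2) < 1/2" using z by (simp add: norm_divide)
  have far: "norm w > 1/2" if "w \<in> closed_hole" for w
  proof -
    obtain u where "u \<in> {-1/4..1/4} \<times> {3/4..5/4}" "w = (case u of (\<sigma>, y) \<Rightarrow> of_real (1 - y / 3) * cis (2 * pi * \<sigma>))"
      using \<open>w \<in> closed_hole\<close> unfolding closed_hole_def by (rule imageE)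
    then show ?thesis by (cases u) (simp add: norm_mult del: of_real_diff of_real_divide)
  qed
  have "central_disk n z \<in> box 0 (Complex (real n + 1) 2)"
    using norm_disk_chart_rect(2)[OF 2] small unfolding 1 by auto
  moreover have "angle_power n (disk_chart n (central_disk n z)) \<notin> closed_hole"
    using far[of "angle_power n (z / 2)"] small unfolding 1 by auto
  ultimately show "central_disk n z \<in> interior (holed_disk n)"
    using in_hole_iff(2)[OF n 2] by (simp add: in_interior_holed_disk_iff)
qed

lemma continuous_on_central_disk: "n > 0 \<Longrightarrow> continuous_on (ball 0 1) (central_disk n)"
  unfolding central_disk_def
  by (rule continuous_on_compose2[OF continuous_on_disk_param]) (auto intro!: continuous_intros simp: norm_divide)

lemma inj_on_central_disk: "n > 0 \<Longrightarrow> inj_on (central_disk n) (ball 0 1)"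
  using central_disk(1)[of n] by (intro inj_onI) (metis divide_cancel_right zero_neq_numeral)

lemma infdist_central_disk:
  assumes "n > 0" "z \<in> ball 0 1"
  shows "infdist (central_disk n z) (frontier (holed_disk n)) > 0"
proof -
  have "central_disk n z \<notin> frontier (holed_disk n)"
    using central_disk(2)[OF assms] by (simp add: frontier_def)
  then have "infdist (central_disk n z) (frontier (holed_disk n)) \<noteq> 0"
    using in_closed_iff_infdist_zero[OF frontier_closed frontier_holed_disk_nonempty] by metis
  then show ?thesis
    using infdist_nonneg[of "central_disk n z" "frontier (holed_disk n)"] by linarith
qed

lemma central_lift_in_surf:
  assumes "n > 0" "z \<in> ball 0 1" "s \<in> {1, -1}"
  shows "central_lift n s z \<in> surf n" "sgn (snd (central_lift n s z)) = s"
  using central_disk(2)[OF assms(1,2)] infdist_central_disk[OF assms(1,2)] assms(3) interior_subset[of "holed_disk n"]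
  by (auto simp: central_lift_def surf_def double_def abs_mult sgn_mult)

lemma surf_rotation_central_lift:
  assumes n: "n > 0" and z: "z \<in> ball 0 1" and s: "s \<in> {1, -1}"
  shows "surf_rotation n 1 (central_lift n s z) = central_lift n s (cis (2 * pi / real n) * z)"
proof -
  have zr: "cis (2 * pi / real n) * z \<in> ball 0 1" using z by (simp add: norm_mult)
  have "rotation n 1 (central_disk n z) = central_disk n (cis (2 * pi / real n) * z)"
    by (rule rect_eqI[OF n rotation_chart(2)[OF n central_disk(3)[OF n z]] central_disk(3)[OF n zr]])
       (simp add: rotation_chart(1)[OF n central_disk(3)[OF n z]] central_disk(1)[OF n z] central_disk(1)[OF n zr])
  moreover have "fst (central_lift n s w) = central_disk n w" for w
    by (simp add: central_lift_def)
  ultimately show ?thesis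
    using central_lift_in_surf[OF n z s] by (simp add: surf_rotation_def double_map_def) (simp add: central_lift_def)
qed

section \<open>Oriented charts at the two fixed points\<close>

lemma embedding_map_leftinverse:
  assumes "continuous_on S \<phi>" "\<And>z. z \<in> S \<Longrightarrow> \<phi> z \<in> surf n" "continuous_on (\<phi> ` S) \<psi>" "\<And>z. z \<in> S \<Longrightarrow> \<psi> (\<phi> z) = z"
  shows "embedding_map (top_of_set S) (Surf n) \<phi>"
proof -
  have sub: "\<phi> ` S \<subseteq> surf n" using assms(2) by blast
  have "homeomorphic_maps (top_of_set S) (top_of_set (\<phi> ` S)) \<phi> \<psi>"
    using assms by (auto simp: homeomorphic_maps_def)
  then have "homeomorphic_map (top_of_set S) (top_of_set (\<phi> ` S)) \<phi>"
    using homeomorphic_maps_map by blast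
  moreover have "subtopology (Surf n) (\<phi> ` S) = top_of_set (\<phi> ` S)"
    using sub by (simp add: subtopology_subtopology inf.absorb2)
  ultimately show ?thesis
    by (simp add: embedding_map_def)
qed

text \<open>The involution \<open>c\<close> stands for the identity on one sheet and for complex
  conjugation on the other, where the disk has to be reflected to become an oriented chart.\<close>

lemma embedding_central_lift:
  assumes n: "n > 0" and s: "s \<in> {1, -1}" and c: "continuous_on UNIV c" "\<And>z. norm (c z) = norm z" "\<And>z. c (c z) = z"
  shows "embedding_map (top_of_set (ball 0 1)) (Surf n) (central_lift n s \<circ> c)"
proof (rule embedding_map_leftinverse)
  have cc: "continuous_on (ball 0 1) (\<lambda>z. central_disk n (c z))"
    by (rule continuous_on_compose2[OF continuous_on_central_disk[OF n]])
       (use c in \<open>auto intro: continuous_on_subset\<close>)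
  then show "continuous_on (ball 0 1) (central_lift n s \<circ> c)"
    unfolding central_lift_def o_def by (intro continuous_intros)
  show "(central_lift n s \<circ> c) z \<in> surf n" if "z \<in> ball 0 1" for z
    using central_lift_in_surf(1)[OF n _ s, of "c z"] that c(2) by simp
  have "continuous_on ((central_lift n s \<circ> c) ` ball 0 1) (\<lambda>x. disk_chart n (fst x))"
  proof (rule continuous_on_compose2[OF continuous_on_disk_chart[OF n]])
    show "fst ` ((central_lift n s \<circ> c) ` ball 0 1) \<subseteq> rect n"
      using central_disk(3)[OF n] c(2) by (auto simp: central_lift_def)
  qed (intro continuous_intros)
  then show "continuous_on ((central_lift n s \<circ> c) ` ball 0 1) (\<lambda>x. c (2 * disk_chart n (fst x)))"
    by (intro continuous_on_compose2[OF c(1)] continuous_intros) auto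
  show "c (2 * disk_chart n (fst ((central_lift n s \<circ> c) z))) = z" if "z \<in> ball 0 1" for z
  proof -
    have "2 * disk_chart n (central_disk n (c z)) = c z"
    proof -
      have "c z \<in> ball 0 1" using that c(2) by simp
      then show ?thesis unfolding central_disk(1)[OF n \<open>c z \<in> ball 0 1\<close>] by simp
    qed
    then show ?thesis
      using c(3) by (simp add: central_lift_def)
  qed
qed

text \<open>The planar disk has some degree \<open>e\<close>, and its lift to the sheet of sign
  \<open>e\<close> is oriented. There the rotation angle is \<open>2 pi / n\<close>. On the opposite
  sheet the reflected disk is oriented, and reflection turns the angle into
  \<open>- 2 pi / n\<close>, which is \<open>2 pi (n - 1) / n\<close> modulo
  \<open>2 pi\<close>.\<close>

lemma has_data_set_surf_rotation:
  assumes n: "n > 1" and ord: "group.ord (homeo_group n) (surf_rotation n 1) = n"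
  shows "has_data_set_D n (mapping_class n (surf_rotation n 1))"
proof -
  have n0: "n > 0" using n by simp
  let ?f = "surf_rotation n 1"
  have "0 \<in> ball (0::complex) 1" by simp
  have cont: "continuous_on (ball 0 1) (central_disk n)" and inj: "inj_on (central_disk n) (ball 0 1)"
    using continuous_on_central_disk[OF n0] inj_on_central_disk[OF n0] .
  have li: "locally_injective_at (central_disk n) z" if "z \<in> ball 0 1" for z
    by (rule locally_injective_atI[OF open_ball that cont inj])
  obtain e where e: "e \<in> {1, -1}" "local_degree (central_disk n) 0 e"
    using locally_injective_at_local_degree[OF li[OF \<open>0 \<in> ball 0 1\<close>]] by blast
  have deg: "local_degree (central_disk n) z e" if "z \<in> ball 0 1" for z
    using e(2) local_degree_const[OF open_ball convex_ball cont inj \<open>0 \<in> ball 0 1\<close> that] by blast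
  have e': "- e \<in> {1, -1}" using e(1) by auto
  have fl: "fst \<circ> (central_lift n s \<circ> c) = central_disk n \<circ> c" for s c
    by (auto simp: central_lift_def)
  have or1: "oriented_embedding n (ball 0 1) (central_lift n e \<circ> id)"
    unfolding oriented_embedding_def
  proof (intro conjI ballI impI embedding_central_lift n0 e(1))
    fix z :: complex assume "z \<in> interior (ball 0 1)"
    then have z: "z \<in> ball 0 1" by (simp add: interior_open)
    show "local_degree (fst \<circ> (central_lift n e \<circ> id)) z (sgn (snd ((central_lift n e \<circ> id) z)))"
      unfolding fl using deg[OF z] central_lift_in_surf(2)[OF n0 z e(1)] by simp
  qed (auto intro: continuous_on_id)
  have or2: "oriented_embedding n (ball 0 1) (central_lift n (- e) \<circ> cnj)"
    unfolding oriented_embedding_def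
  proof (intro conjI ballI impI embedding_central_lift n0 e')
    fix z :: complex assume "z \<in> interior (ball 0 1)"
    then have z: "cnj z \<in> ball 0 1" by (simp add: interior_open)
    have "locally_injective_at cnj z"
      by (rule locally_injective_atI[of UNIV]) (auto intro: continuous_on_cnj continuous_on_id inj_onI)
    then have "local_degree (central_disk n \<circ> cnj) z (e * (-1))"
      using local_degree_cnj li[OF z] deg[OF z] by (intro local_degree_compose)
    then show "local_degree (fst \<circ> (central_lift n (- e) \<circ> cnj)) z (sgn (snd ((central_lift n (- e) \<circ> cnj) z)))"
      unfolding fl using central_lift_in_surf(2)[OF n0 z e'] by simp
  qed (auto intro: continuous_on_cnj continuous_on_id)
  let ?p = "central_lift n e 0" and ?q = "central_lift n (- e) 0"
  have pq: "?p \<in> surf n" "?q \<in> surf n" "sgn (snd ?p) = e" "sgn (snd ?q) = - e"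
    using central_lift_in_surf[OF n0 \<open>0 \<in> ball 0 1\<close>] e(1) e' by auto
  have "\<exists>p\<in>surf n. \<exists>q\<in>surf n. p \<noteq> q \<and> ?f p = p \<and> ?f q = q \<and>
      local_rotation n ?f p (2 * pi / real n) \<and> local_rotation n ?f q (2 * pi * (real n - 1) / real n) \<and>
      (\<forall>x\<in>surf n - {p, q}. \<forall>m\<in>{1..<n}. (?f ^^ m) x \<noteq> x)"
  proof (rule bexI[OF _ pq(1)], rule bexI[OF _ pq(2)], intro conjI ballI)
    have "e \<noteq> - e" using e(1) by auto
    then show "?p \<noteq> ?q" using pq(3,4) by metis
    show "?f ?p = ?p" "?f ?q = ?q"
      using surf_rotation_central_lift[OF n0 \<open>0 \<in> ball 0 1\<close> e(1)] surf_rotation_central_lift[OF n0 \<open>0 \<in> ball 0 1\<close> e'] by simp_all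
    show "local_rotation n ?f ?p (2 * pi / real n)"
      unfolding local_rotation_def
      by (rule exI[of _ "central_lift n e \<circ> id"])
         (use or1 surf_rotation_central_lift[OF n0 _ e(1)] in auto)
    have cis: "cis (2 * pi * (real n - 1) / real n) = cis (- (2 * pi / real n))"
    proof -
      have "2 * pi * (real n - 1) / real n = 2 * pi + - (2 * pi / real n)"
        using n0 by (simp add: field_simps)
      moreover have "cis (2 * pi + - (2 * pi / real n)) = cis (2 * pi) * cis (- (2 * pi / real n))"
        by (rule cis_mult[symmetric])
      ultimately show ?thesis by (simp only: cis_2pi mult_1_left)
    qed
    show "local_rotation n ?f ?q (2 * pi * (real n - 1) / real n)"
      unfolding local_rotation_def cis
    proof (intro exI[of _ "central_lift n (- e) \<circ> cnj"] conjI ballI or2)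
      fix z :: complex assume "z \<in> ball 0 1"
      then have "cnj z \<in> ball 0 1" by simp
      from surf_rotation_central_lift[OF n0 this e']
      show "?f ((central_lift n (- e) \<circ> cnj) z) = (central_lift n (- e) \<circ> cnj) (cis (- (2 * pi / real n)) * z)"
        by (simp add: cis_cnj)
    qed simp
    fix x m assume x: "x \<in> surf n - {?p, ?q}" and m: "m \<in> {1..<n}"
    show "(?f ^^ m) x \<noteq> x"
    proof
      assume "(?f ^^ m) x = x"
      then have "surf_rotation n m x = x"
        using funpow_surf_rotation[OF n0] x by simp
      then have "rotation n m (fst x) = fst x"
        using x by (metis DiffD1 fst_double_map restrict_apply' surf_rotation_def)
      then have "disk_chart n (fst x) = 0"
        using rotation_fixed_iff[OF n0 surf_fst_rect] x m by auto
      \<comment> \<open>A point fixed by a nontrivial power lies over the centre of the disk. The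
        centre is off the seam, so exactly one such point lies on each sheet.\<close>
      then have fx: "fst x = central_disk n 0"
        using rect_eqI[OF n0, of "fst x" "central_disk n 0"] surf_fst_rect x central_disk[OF n0 \<open>0 \<in> ball 0 1\<close>] by simp
      then have "fst x \<notin> frontier (holed_disk n)"
        using central_disk(2)[OF n0 \<open>0 \<in> ball 0 1\<close>] by (simp add: frontier_def)
      then have "snd x \<noteq> 0"
        using double_snd_eq_0_iff[of x "holed_disk n"] frontier_holed_disk_nonempty x by (auto simp: surf_def)
      then have "sgn (snd x) = e \<or> sgn (snd x) = - e"
        using e(1) by (auto simp: sgn_if)
      then have "x = ?p \<or> x = ?q"
        using double_eq_iff[of x "holed_disk n"] pq x fx by (auto simp: surf_def central_lift_def)
      then show False using x by blast
    qed
  qed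
  then show ?thesis
    unfolding has_data_set_D_def
    using ord quotient_genus_surf_rotation[OF n0] surf_rotation_in_homeo_plus[OF n] by blast
qed


section \<open>The powers of the rotation are not isotopic to the identity\<close>

text \<open>The map \<open>hole_winding\<close> to the circle is the collapse of a neighbourhood of the boundary of the first hole:
  the signed distance to this boundary becomes the angle.  It has degree \<open>1\<close> on \<open>a\<^sub>1\<close>, and it is constant on
  every other \<open>a\<^sub>i\<close>.\<close>

definition hole_dist :: "complex \<Rightarrow> real" where
  "hole_dist p = min 1 (max 0 (4 * (max \<bar>Re p - 1\<bar> \<bar>Im p - 1\<bar> - 1/4)))"

definition hole_winding :: "complex \<times> real \<Rightarrow> complex" where
  "hole_winding x = Complex (cos (pi * hole_dist (fst x))) (sgn (snd x) * sin (pi * hole_dist (fst x)))"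

lemma hole_dist_bounds: "0 \<le> hole_dist p" "hole_dist p \<le> 1"
  by (simp_all add: hole_dist_def)

lemma hole_dist_eq_1: "\<bar>Re p - 1\<bar> \<ge> 1/2 \<or> \<bar>Im p - 1\<bar> \<ge> 1/2 \<Longrightarrow> hole_dist p = 1"
  by (auto simp: hole_dist_def min_def max_def)

text \<open>The value rises from 0 to 1 between the distances 1/4 and 1/2 from the centre of the
  first hole in the maximum norm: it starts on the boundary of this hole and is 1 before any other
  part of the frontier. Hence the sine vanishes on the seam and \<open>hole_winding\<close> is
  continuous across it.\<close>

lemma hole_dist_frontier:
  assumes n: "n > 0" and "p \<in> frontier (holed_disk n)"
  shows "hole_dist p \<in> {0, 1}"
proof -
  have p: "p \<in> rect n"
    using assms(2) holed_disk_subset_rect unfolding in_frontier_holed_disk_iff by blast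
  consider "p \<notin> box 0 (Complex (real n + 1) 2)"
    | i where "i \<in> {1..n}" "p \<in> cbox (Complex (real i - 1/4) (3/4)) (Complex (real i + 1/4) (5/4))"
    using assms(2) by (auto simp: in_frontier_holed_disk_iff)
  then show ?thesis
  proof cases
    case 1
    then have "Re p = 0 \<or> Re p = real n + 1 \<or> Im p = 0 \<or> Im p = 2"
      using p by (auto simp: in_box_complex_iff in_cbox_complex_iff)
    then have "\<bar>Re p - 1\<bar> \<ge> 1/2 \<or> \<bar>Im p - 1\<bar> \<ge> 1/2"
      using n by auto
    then show ?thesis using hole_dist_eq_1 by blast
  next
    case 2
    then have b: "real i - 1/4 \<le> Re p" "Re p \<le> real i + 1/4" "3/4 \<le> Im p" "Im p \<le> 5/4"
      by (auto simp: in_cbox_complex_iff)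
    show ?thesis
    proof (cases "i = 1")
      case True
      then have "max \<bar>Re p - 1\<bar> \<bar>Im p - 1\<bar> \<le> 1/4"
        using b unfolding max.bounded_iff abs_le_iff by auto
      then show ?thesis by (simp add: hole_dist_def)
    next
      case False
      then have "real i \<ge> 2" using 2 by auto
      then have "\<bar>Re p - 1\<bar> \<ge> 1/2" using b by linarith
      then show ?thesis using hole_dist_eq_1 by blast
    qed
  qed
qed

lemma continuous_on_hole_winding:
  assumes n: "n > 0"
  shows "continuous_on (surf n) hole_winding"
proof -
  have d: "continuous_on A hole_dist" for A
    unfolding hole_dist_def by (intro continuous_intros)
  have "continuous_on (surf n) (\<lambda>x. sgn (snd x) * sin (pi * hole_dist (fst x)))"
    unfolding surf_def
  proof (rule continuous_on_sgn_double[where k = "\<lambda>p. sin (pi * hole_dist p)"])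
    show "continuous_on (holed_disk n) (\<lambda>p. sin (pi * hole_dist p))"
      by (intro continuous_intros d)
    show "sin (pi * hole_dist p) = 0" if "p \<in> frontier (holed_disk n) \<inter> holed_disk n" for p
      using hole_dist_frontier[OF n, of p] that by auto
  qed (rule frontier_holed_disk_nonempty)
  moreover have "continuous_on (surf n) (\<lambda>x. cos (pi * hole_dist (fst x)))"
    by (intro continuous_intros continuous_on_compose2[OF d]) auto
  ultimately show ?thesis
    unfolding hole_winding_def Complex_eq
    by (intro continuous_on_add continuous_on_mult_left continuous_on_of_real)
qed

lemma hole_winding_nonzero:
  assumes n: "n > 0" and x: "x \<in> surf n"
  shows "hole_winding x \<noteq> 0"
proof (cases "snd x = 0")
  case True
  then have "hole_dist (fst x) \<in> {0, 1}"
    using double_snd_eq_0_iff[of x "holed_disk n"] frontier_holed_disk_nonempty x hole_dist_frontier[OF n]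
    by (auto simp: surf_def)
  then show ?thesis by (auto simp: hole_winding_def complex_eq_iff)
next
  case False
  have "norm (Complex (cos t) (sin t)) = 1" for t by (simp add: cmod_def)
  then show ?thesis
    using False sin_zero_abs_cos_one[of "pi * hole_dist (fst x)"]
    by (auto simp: hole_winding_def complex_eq_iff sgn_zero_iff)
qed

definition core_loop :: "nat \<Rightarrow> nat \<Rightarrow> real \<Rightarrow> complex \<times> real" where
  "core_loop n i = nbhd_a n i \<circ> circlepath 0 (3/2)"

lemma circlepath_annulus: "circlepath 0 (3/2) t \<in> annulus" "norm (circlepath 0 (3/2) t) = 3/2"
  by (simp_all add: circlepath annulus_def norm_mult norm_exp_eq_Re)

lemma continuous_on_core_loop:
  assumes "i \<in> {1..n}"
  shows "continuous_on {0..1} (core_loop n i)"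
  unfolding core_loop_def
  by (intro continuous_on_compose continuous_on_subset[OF continuous_on_nbhd_a[OF assms]])
     (auto simp: circlepath_annulus path_circlepath simp flip: path_def)

text \<open>The straight homotopy to the circle never passes through 0. Off the real axis the
  imaginary parts are not of opposite sign, and they vanish together only at the stage where the
  unit vector itself is reached. On the axis the top of the curve lies on the boundary of the hole
  and gives 1, and the bottom gives -1, as on the circle.\<close>

lemma winding_number_core_loop_1:
  assumes n: "n > 0"
  shows "winding_number (hole_winding \<circ> core_loop n 1) 0 = 1"
proof -
  have i: "1 \<in> {1..n}" using n by simp
  let ?c = "circlepath 0 (3/2) :: real \<Rightarrow> complex" and ?L = "hole_winding \<circ> core_loop n 1"
  have "winding_number ?L 0 = winding_number ?c 0"
  proof (rule winding_number_loops_linear_eq)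
    show "path ?L"
      unfolding path_def
      by (intro continuous_on_compose continuous_on_core_loop[OF i] continuous_on_subset[OF continuous_on_hole_winding[OF n]])
         (use nbhd_a_in_surf[OF i] circlepath_annulus in \<open>auto simp: core_loop_def\<close>)
    show "pathfinish ?L = pathstart ?L"
      by (simp add: pathfinish_def pathstart_def core_loop_def circlepath)
    show "0 \<notin> closed_segment (?c t) (?L t)" for t
    proof
      assume "0 \<in> closed_segment (?c t) (?L t)"
      then obtain u where u: "0 \<le> u" "u \<le> 1" "0 = (1 - u) *\<^sub>R ?c t + u *\<^sub>R ?L t"
        by (auto simp: closed_segment_def)
      define z where "z = ?c t"
      have z: "z \<in> annulus" "norm z = 3/2" using circlepath_annulus by (simp_all add: z_def)
      define \<omega> where "\<omega> = hole_dist (fst (nbhd_a n 1 z))"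
      have "sgn (snd (nbhd_a n 1 z)) = sgn (Im z)"
        using nbhd_a_infdist[OF i z(1)] infdist_nonneg[of "strip_a 1 z" "frontier (holed_disk n)"]
        by (auto simp: nbhd_a_def sgn_mult sgn_if)
      then have L: "Re (?L t) = cos (pi * \<omega>)" "Im (?L t) = sgn (Im z) * sin (pi * \<omega>)"
        by (simp_all add: hole_winding_def core_loop_def \<omega>_def z_def)
      have re: "(1 - u) * Re z + u * cos (pi * \<omega>) = 0"
        using arg_cong[OF u(3), of Re] by (simp add: z_def L(1)[symmetric])
      have im: "(1 - u) * Im z + u * (sgn (Im z) * sin (pi * \<omega>)) = 0"
        using arg_cong[OF u(3), of Im] unfolding z_def[symmetric] L(2)[symmetric] by (simp add: z_def)
      have "0 \<le> \<omega>" "\<omega> \<le> 1" using hole_dist_bounds by (simp_all add: \<omega>_def)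
      then have sin: "0 \<le> sin (pi * \<omega>)"
        by (intro sin_ge_zero) (auto simp: mult_left_le)
      show False
      proof (cases "Im z = 0")
        case True
        then have "\<bar>Re z\<bar> = 3/2" using z(2) by (simp add: cmod_def)
        then consider "Re z = 3/2" | "Re z = -3/2" by linarith
        then show False
        proof cases
          case 1
          then have "\<omega> = 0"
            by (simp add: \<omega>_def nbhd_a_def strip_a_def hole_dist_def z(2))
          then show False using re 1 u by (simp add: field_simps)
        next
          case 2
          then have "\<omega> = 1"
            by (simp add: \<omega>_def nbhd_a_def strip_a_def hole_dist_def z(2))
          then show False using re 2 u by (simp add: field_simps)
        qed
      next
        case False
        have "(1 - u) * \<bar>Im z\<bar> + u * sin (pi * \<omega>) = sgn (Im z) * ((1 - u) * Im z + u * (sgn (Im z) * sin (pi * \<omega>)))"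
          using False by (simp add: sgn_if algebra_simps abs_if)
        then have "(1 - u) * \<bar>Im z\<bar> + u * sin (pi * \<omega>) = 0" using im by simp
        moreover have "(1 - u) * \<bar>Im z\<bar> \<ge> 0" "u * sin (pi * \<omega>) \<ge> 0" using u sin by auto
        ultimately have "(1 - u) * \<bar>Im z\<bar> = 0" "u * sin (pi * \<omega>) = 0" by linarith+
        then have "u = 1" "sin (pi * \<omega>) = 0" using False by auto
        then have "cos (pi * \<omega>) = 0" using re by simp
        then show False using \<open>sin (pi * \<omega>) = 0\<close> sin_zero_abs_cos_one by force
      qed
    qed
  qed auto
  then show ?thesis by (simp add: winding_number_circlepath)
qed

lemma surf_rotation_not_isotopic:
  assumes r: "0 < r" "r < n"
  shows "surf_rotation n r \<notin> homeo_0 n"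
proof
  assume "surf_rotation n r \<in> homeo_0 n"
  then have iso: "isotopic n id (surf_rotation n r)"
    by (simp add: homeo_0_def)
  have n: "n > 0" and i: "1 \<in> {1..n}" and k: "Suc r \<in> {1..n}" using r by auto
  have hw: "continuous_map (Surf n) (top_of_set (- {0})) hole_winding"
    using continuous_on_hole_winding[OF n] hole_winding_nonzero[OF n] by auto
  have cl: "continuous_map (top_of_set {0..1}) (Surf n) (core_loop n 1)"
    using continuous_on_core_loop[OF i] nbhd_a_in_surf[OF i] circlepath_annulus by (auto simp: core_loop_def)
  have loop: "core_loop n 1 1 = core_loop n 1 0"
    by (simp add: core_loop_def circlepath)
  have "homotopic_with (\<lambda>_. True) (Surf n) (top_of_set (- {0})) (hole_winding \<circ> id) (hole_winding \<circ> surf_rotation n r)"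
    by (rule homotopic_with_compose_continuous_map_left[OF iso hw]) simp
  then have "homotopic_loops (- {0}) (hole_winding \<circ> id \<circ> core_loop n 1) (hole_winding \<circ> surf_rotation n r \<circ> core_loop n 1)"
    unfolding homotopic_loops_def
    by (rule homotopic_with_compose_continuous_map_right[OF _ cl]) (simp add: pathfinish_def pathstart_def loop[simplified])
  then have "winding_number (hole_winding \<circ> id \<circ> core_loop n 1) 0 = winding_number (hole_winding \<circ> surf_rotation n r \<circ> core_loop n 1) 0"
    by (rule winding_number_homotopic_loops)
  \<comment> \<open>The image of the first curve is the curve number \<open>r + 1\<close>, at
    horizontal distance \<open>r \<ge> 1\<close> from the centre of the first hole. There the angle
    is constantly \<open>pi\<close>.\<close>
  moreover have "hole_winding \<circ> surf_rotation n r \<circ> core_loop n 1 = (\<lambda>t. - 1)"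
  proof
    fix t
    let ?z = "circlepath 0 (3/2) t"
    have "surf_rotation n r (core_loop n 1 t) = nbhd_a n (Suc r) ?z"
      using surf_rotation_nbhd_a[OF n i k _ circlepath_annulus(1), of r t] by (simp add: core_loop_def)
    moreover have "hole_dist (fst (nbhd_a n (Suc r) ?z)) = 1"
      using r by (intro hole_dist_eq_1) (simp add: nbhd_a_def strip_a_def circlepath_annulus)
    ultimately show "(hole_winding \<circ> surf_rotation n r \<circ> core_loop n 1) t = - 1"
      by (simp add: hole_winding_def complex_eq_iff)
  qed
  moreover have "winding_number (\<lambda>t. - 1) 0 = 0"
    by (rule winding_number_zero_const) simp
  ultimately show False
    using winding_number_core_loop_1[OF n] by simp
qed


section \<open>The root\<close>

lemma (in group) ord_eqI:
  assumes "x \<in> carrier G" "n > 0" "x [^] n = \<one>" "\<And>r::nat. 0 < r \<Longrightarrow> r < n \<Longrightarrow> x [^] r \<noteq> \<one>"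
  shows "ord x = n"
proof -
  have dvd: "ord x dvd n" using assms(1,3) pow_eq_id by blast
  then have "ord x > 0" using assms(2) by (auto intro: Nat.gr0I)
  then show ?thesis
    using assms(4)[of "ord x"] pow_ord_eq_1[OF assms(1)] dvd_imp_le[OF dvd assms(2)] by force
qed

lemma surf_rotation_annular_map:
  assumes n: "n > 0" and i: "i \<in> {1..<n}" and x: "x \<in> surf n"
  shows "surf_rotation n 1 (annular_map n i s x) = annular_map n (Suc i) s (surf_rotation n 1 x)"
proof -
  have k: "i \<in> {1..n}" "Suc i \<in> {1..n}" using i by auto
  have eq: "surf_rotation n 1 (nbhd_a n i z) = nbhd_a n (Suc i) z" if "z \<in> annulus" for z
    using surf_rotation_nbhd_a[OF n k _ that, of 1] by simp
  show ?thesis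
  proof (cases "x \<in> nbhd_a n i ` annulus")
    case True
    then obtain z where "z \<in> annulus" "x = nbhd_a n i z" by blast
    then show ?thesis
      using annular_map_nbhd_a[OF k(1)] annular_map_nbhd_a[OF k(2)] eq twist_by_annulus by simp
  next
    case False
    have "surf_rotation n 1 x \<notin> nbhd_a n (Suc i) ` annulus"
    proof
      assume "surf_rotation n 1 x \<in> nbhd_a n (Suc i) ` annulus"
      then obtain z where z: "z \<in> annulus" "surf_rotation n 1 x = surf_rotation n 1 (nbhd_a n i z)"
        using eq by force
      \<comment> \<open>The rotation by \<open>n - 1\<close> steps undoes the rotation by one step,
        so a point that arrives in the next strip started in strip \<open>i\<close>.\<close>
      have "surf_rotation n (n - 1) (surf_rotation n 1 y) = y" if "y \<in> surf n" for y
        using surf_rotation_add[OF n that, of "n - 1" 1] surf_rotation_trivial(2)[OF n that] n by simp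
      then have "x = nbhd_a n i z"
        using z x nbhd_a_in_surf[OF k(1) z(1)] by metis
      then show False using False z(1) by blast
    qed
    then show ?thesis
      using False annular_map_outside x surf_rotation_in_surf[OF n x] by metis
  qed
qed

theorem proposition7p6:
  fixes g :: nat
  assumes "g \<ge> 2"
  shows "\<exists>F\<in>carrier (MCG g). \<exists>G\<in>carrier (MCG g).
           F [^]\<^bsub>MCG g\<^esub> g = multitwist_a g \<and>
           F = G \<otimes>\<^bsub>MCG g\<^esub> T_a g 1 \<and>
           group.ord (MCG g) G = g \<and>
           has_data_set_D g G"
proof -
  let ?H = "homeo_group g" and ?\<mu> = "mapping_class g"
  interpret hom: group_hom ?H "MCG g" ?\<mu> by (rule group_hom_mapping_class)
  have g: "g > 0" "g > 1" "g \<ge> 1" using assms by auto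
  let ?a = "surf_rotation g 1" and ?t = "\<lambda>i. annular_map g i 1"
  have a: "?a \<in> carrier ?H" using surf_rotation_in_homeo_plus[OF g(2)] by simp
  have t: "?t i \<in> carrier ?H" if "i \<in> {1..g}" for i
    using annular_map_in_homeo_plus[OF that] by simp
  have mem: "compose (surf g) u v \<in> homeo_plus g" if "u \<in> carrier ?H" "v \<in> carrier ?H" for u v
    using compose_in_homeo_plus that by simp
  have one: "surf_rotation g g = \<one>\<^bsub>?H\<^esub>"
    using surf_rotation_trivial(2)[OF g(1)] by (auto simp: one_homeo_group surf_rotation_def)
  have ag: "?a [^]\<^bsub>?H\<^esub> g = \<one>\<^bsub>?H\<^esub>"
    using pow_surf_rotation[OF g(2)] one by simp
  have nontriv: "?\<mu> (?a [^]\<^bsub>?H\<^esub> r) \<noteq> \<one>\<^bsub>MCG g\<^esub>" if "0 < r" "r < g" for r :: nat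
  proof -
    have "?a [^]\<^bsub>?H\<^esub> r \<in> homeo_plus g"
      using hom.G.nat_pow_closed[OF a, of r] by simp
    then show ?thesis
      using mapping_class_eq_one_iff surf_rotation_not_isotopic[OF that] pow_surf_rotation[OF g(2)] by metis
  qed
  have "(?a \<otimes>\<^bsub>?H\<^esub> ?t 1) [^]\<^bsub>?H\<^esub> g = foldr (\<lambda>i u. ?t i \<otimes>\<^bsub>?H\<^esub> u) [1..<Suc g] \<one>\<^bsub>?H\<^esub>"
  proof (rule hom.G.pow_cyclic_conjugates[OF a ag g(3) t])
    fix i assume i: "i \<in> {1..<g}"
    then have ti: "?t i \<in> homeo_plus g" "?t (Suc i) \<in> homeo_plus g" "?a \<in> homeo_plus g"
      using t[of i] t[of "Suc i"] a by auto
    then show "?a \<otimes>\<^bsub>?H\<^esub> ?t i = ?t (Suc i) \<otimes>\<^bsub>?H\<^esub> ?a"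
      using surf_rotation_annular_map[OF g(1) i] by (auto simp: mult_homeo_group compose_def)
  next
    fix i assume i: "i \<in> {1..g}"
    have "1 \<in> {1..g}" using g by simp
    then show "?t 1 \<otimes>\<^bsub>?H\<^esub> ?t i = ?t i \<otimes>\<^bsub>?H\<^esub> ?t 1"
      using t[OF i] t[of 1] annular_map_commute[OF _ i] by (auto simp: mult_homeo_group compose_def)
  qed
  moreover have "?\<mu> (foldr (\<lambda>i u. ?t i \<otimes>\<^bsub>?H\<^esub> u) xs \<one>\<^bsub>?H\<^esub>) = foldr (\<lambda>i u. T_a g i \<otimes>\<^bsub>MCG g\<^esub> u) xs \<one>\<^bsub>MCG g\<^esub>"
    if "set xs \<subseteq> {1..g}" for xs
    using that
  proof (induction xs)
    case (Cons i xs)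
    have "foldr (\<lambda>i u. ?t i \<otimes>\<^bsub>?H\<^esub> u) xs \<one>\<^bsub>?H\<^esub> \<in> carrier ?H"
      using Cons.prems t hom.G.one_closed by (intro hom.G.foldr_mult_closed) (auto simp del: carrier_homeo_group)
    then show ?case
      using Cons t[of i] hom.hom_mult by (simp add: T_a_def dehn_twist_def twist_map_eq)
  qed simp
  ultimately have pow: "?\<mu> ((?a \<otimes>\<^bsub>?H\<^esub> ?t 1) [^]\<^bsub>?H\<^esub> g) = multitwist_a g"
    unfolding multitwist_a_def by (metis atLeastAtMost_upt order_refl)
  have t1: "?t 1 \<in> carrier ?H" using t g by simp
  show ?thesis
  proof (intro bexI conjI)
    show "?\<mu> (?a \<otimes>\<^bsub>?H\<^esub> ?t 1) [^]\<^bsub>MCG g\<^esub> g = multitwist_a g"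
      using pow hom.hom_nat_pow[OF hom.G.m_closed[OF a t1], of g] by metis
    show "?\<mu> (?a \<otimes>\<^bsub>?H\<^esub> ?t 1) = ?\<mu> ?a \<otimes>\<^bsub>MCG g\<^esub> T_a g 1"
      using hom.hom_mult[OF a t1] by (simp add: T_a_def dehn_twist_def twist_map_eq)
    show "group.ord (MCG g) (?\<mu> ?a) = g"
    proof (rule hom.H.ord_eqI[OF hom.hom_closed[OF a] g(1)])
      show "?\<mu> ?a [^]\<^bsub>MCG g\<^esub> g = \<one>\<^bsub>MCG g\<^esub>"
        using hom.hom_nat_pow[OF a, of g] ag by simp
      show "?\<mu> ?a [^]\<^bsub>MCG g\<^esub> r \<noteq> \<one>\<^bsub>MCG g\<^esub>" if "0 < r" "r < g" for r :: nat
        using hom.hom_nat_pow[OF a, of r] nontriv[OF that] by simp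
    qed
    \<comment> \<open>A power of the rotation that is trivial as a map would have the trivial class,
      so \<open>nontriv\<close> also gives the order among homeomorphisms.\<close>
    have "group.ord ?H ?a = g"
      using nontriv hom.hom_one by (intro hom.G.ord_eqI[OF a g(1) ag]) metis
    then show "has_data_set_D g (?\<mu> ?a)"
      by (rule has_data_set_surf_rotation[OF g(2)])
    show "?\<mu> ?a \<in> carrier (MCG g)" "?\<mu> (?a \<otimes>\<^bsub>?H\<^esub> ?t 1) \<in> carrier (MCG g)"
      using hom.hom_closed a t1 by auto
  qed
qed

end
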